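(* Let $p\ge2$ and $s\in(0,1)$. There exist $\alpha_0\in(0,1)$ and $c>0$, depending only on $n$, $p$ and $s$, such that the following holds. Let $\Omega\subset\mathbb{R}^n$ be a bounded domain, let $M>0$, and let $u$ be a minimizer of $\mathcal I_M$ in $\Omega$. Then, for every ball $B_{4R}(x_0)\subset\Omega$, $$[u]_{C^{\alpha_0}(B_R(x_0))}\le \frac{c}{R^{\alpha_0}}\left[\operatorname{Tail}(u;x_0,2R)+\left(\frac{1}{|B_{4R}(x_0)|}\int_{B_{4R}(x_0)}|u|^p\,dx\right)^{1/p}+M^{1/p}R^s\right].$$
   Context: $W^{s,p}(\mathbb{R}^n)$ is the space of $u\in L^p(\mathbb{R}^n)$ with $\int_{\mathbb{R}^n}\int_{\mathbb{R}^n}\frac{|u(x)-u(y)|^p}{|x-y|^{n+sp}}\,dx\,dy<\infty$. The functional is $\mathcal I_M(u):=\int_{\mathbb{R}^n}\int_{\mathbb{R}^n}\frac{|u(x)-u(y)|^p}{|x-y|^{n+sp}}\,dx\,dy+M\,|\{u>0\}\cap\Omega|$. Given $g\in W^{s,p}(\mathbb{R}^n)$, $\mathcal A_g(\Omega):=\{v\in W^{s,p}(\mathbb{R}^n): v=g\text{ a.e. in }\mathbb{R}^n\setminus\Omega\}$. A minimizer of $\mathcal I_M$ in $\Omega$ is a function $u\in\mathcal A_g(\Omega)$, for some exterior datum $g\in W^{s,p}(\mathbb{R}^n)$ with $g\ge0$ a.e. in $\mathbb{R}^n\setminus\Omega$, such that $\mathcal I_M(u)\le\mathcal I_M(v)$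 for every $v\in\mathcal A_g(\Omega)$. The nonlocal tail is $\operatorname{Tail}(u;x_0,r):=\left(r^{sp}\int_{\mathbb{R}^n\setminus B_r(x_0)}\frac{|u(y)|^{p-1}}{|y-x_0|^{n+sp}}\,dy\right)^{1/(p-1)}$. $[u]_{C^{\alpha}(B)}=\sup_{x\ne y\in B}\frac{|u(x)-u(y)|}{|x-y|^{\alpha}}$ is the Hölder seminorm; the estimate is understood to assert that $u$ has a representative (a.e. equal) for which it holds. *)

theory Defs
  imports "HOL-Analysis.Analysis"
begin

text \<open>Functions on $R^n$ are Lebesgue measurable, not necessarily Borel, so all integrals are
  taken with respect to \<^term>\<open>lebesgue\<close>. The dimension is $n$ = \<^term>\<open>CARD('n)\<close>.\<close>

text \<open>On the diagonal the integrand is $0/0$, which is $0$ in HOL; the diagonal is a null set.\<close>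

definition gagliardo :: "real \<Rightarrow> real \<Rightarrow> (real ^ 'n \<Rightarrow> real) \<Rightarrow> ennreal" where
  "gagliardo s p u =
     (\<integral>\<^sup>+x. (\<integral>\<^sup>+y. ennreal (\<bar>u x - u y\<bar> powr p / norm (x - y) powr (real CARD('n) + s * p))
        \<partial>lebesgue) \<partial>lebesgue)"

definition frac_sobolev :: "real \<Rightarrow> real \<Rightarrow> (real ^ 'n \<Rightarrow> real) set" where
  "frac_sobolev s p =
     {u. u \<in> borel_measurable lebesgue \<and> integrable lebesgue (\<lambda>x. \<bar>u x\<bar> powr p)
         \<and> gagliardo s p u < \<infinity>}"

definition energy ::
  "real \<Rightarrow> real \<Rightarrow> real \<Rightarrow> (real ^ 'n) set \<Rightarrow> (real ^ 'n \<Rightarrow> real) \<Rightarrow> ennreal" where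
  "energy s p M \<Omega> u = gagliardo s p u + ennreal M * emeasure lebesgue ({x. u x > 0} \<inter> \<Omega>)"

definition admissible ::
  "real \<Rightarrow> real \<Rightarrow> (real ^ 'n \<Rightarrow> real) \<Rightarrow> (real ^ 'n) set \<Rightarrow> (real ^ 'n \<Rightarrow> real) set" where
  "admissible s p g \<Omega> = {v \<in> frac_sobolev s p. AE x in lebesgue. x \<notin> \<Omega> \<longrightarrow> v x = g x}"

definition is_minimizer ::
  "real \<Rightarrow> real \<Rightarrow> real \<Rightarrow> (real ^ 'n) set \<Rightarrow> (real ^ 'n \<Rightarrow> real) \<Rightarrow> bool" where
  "is_minimizer s p M \<Omega> u \<longleftrightarrow>
     (\<exists>g \<in> frac_sobolev s p.
        (AE x in lebesgue. x \<notin> \<Omega> \<longrightarrow> g x \<ge> 0) \<and>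
        u \<in> admissible s p g \<Omega> \<and>
        (\<forall>v \<in> admissible s p g \<Omega>. energy s p M \<Omega> u \<le> energy s p M \<Omega> v))"

text \<open>For \<open>u \<in> frac_sobolev s p\<close>, \<open>p > 1\<close>, \<open>s > 0\<close> and \<open>r > 0\<close> the integrand below is integrable
  by Hoelder's inequality, so the Bochner integral does not take its default value $0$.\<close>

definition tail :: "real \<Rightarrow> real \<Rightarrow> (real ^ 'n \<Rightarrow> real) \<Rightarrow> real ^ 'n \<Rightarrow> real \<Rightarrow> real" where
  "tail s p u x0 r =
     (r powr (s * p) *
       (LINT y:(- ball x0 r)|lebesgue.
          \<bar>u y\<bar> powr (p - 1) / norm (y - x0) powr (real CARD('n) + s * p))) powr (1 / (p - 1))"

text \<open>Extended-valued, so that a finite upper bound asserts finiteness.\<close>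

definition holder_seminorm :: "real \<Rightarrow> (real ^ 'n) set \<Rightarrow> (real ^ 'n \<Rightarrow> real) \<Rightarrow> ennreal" where
  "holder_seminorm \<alpha> B u =
     (SUP (x, y) \<in> {(x, y). x \<in> B \<and> y \<in> B \<and> x \<noteq> y}.
        ennreal (\<bar>u x - u y\<bar> / norm (x - y) powr \<alpha>))"

end

theory Submission
  imports Defs
begin

text \<open>A minimizer \<open>u\<close> and its negative are quasi-minimizers: changing \<open>u\<close> on a set \<open>E\<close> lowers the
  Gagliardo energy by at most \<open>M |E|\<close>. Testing with \<open>u - \<psi>\<^sup>p (u - k)\<^sub>+\<close>, for a cutoff \<open>\<psi>\<close>, gives a Caccioppoli
  inequality whose left-hand side controls the interaction of \<open>{u > k}\<close> with \<open>{u \<le> k}\<close>. Since the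
  kernel sees the complement of a set \<open>A\<close> with weight at least \<open>c |A|\<close> to the power \<open>- s p / n\<close>, this suffices to
  run De Giorgi's iteration and bound \<open>u\<close> from above. The mixed term \<open>(u(x) - k)\<^sub>+ (k - u(y))\<^sub>+\<close> to the powers
  \<open>1\<close> and \<open>p - 1\<close> shows that \<open>u\<close> drops below its maximum by a fixed fraction of the oscillation
  once \<open>u\<close> lies below its middle value on half of a ball. Applied to \<open>u\<close> or \<open>- u\<close> on a geometric sequence of balls,
  this yields the oscillation decay; the growth of the oscillation outside the balls is absorbed in the
  tail because the Hoelder exponent is small.\<close>

section \<open>Power inequalities\<close>

text \<open>The measure term has no derivative in \<open>u\<close>, so everything rests on
  comparison with truncations and not on an equation. Comparison yields the energy of the truncation
  on one side and that of \<open>u\<close> on the other, and the two are subtracted; hence the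
  coefficient of |u(x) - u(y)|^p must be exactly 1, and this is what the power p on the cutoff
  achieves. Because the kernel is nonlocal, a bound on one ball never suffices: each estimate
  carries an integral over the exterior as a hypothesis, and the induction over scales has to
  transport bounds for all larger scales. The contribution M |E| on a ball of radius R is of the
  order of the p-th power of a height M^(1/p) R^s, so the heights used are kept at least comparable
  to that quantity; this persists at smaller radii because the Hoelder exponent is at most
  \<open>s\<close>. In every statement the constants are quantified before \<open>M\<close>,
  \<Omega> and \<open>u\<close>, which gives the dependence on n, p and s alone.\<close>

lemma powr_diff_le:
  fixes a b p :: real
  assumes "p \<ge> 1" "0 \<le> b" "b \<le> a"
  shows "a powr p - b powr p \<le> p * a powr (p - 1) * (a - b)"
proof (cases "b = a \<or> b = 0")
  case True
  then show ?thesis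
  proof
    assume b0: "b = 0"
    show ?thesis
    proof (cases "a = 0")
      case False
      with assms have "a powr p = a powr (p-1) * a"
        by (simp add: powr_diff)
      moreover have "a powr (p-1) * a \<le> p * (a powr (p-1) * a)"
        using assms mult_right_mono[of 1 p "a powr (p-1) * a"] by simp
      ultimately show ?thesis using b0 assms by (simp add: mult.assoc)
    qed (use b0 in simp)
  qed simp
next
  case False
  with assms have ab: "0 < b" "b < a" by auto
  have der: "((\<lambda>x. x powr p) has_real_derivative p * x powr (p - 1)) (at x)" if "b \<le> x" "x \<le> a" for x
    using that ab by (auto intro!: derivative_eq_intros)
  obtain z where z: "b < z" "z < a" "a powr p - b powr p = (a - b) * (p * z powr (p - 1))"
    using MVT2[OF ab(2) der] by blast
  have "z powr (p-1) \<le> a powr (p-1)" using z ab assms by (intro powr_mono2) auto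
  then show ?thesis using z ab assms by (simp add: mult.commute mult_left_mono)
qed

text \<open>Ordinary convexity if both points are positive. If one of them is 0, the claim reduces
  to \<open>r powr p \<le> r\<close> for r in [0, 1], applied to a weight of the
  combination.\<close>

lemma powr_convex_comb:
  fixes a b t p :: real
  assumes "p \<ge> 1" "0 \<le> a" "0 \<le> b" "0 \<le> t" "t \<le> 1"
  shows "((1 - t) * a + t * b) powr p \<le> (1 - t) * a powr p + t * b powr p"
proof -
  have *: "r powr p \<le> r" if "0 \<le> r" "r \<le> 1" for r :: real
    using powr_mono'[of 1 p r] that assms by simp
  consider "0 < a" "0 < b" | "a = 0" | "b = 0" using assms by linarith
  then show ?thesis
  proof cases
    case 1
    then show ?thesis using convex_onD[OF powr_convex[OF assms(1)], of t a b] assms by simp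
  next
    case 2
    then show ?thesis using assms *[of t] by (simp add: powr_mult mult_right_mono)
  next
    case 3
    then show ?thesis using assms *[of "1 - t"] by (simp add: powr_mult mult_right_mono)
  qed
qed

lemma powr_mult_self: "x powr p = x * x powr (p - 1)" if "x \<ge> 0" for x p :: real
  using that by (cases "x = 0") (auto simp: powr_diff)

lemma powr_superadd:
  fixes w z p :: real
  assumes "p \<ge> 1" "0 \<le> w" "0 \<le> z"
  shows "w powr p + z powr p \<le> (w + z) powr p"
proof -
  have "w * w powr (p-1) + z * z powr (p-1) \<le> w * (w+z) powr (p-1) + z * (w+z) powr (p-1)"
    using assms by (intro add_mono mult_left_mono powr_mono2) auto
  then show ?thesis using powr_mult_self[of w p] powr_mult_self[of z p] powr_mult_self[of "w+z" p] assms
    by (simp add: algebra_simps)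
qed

lemma powr_add_le:
  fixes a b p :: real
  assumes "p \<ge> 1" "0 \<le> a" "0 \<le> b"
  shows "(a + b) powr p \<le> 2 powr p * (a powr p + b powr p)"
proof -
  have "(a + b) powr p \<le> (2 * max a b) powr p" using assms by (intro powr_mono2) auto
  also have "\<dots> = 2 powr p * max a b powr p" using assms by (simp add: powr_mult)
  also have "\<dots> \<le> 2 powr p * (a powr p + b powr p)" by (intro mult_left_mono) (auto simp: max_def)
  finally show ?thesis .
qed

text \<open>Here \<open>w\<close> is the height of u(x) above a level, \<open>z\<close> the depth of
  u(y) below it, and \<open>t\<close> the fraction of \<open>w\<close> that is removed. Convexity
  along (1 - t)(w + z) + t z leaves a gain of at least t ((w + z)^p - z^p), and superadditivity of
  the power p - 1, which is at least 1, splits this into two terms. The mixed one records how deep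
  u(y) lies.\<close>

lemma below_level_gain:
  fixes w z p t :: real
  assumes "p \<ge> 2" "0 \<le> w" "0 \<le> z" "0 \<le> t" "t \<le> 1"
  shows "((1 - t) * w + z) powr p + t * (w powr p + w * z powr (p - 1)) \<le> (w + z) powr p"
proof -
  have "(w+z) powr p = w * (w+z) powr (p-1) + z * (w+z) powr (p-1)"
    using powr_mult_self[of "w+z" p] assms by (simp add: algebra_simps)
  moreover have "\<dots> \<ge> w * (w powr (p-1) + z powr (p-1)) + z * z powr (p-1)"
    using powr_superadd[of "p-1" w z] assms by (intro add_mono mult_left_mono powr_mono2) auto
  ultimately have "w powr p + w * z powr (p - 1) + z powr p \<le> (w + z) powr p"
    using powr_mult_self[of w p] powr_mult_self[of z p] assms by (simp add: algebra_simps)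
  then have "t * (w powr p + w * z powr (p - 1)) \<le> t * ((w + z) powr p - z powr p)"
    using assms by (intro mult_left_mono) auto
  moreover have "((1 - t) * (w + z) + t * z) powr p \<le> (1 - t) * (w + z) powr p + t * z powr p"
    using assms by (intro powr_convex_comb) auto
  ultimately show ?thesis by (simp add: algebra_simps)
qed

text \<open>Only one of two heights above the level is lowered, as for a pair with one point outside
  the large ball. If \<open>Y\<close> is below the lowered height, the difference shrinks; otherwise
  its increase is controlled by the removed amount \<open>t * X\<close> and by \<open>Y\<close>. The
  error is linear in \<open>X\<close> and of degree p - 1 in \<open>Y\<close>, which is the shape of
  the tail.\<close>

lemma far_truncation_le:
  fixes X Y t p :: real
  assumes "p \<ge> 1" "0 \<le> X" "0 \<le> Y" "0 \<le> t" "t \<le> 1"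
  shows "\<bar>(1 - t) * X - Y\<bar> powr p \<le> \<bar>X - Y\<bar> powr p + p * t * X * Y powr (p - 1)"
proof -
  define \<tau> where "\<tau> = (1 - t) * X"
  have \<tau>: "0 \<le> \<tau>" "\<tau> \<le> X" "X - \<tau> = t * X" using assms by (auto simp: \<tau>_def mult_left_le_one_le) (simp add: algebra_simps)
  have nn: "0 \<le> p * t * X * Y powr (p - 1)" using assms by simp
  consider "Y \<le> \<tau>" | "\<tau> < Y" "Y \<le> X" | "X < Y" by linarith
  then show ?thesis
  proof cases
    case 1
    then have "\<bar>\<tau> - Y\<bar> powr p \<le> \<bar>X - Y\<bar> powr p" using \<tau> assms by (intro powr_mono2) auto
    then show ?thesis using nn by (simp add: \<tau>_def)
  next
    case 2
    have "\<bar>\<tau> - Y\<bar> powr p = (Y - \<tau>) * (Y - \<tau>) powr (p-1)" using 2 powr_mult_self[of "Y - \<tau>" p] by simp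
    also have "\<dots> \<le> (X - \<tau>) * Y powr (p-1)" using 2 \<tau> assms by (intro mult_mono powr_mono2) auto
    also have "\<dots> \<le> p * ((X - \<tau>) * Y powr (p-1))" using assms \<tau>
      mult_right_mono[of 1 p "(X - \<tau>) * Y powr (p-1)"] by simp
    finally have "\<bar>\<tau> - Y\<bar> powr p \<le> p * t * X * Y powr (p-1)" unfolding \<tau>(3) by (simp add: mult_ac)
    then show ?thesis using powr_ge_zero[of "\<bar>X - Y\<bar>" p] unfolding \<tau>_def by linarith
  next
    case 3
    have "(Y - \<tau>) powr p - (Y - X) powr p \<le> p * (Y - \<tau>) powr (p-1) * ((Y - \<tau>) - (Y - X))"
      using 3 \<tau> assms by (intro powr_diff_le) auto
    also have "\<dots> \<le> p * Y powr (p-1) * (X - \<tau>)" using 3 \<tau> assms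
      by (intro mult_mono mult_left_mono powr_mono2) auto
    finally show ?thesis using 3 \<tau> by (simp add: \<tau>_def mult_ac)
  qed
qed

text \<open>For the larger cutoff value \<open>a\<close>, with e = a^p, the new difference is
  bounded by a convex combination of |X - Y| and (e - b^p) Y / e with weights 1 - e and e. Convexity
  produces the factor e^(1 - p) in the second term, and e - b^p \<le> p a^(p-1) (a - b) cancels it
  exactly; a cutoff without the power p would not do this. The error contains both p-th powers, so
  either order of \<open>a\<close> and \<open>b\<close> is covered.\<close>

lemma near_truncation_le:
  fixes X Y a b p :: real
  assumes "p \<ge> 1" "0 \<le> X" "0 \<le> Y" "0 \<le> a" "a \<le> 1" "0 \<le> b" "b \<le> 1"
  shows "\<bar>(1 - a powr p) * X - (1 - b powr p) * Y\<bar> powr p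
           \<le> \<bar>X - Y\<bar> powr p + p powr p * \<bar>a - b\<bar> powr p * (X powr p + Y powr p)"
proof -
  have main: "\<bar>(1 - a powr p) * X - (1 - b powr p) * Y\<bar> powr p
           \<le> \<bar>X - Y\<bar> powr p + p powr p * \<bar>a - b\<bar> powr p * Y powr p"
    if h: "0 \<le> b" "b \<le> a" "a \<le> 1" "0 \<le> X" "0 \<le> Y" for a b X Y
  proof (cases "a = 0")
    case False
    define e where "e = a powr p"
    have e: "0 < e" "e \<le> 1" using h False assms by (auto simp: e_def powr_le1)
    have be: "b powr p \<le> e" unfolding e_def using h assms by (intro powr_mono2) auto
    have "\<bar>(1 - e) * X - (1 - b powr p) * Y\<bar> = \<bar>(1 - e) * (X - Y) + (- (e - b powr p)) * Y\<bar>"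
      by (simp add: algebra_simps)
    also have "\<dots> \<le> \<bar>(1 - e) * (X - Y)\<bar> + \<bar>(- (e - b powr p)) * Y\<bar>" by (rule abs_triangle_ineq)
    also have "\<dots> = (1 - e) * \<bar>X - Y\<bar> + e * ((e - b powr p) * Y / e)"
      using e be h by (simp add: abs_mult)
    finally have "\<bar>(1 - e) * X - (1 - b powr p) * Y\<bar> powr p
        \<le> ((1 - e) * \<bar>X - Y\<bar> + e * ((e - b powr p) * Y / e)) powr p"
      using assms by (intro powr_mono2) auto
    also have "\<dots> \<le> (1 - e) * \<bar>X - Y\<bar> powr p + e * ((e - b powr p) * Y / e) powr p"
      using e be h assms by (intro powr_convex_comb) auto
    also have "(1 - e) * \<bar>X - Y\<bar> powr p \<le> \<bar>X - Y\<bar> powr p"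
      using e by (intro mult_left_le_one_le) auto
    also have "e * ((e - b powr p) * Y / e) powr p \<le> p powr p * \<bar>a - b\<bar> powr p * Y powr p"
    proof -
      have "e - b powr p \<le> p * a powr (p-1) * (a - b)" unfolding e_def
        using h assms by (intro powr_diff_le) auto
      then have "(e - b powr p) * Y / e \<le> p * a powr (p-1) * (a - b) * Y / e"
        using e h by (intro divide_right_mono mult_right_mono) auto
      also have "\<dots> = p * (a - b) * Y / a"
        using False h by (simp add: e_def powr_diff field_simps)
      finally have "((e - b powr p) * Y / e) powr p \<le> (p * (a - b) * Y / a) powr p"
        using e h be assms by (intro powr_mono2) auto
      also have "\<dots> = p powr p * (a - b) powr p * Y powr p / e"
        using h assms by (simp add: e_def powr_mult powr_divide)
      finally show ?thesis using e h by (simp add: field_simps)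
    qed
    finally show ?thesis by (simp add: e_def)
  qed (use h in simp)
  have nn: "0 \<le> p powr p * \<bar>a - b\<bar> powr p * X powr p" "0 \<le> p powr p * \<bar>a - b\<bar> powr p * Y powr p"
    by auto
  show ?thesis
  proof (cases "b \<le> a")
    case True
    show ?thesis using main[of b a X Y] True assms nn unfolding distrib_left by linarith
  next
    case False
    show ?thesis using main[of a b Y X] False assms nn unfolding distrib_left
      abs_minus_commute[of "(1 - b powr p) * Y"] abs_minus_commute[of Y] abs_minus_commute[of b]
      by linarith
  qed
qed

text \<open>Young's inequality with weights 1 - a/b and a/b for the factors 1 and t^b. The point is
  the factor \<open>a / b\<close>: for a small Hoelder exponent \<open>a\<close> and fixed
  \<open>b\<close>, the excess of t^a over 1 is a small multiple of t^b.\<close>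

lemma powr_minus_one_le:
  fixes t a b :: real
  assumes "t \<ge> 1" "0 < a" "a \<le> b"
  shows "t powr a - 1 \<le> a / b * (t powr b)"
proof -
  have "t powr a = 1 powr (1 - a/b) * (t powr b) powr (a/b)"
    using assms by (simp add: powr_powr)
  also have "\<dots> \<le> (1 - a/b) * 1 + a/b * t powr b"
    using assms by (intro Youngs_inequality_0) auto
  finally have "t powr a - 1 \<le> a / b * t powr b - a / b" by simp
  moreover have "0 \<le> a / b" using assms by simp
  ultimately show ?thesis by linarith
qed

section \<open>Integrals of the kernel\<close>

lemma powr_le_dyadic:
  fixes t \<tau> b :: real
  assumes "0 < \<tau>" "\<tau> / 2 \<le> t" "t \<le> \<tau>"
  shows "t powr b \<le> 2 powr \<bar>b\<bar> * \<tau> powr b"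
proof (cases "b \<ge> 0")
  case True
  have "t powr b \<le> 1 * \<tau> powr b" using assms True by (auto intro: powr_mono2)
  also have "\<dots> \<le> 2 powr \<bar>b\<bar> * \<tau> powr b" by (intro mult_right_mono) (auto simp: ge_one_powr_ge_zero)
  finally show ?thesis .
next
  case False
  have "t powr b \<le> (\<tau> / 2) powr b" using assms False by (intro powr_mono2') auto
  also have "\<dots> = 2 powr \<bar>b\<bar> * \<tau> powr b"
    using assms False by (simp add: powr_divide powr_minus_divide abs_if)
  finally show ?thesis .
qed

lemma emeasure_ball_powr:
  fixes x :: "'a::euclidean_space"
  assumes "r > 0"
  shows "emeasure lborel (ball x r) = ennreal (unit_ball_vol (DIM('a)) * r powr (DIM('a)))"
  using assms by (simp add: emeasure_ball powr_realpow)

text \<open>The integrand is comparable to a constant on each shell, and each shell is enlarged to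
  its ball, so the integral is at most a geometric series with ratio \<theta>^(b + n). The value
  \<theta> = 1/2 treats singularities at the centre and \<theta> = 2 decay at infinity; in both
  cases the ratio is below 1 exactly when the integral converges.\<close>

lemma dyadic_kernel_integral_le:
  fixes x :: "'a::euclidean_space" and \<theta> b \<rho> :: real
  assumes S: "S \<in> sets borel" and \<theta>: "0 < \<theta>" "\<theta> powr (b + DIM('a)) < 1" and \<rho>: "0 < \<rho>"
    and cov: "\<And>y. y \<in> S \<Longrightarrow> y \<noteq> x \<Longrightarrow> \<exists>j::nat. \<rho> * \<theta> ^ j / 2 \<le> norm (x - y) \<and> norm (x - y) < \<rho> * \<theta> ^ j"
  shows "(\<integral>\<^sup>+y\<in>S. ennreal (norm (x - y) powr b) \<partial>lborel)
    \<le> ennreal (2 powr \<bar>b\<bar> * unit_ball_vol (DIM('a)) / (1 - \<theta> powr (b + DIM('a))) * \<rho> powr (b + DIM('a)))"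
proof -
  let ?n = "real DIM('a)"
  define \<tau> where "\<tau> j = \<rho> * \<theta> ^ j" for j :: nat
  define q where "q = \<theta> powr (b + ?n)"
  have \<tau>: "\<tau> j > 0" for j using \<theta> \<rho> by (simp add: \<tau>_def)
  have q: "0 < q" "q < 1" using \<theta> by (auto simp: q_def)
  let ?F = "\<lambda>j y. ennreal (2 powr \<bar>b\<bar> * \<tau> j powr b) * indicator (ball x (\<tau> j)) y"
  have le_suminf: "f j \<le> suminf f" for f :: "nat \<Rightarrow> ennreal" and j
    using sum_le_suminf[of f "{j}"] by simp
  have pw: "ennreal (norm (x - y) powr b) * indicator S y \<le> (\<Sum>j. ?F j y)" for y
  proof (cases "y \<in> S \<and> y \<noteq> x")
    case True
    then obtain j where j: "\<tau> j / 2 \<le> norm (x - y)" "norm (x - y) < \<tau> j"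
      using cov unfolding \<tau>_def by blast
    then have "ennreal (norm (x - y) powr b) * indicator S y \<le> ?F j y"
      using powr_le_dyadic[OF \<tau>, of j "norm (x - y)" b] True by (auto simp: dist_norm intro!: ennreal_leI)
    also have "\<dots> \<le> (\<Sum>j. ?F j y)" by (rule le_suminf)
    finally show ?thesis .
  qed auto
  have tm: "(\<integral>\<^sup>+y. ?F j y \<partial>lborel) = ennreal (2 powr \<bar>b\<bar> * unit_ball_vol ?n * \<rho> powr (b + ?n) * q ^ j)" for j
  proof -
    have "(\<integral>\<^sup>+y. ?F j y \<partial>lborel) = ennreal (2 powr \<bar>b\<bar> * \<tau> j powr b) * ennreal (unit_ball_vol ?n * \<tau> j powr ?n)"
      by (subst nn_integral_cmult_indicator) (simp_all only: emeasure_ball_powr[OF \<tau>] sets_lborel open_ball borel_open)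
    also have "\<dots> = ennreal (2 powr \<bar>b\<bar> * unit_ball_vol ?n * \<tau> j powr (b + ?n))"
      by (subst ennreal_mult[symmetric]) (auto simp: powr_add mult_ac)
    also have "\<tau> j powr (b + ?n) = \<rho> powr (b + ?n) * q ^ j"
      using \<theta> \<rho> by (simp add: \<tau>_def q_def powr_mult powr_power powr_realpow[symmetric] powr_powr mult.commute)
    finally show ?thesis by (simp add: mult_ac)
  qed
  have "(\<integral>\<^sup>+y\<in>S. ennreal (norm (x - y) powr b) \<partial>lborel) \<le> (\<integral>\<^sup>+y. (\<Sum>j. ?F j y) \<partial>lborel)"
    by (intro nn_integral_mono pw)
  moreover have meas: "(\<lambda>y. ?F j y) \<in> borel_measurable lborel" for j
    by (intro borel_measurable_times_ennreal borel_measurable_indicator borel_measurable_const) simp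
  have "(\<integral>\<^sup>+y. (\<Sum>j. ?F j y) \<partial>lborel) = (\<Sum>j. \<integral>\<^sup>+y. ?F j y \<partial>lborel)"
    by (rule nn_integral_suminf[OF meas])
  moreover have "\<dots> = (\<Sum>j. ennreal (2 powr \<bar>b\<bar> * unit_ball_vol ?n * \<rho> powr (b + ?n) * q ^ j))"
    by (rule arg_cong[where f = suminf], rule ext, rule tm)
  moreover have "\<dots> = ennreal (2 powr \<bar>b\<bar> * unit_ball_vol ?n * \<rho> powr (b + ?n) * (1 / (1 - q)))"
    using q by (intro suminf_ennreal_eq sums_mult geometric_sums) auto
  ultimately show ?thesis by (simp add: q_def mult_ac)
qed

text \<open>Used with base 2 to choose a shell of a kernel integral, and with base 4 to choose the
  scale at which the oscillation is known.\<close>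

lemma geometric_scale:
  fixes b t R :: real
  assumes "1 < b" "0 < t" "t < R"
  obtains j :: nat where "R / b ^ Suc j \<le> t" "t < R / b ^ j"
proof -
  define P where "P i \<longleftrightarrow> R / b ^ Suc i \<le> t" for i
  obtain i where "R / t < b ^ i" using real_arch_pow[OF assms(1), of "R / t"] by auto
  then have "R < t * b ^ i" using assms by (simp add: field_simps)
  also have "\<dots> \<le> t * b ^ Suc i" using assms by simp
  finally have "P i" using assms by (simp add: P_def field_simps)
  then have "P (LEAST i. P i)" by (rule LeastI)
  moreover define N where "N = (LEAST i. P i)"
  ultimately have N: "P N" by simp
  have "t < R / b ^ N"
  proof (cases N)
    case (Suc i)
    then have "\<not> P i" using not_less_Least[of i P] by (simp add: N_def)
    then show ?thesis using Suc by (simp add: P_def)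
  qed (use assms in simp)
  then show thesis using that N by (simp add: P_def)
qed

lemma near_kernel_integral:
  fixes a :: real
  assumes "a > 0"
  shows "\<exists>C>0. \<forall>(x::'a::euclidean_space) \<rho>. \<rho> > 0 \<longrightarrow>
    (\<integral>\<^sup>+y\<in>ball x \<rho>. ennreal (norm (x - y) powr (a - DIM('a))) \<partial>lborel) \<le> ennreal (C * \<rho> powr a)"
proof -
  let ?n = "real DIM('a)"
  have q: "(1/2) powr a < (1::real)" using assms by (simp add: powr_divide)
  define C where "C = 2 powr \<bar>a - ?n\<bar> * unit_ball_vol ?n / (1 - (1/2) powr (a - ?n + ?n))"
  have "C > 0" using q by (simp add: C_def unit_ball_vol_pos)
  moreover have "(\<integral>\<^sup>+y\<in>ball x \<rho>. ennreal (norm (x - y) powr (a - ?n)) \<partial>lborel) \<le> ennreal (C * \<rho> powr a)"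
    if \<rho>: "\<rho> > 0" for x :: 'a and \<rho>
  proof -
    have "\<exists>j::nat. \<rho> * (1/2) ^ j / 2 \<le> norm (x - y) \<and> norm (x - y) < \<rho> * (1/2) ^ j"
      if y: "y \<in> ball x \<rho>" "y \<noteq> x" for y
    proof -
      define t where "t = norm (x - y)"
      have t: "0 < t" "t < \<rho>" using y by (auto simp: t_def dist_norm)
      obtain j where "\<rho> / 2 ^ Suc j \<le> t" "t < \<rho> / 2 ^ j" by (rule geometric_scale[OF _ t, of 2]) auto
      then show ?thesis by (intro exI[of _ j]) (simp add: t_def power_one_over)
    qed
    from dyadic_kernel_integral_le[OF _ _ _ \<rho> this, where b = "a - ?n" and S = "ball x \<rho>"] q
    show ?thesis by (simp add: C_def)
  qed
  ultimately show ?thesis by blast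
qed

lemma far_kernel_integral:
  fixes a :: real
  assumes "a > 0"
  shows "\<exists>C>0. \<forall>(x::'a::euclidean_space) \<rho>. \<rho> > 0 \<longrightarrow>
    (\<integral>\<^sup>+y\<in>- ball x \<rho>. ennreal (1 / norm (x - y) powr (DIM('a) + a)) \<partial>lborel) \<le> ennreal (C * \<rho> powr (-a))"
proof -
  let ?n = "real DIM('a)"
  let ?b = "- (?n + a)"
  have q: "2 powr (-a) < (1::real)" using assms powr_less_mono[of "-a" 0 2] by simp
  \<comment> \<open>The dyadic balls start at radius 2 \<rho>, so that shell 0 covers the distances
    from \<rho> to 2 \<rho>; this accounts for the last factor \<open>2 powr (-a)\<close>.\<close>
  define C where "C = 2 powr \<bar>?b\<bar> * unit_ball_vol ?n / (1 - 2 powr (?b + ?n)) * 2 powr (-a)"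
  have "C > 0" using q by (simp add: C_def unit_ball_vol_pos)
  moreover have "(\<integral>\<^sup>+y\<in>- ball x \<rho>. ennreal (1 / norm (x - y) powr (?n + a)) \<partial>lborel) \<le> ennreal (C * \<rho> powr (-a))"
    if \<rho>: "\<rho> > 0" for x :: 'a and \<rho>
  proof -
    have cov: "\<exists>j::nat. (2*\<rho>) * 2 ^ j / 2 \<le> norm (x - y) \<and> norm (x - y) < (2*\<rho>) * 2 ^ j"
      if y: "y \<in> - ball x \<rho>" "y \<noteq> x" for y
    proof -
      define t where "t = norm (x - y)"
      have t: "\<rho> \<le> t" using y by (auto simp: t_def dist_norm)
      define P where "P j \<longleftrightarrow> t < \<rho> * 2 ^ Suc j" for j :: nat
      obtain j where "t / \<rho> < 2 ^ j" using real_arch_pow[of 2 "t/\<rho>"] by auto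
      then have "t < \<rho> * 2 ^ j" using \<rho> by (simp add: field_simps)
      also have "\<dots> \<le> \<rho> * 2 ^ Suc j" using \<rho> by simp
      finally have "P j" unfolding P_def .
      then have "P (LEAST j. P j)" by (rule LeastI)
      moreover define N where "N = (LEAST j. P j)"
      ultimately have L: "P N" by simp
      have "\<rho> * 2 ^ N \<le> t"
      proof (cases N)
        case (Suc i)
        then have "\<not> P i" using not_less_Least[of i P] by (simp add: N_def)
        then show ?thesis using Suc by (simp add: P_def)
      qed (use t in simp)
      then show ?thesis using L unfolding P_def t_def by (intro exI[of _ N]) auto
    qed
    have eq: "1 / norm (x - y) powr (?n + a) = norm (x - y) powr ?b" for y
      by (simp only: powr_minus_divide)
    from dyadic_kernel_integral_le[OF _ _ _ _ cov, where b = ?b and S = "- ball x \<rho>"] q \<rho>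
    show ?thesis unfolding eq by (simp add: C_def powr_mult powr_minus_divide mult_ac)
  qed
  ultimately show ?thesis by blast
qed

text \<open>This replaces the fractional Sobolev inequality: the kernel sees at least as much of the
  complement of a set of measure \<open>d\<close> as half of a ball of measure \<open>2 d\<close>.\<close>

lemma kernel_integral_complement_ge:
  fixes e :: real
  assumes "e > 0"
  shows "\<exists>c>0. \<forall>(A::'a::euclidean_space set) d x. A \<in> sets borel \<longrightarrow> d > 0 \<longrightarrow> emeasure lborel A \<le> ennreal d \<longrightarrow>
    ennreal (c * d powr (- (e / DIM('a)))) \<le> (\<integral>\<^sup>+y\<in>- A. ennreal (1 / norm (x - y) powr (DIM('a) + e)) \<partial>lborel)"
proof -
  let ?n = "real DIM('a)"
  let ?V = "unit_ball_vol ?n"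
  have n: "?n > 0" by simp
  have V: "?V > 0" by (simp add: unit_ball_vol_pos)
  then have V0: "?V \<noteq> 0" by linarith
  define c where "c = (2 / ?V) powr (-(1 + e / ?n))"
  have "c > 0" using V0 by (simp add: c_def)
  moreover have "ennreal (c * d powr (- (e / ?n))) \<le> (\<integral>\<^sup>+y\<in>- A. ennreal (1 / norm (x - y) powr (?n + e)) \<partial>lborel)"
    if A[measurable]: "A \<in> sets borel" and d: "d > 0" and Ad: "emeasure lborel A \<le> ennreal d" for A :: "'a set" and d x
  proof -
    define \<rho> where "\<rho> = (2 * d / ?V) powr (1 / ?n)"
    have \<rho>: "\<rho> > 0" using d V0 by (simp add: \<rho>_def)
    have B: "emeasure lborel (ball x \<rho>) = ennreal (2 * d)"
    proof -
      have dV: "0 < 2 * d / ?V" using d V by (intro divide_pos_pos mult_pos_pos) auto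
      have "\<rho> powr ?n = (2 * d / ?V) powr (1 / ?n * ?n)" unfolding \<rho>_def by (rule powr_powr)
      also have "1 / ?n * ?n = 1" by simp
      also have "(2 * d / ?V) powr 1 = 2 * d / ?V" using dV by (intro powr_one) linarith
      finally have "?V * \<rho> powr ?n = 2 * d" using V0 by (metis nonzero_mult_div_cancel_left times_divide_eq_right)
      then show ?thesis using emeasure_ball_powr[OF \<rho>, of x] by (simp only:)
    qed
    \<comment> \<open>The point \<open>x\<close> is taken out because the kernel at distance 0 is
      \<open>1 / 0 = 0\<close> in HOL and would violate the lower bound. It has measure
      zero.\<close>
    define S where "S = ball x \<rho> - A - {x}"
    have S[measurable]: "S \<in> sets borel" by (simp add: S_def)
    have "ennreal (2 * d) \<le> emeasure lborel (S \<union> (A \<union> {x}))"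
      unfolding B[symmetric] by (intro emeasure_mono) (auto simp: S_def)
    also have "\<dots> \<le> emeasure lborel S + emeasure lborel (A \<union> {x})"
      by (intro emeasure_subadditive) auto
    also have "emeasure lborel (A \<union> {x}) \<le> emeasure lborel A + emeasure lborel {x}"
      by (intro emeasure_subadditive) auto
    also have "\<dots> \<le> ennreal d" using Ad by simp
    finally have "ennreal (2 * d) - ennreal d \<le> emeasure lborel S"
      by (simp add: ennreal_minus_le_iff add.commute)
    then have Sd: "ennreal d \<le> emeasure lborel S" using d by (simp add: ennreal_minus)
    have eq: "c * d powr (- (e / ?n)) = 1 / \<rho> powr (?n + e) * d"
    proof -
      have "\<rho> powr (?n + e) = (2 * d / ?V) powr (1 + e / ?n)"
        using n by (simp add: \<rho>_def powr_powr add_divide_distrib)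
      also have "\<dots> = (2 / ?V) powr (1 + e / ?n) * (d * d powr (e / ?n))"
        using d V by (simp add: powr_mult[symmetric] powr_add[of d])  (simp add: powr_mult powr_divide powr_add)
      finally show ?thesis using d V by (simp add: c_def powr_minus_divide field_simps)
    qed
    have "ennreal (c * d powr (- (e / ?n))) = ennreal (1 / \<rho> powr (?n + e)) * ennreal d"
      unfolding eq using d by (subst ennreal_mult[symmetric]) auto
    also have "\<dots> \<le> ennreal (1 / \<rho> powr (?n + e)) * emeasure lborel S"
      by (intro mult_left_mono Sd) auto
    also have "\<dots> = (\<integral>\<^sup>+y. ennreal (1 / \<rho> powr (?n + e)) * indicator S y \<partial>lborel)"
      by (simp add: nn_integral_cmult_indicator)
    also have "\<dots> \<le> (\<integral>\<^sup>+y\<in>- A. ennreal (1 / norm (x - y) powr (?n + e)) \<partial>lborel)"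
    proof (intro nn_integral_mono)
      fix y
      have "1 / \<rho> powr (?n + e) \<le> 1 / norm (x - y) powr (?n + e)" if "y \<in> S"
        using that assms \<rho> by (intro divide_left_mono powr_mono2 mult_pos_pos) (auto simp: S_def dist_norm)
      then show "ennreal (1 / \<rho> powr (?n + e)) * indicator S y
          \<le> ennreal (1 / norm (x - y) powr (?n + e)) * indicator (- A) y"
        by (auto simp: indicator_def S_def intro!: ennreal_leI)
    qed
    finally show ?thesis .
  qed
  ultimately show ?thesis by blast
qed

section \<open>Caccioppoli inequality for quasi-minimizers\<close>

lemma ball_in_borel [measurable]: "ball x r \<in> sets borel"
  by simp

section \<open>The fractional kernel, its energy, and the two classes of functions built on
  it\<close>

locale fractional_energy =
  fixes s p :: real
  assumes p2: "2 \<le> p" and s0: "0 < s" and s1: "s < 1"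
begin

lemma sp0: "0 < s * p" and spp: "s * p < p"
  using p2 s0 s1 by auto

text \<open>At the origin the value is \<open>1 / 0 = 0\<close>, so the diagonal contributes nothing
  to double integrals.\<close>

definition ker :: "'a::euclidean_space \<Rightarrow> real" where
  "ker z = 1 / norm z powr (real DIM('a) + s * p)"

lemma ker_nonneg [simp]: "0 \<le> ker z"
  by (simp add: ker_def)

lemma ker_commute: "ker (x - y) = ker (y - x)"
  by (simp add: ker_def norm_minus_commute)

lemma ker_measurable [measurable]: "ker \<in> borel_measurable borel"
  unfolding ker_def by measurable

definition frac_energy :: "('a::euclidean_space \<Rightarrow> real) \<Rightarrow> ennreal" where
  "frac_energy u = (\<integral>\<^sup>+x. \<integral>\<^sup>+y. ennreal (\<bar>u x - u y\<bar> powr p * ker (x - y)) \<partial>lborel \<partial>lborel)"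

text \<open>Stated for Borel functions that agree everywhere outside \<Omega>, so that truncations
  qualify as competitors with no null sets to carry along. It is applied to a Borel representative
  of the minimizer.\<close>

definition quasi_minimizer :: "real \<Rightarrow> 'a::euclidean_space set \<Rightarrow> ('a \<Rightarrow> real) \<Rightarrow> bool" where
  "quasi_minimizer M \<Omega> u \<longleftrightarrow> u \<in> borel_measurable borel \<and>
     (\<integral>\<^sup>+x. ennreal (\<bar>u x\<bar> powr p) \<partial>lborel) < \<infinity> \<and> frac_energy u < \<infinity> \<and>
     (\<forall>v \<in> borel_measurable borel. (\<integral>\<^sup>+x. ennreal (\<bar>v x\<bar> powr p) \<partial>lborel) < \<infinity> \<longrightarrow> frac_energy v < \<infinity> \<longrightarrow>
        (\<forall>x. x \<notin> \<Omega> \<longrightarrow> v x = u x) \<longrightarrow> frac_energy u \<le> frac_energy v + ennreal M * emeasure lborel {x. v x \<noteq> u x})"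

text \<open>A fractional De Giorgi class; the second summand on the left is what makes the growth lemma
  work without an isoperimetric inequality.\<close>

definition de_giorgi :: "real \<Rightarrow> real \<Rightarrow> 'a::euclidean_space set \<Rightarrow> ('a \<Rightarrow> real) \<Rightarrow> bool" where
  "de_giorgi C M \<Omega> u \<longleftrightarrow> u \<in> borel_measurable borel \<and>
     (\<forall>x0 r R k. 0 < r \<longrightarrow> r < R \<longrightarrow> ball x0 R \<subseteq> \<Omega> \<longrightarrow>
       (\<integral>\<^sup>+x\<in>ball x0 r. (\<integral>\<^sup>+y\<in>{y. u y \<le> k}.
           ennreal ((max (u x - k) 0 powr p + max (u x - k) 0 * (k - u y) powr (p - 1)) * ker (x - y))
         \<partial>lborel) \<partial>lborel)
       \<le> ennreal (C * (R / (R - r)) powr (DIM('a) + p)) *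
           (ennreal (R powr - (s * p)) * (\<integral>\<^sup>+x\<in>ball x0 R. ennreal (max (u x - k) 0 powr p) \<partial>lborel)
            + (\<integral>\<^sup>+x\<in>ball x0 R. ennreal (max (u x - k) 0) \<partial>lborel) *
              (\<integral>\<^sup>+y\<in>- ball x0 R. ennreal (max (u y - k) 0 powr (p - 1) * ker (y - x0)) \<partial>lborel))
         + ennreal M * emeasure lborel {x \<in> ball x0 R. k < u x})"

text \<open>Here \<open>a = u(x)\<close>, \<open>b = u(y)\<close>, and \<open>rx\<close>, \<open>mx\<close>, \<open>Rx\<close> say that \<open>x\<close> lies in the balls of radii \<open>r < m < R\<close>,
  where the cutoff is \<open>1\<close> on the first and supported in the second.\<close>

lemma truncation_pointwise:
  fixes a b k \<psi>a \<psi>b :: real and Rx Ry mx my rx :: bool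
  assumes \<psi>: "0 \<le> \<psi>a" "\<psi>a \<le> 1" "0 \<le> \<psi>b" "\<psi>b \<le> 1"
    and mR: "mx \<Longrightarrow> Rx" "my \<Longrightarrow> Ry" and rx: "rx \<Longrightarrow> \<psi>a = 1"
    and mx: "\<not> mx \<Longrightarrow> \<psi>a = 0" and my: "\<not> my \<Longrightarrow> \<psi>b = 0"
  defines "wa \<equiv> max (a - k) 0" and "wb \<equiv> max (b - k) 0"
  shows "\<bar>(a - \<psi>a powr p * wa) - (b - \<psi>b powr p * wb)\<bar> powr p
      + (if rx \<and> b \<le> k then wa powr p + wa * (k - b) powr (p - 1) else 0)
    \<le> \<bar>a - b\<bar> powr p
      + ((if Rx \<and> Ry then p powr p * \<bar>\<psi>a - \<psi>b\<bar> powr p * wa powr p else 0)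
         + (if mx \<and> \<not> Ry then p * wa * wb powr (p - 1) else 0))
      + ((if Ry \<and> Rx then p powr p * \<bar>\<psi>b - \<psi>a\<bar> powr p * wb powr p else 0)
         + (if my \<and> \<not> Rx then p * wb * wa powr (p - 1) else 0))"
    (is "_ + ?g \<le> _ + (?f1 + ?f2) + (?f3 + ?f4)")
proof -
  have f: "0 \<le> ?f1" "0 \<le> ?f2" "0 \<le> ?f3" "0 \<le> ?f4"
    using p2 by (auto simp: wa_def wb_def)
  have p0: "0 powr p = 0" "p \<ge> 1" using p2 by auto
  \<comment> \<open>The sides of the level decide. Two points below it do not move. In a mixed pair
    the upper point moves towards the lower one, and the gain is claimed only in the order with x
    above. All errors come from pairs above the level.\<close>
  consider "a \<le> k" "b \<le> k" | "a > k" "b \<le> k" | "a \<le> k" "b > k" | "a > k" "b > k" by linarith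
  then show ?thesis
  proof cases
    case 1
    then have "wa = 0" "wb = 0" by (auto simp: wa_def wb_def)
    then show ?thesis using f p0 by simp
  next
    case 2
    define t where "t = \<psi>a powr p"
    have t: "0 \<le> t" "t \<le> 1" using \<psi> p2 by (auto simp: t_def powr_le1)
    have wb: "wb = 0" and wa: "wa = a - k" "0 \<le> wa" using 2 by (auto simp: wa_def wb_def)
    have "((1 - t) * wa + (k - b)) powr p + t * (wa powr p + wa * (k - b) powr (p - 1)) \<le> (wa + (k - b)) powr p"
      using 2 t wa by (intro below_level_gain p2) auto
    moreover have "?g \<le> t * (wa powr p + wa * (k - b) powr (p - 1))"
      using rx t wa by (auto simp: t_def)
    moreover have "\<bar>(a - t * wa) - (b - \<psi>b powr p * wb)\<bar> = (1 - t) * wa + (k - b)"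
    proof -
      have "0 \<le> (1 - t) * wa + (k - b)" using t wa 2 by (intro add_nonneg_nonneg mult_nonneg_nonneg) auto
      moreover have "(a - t * wa) - (b - \<psi>b powr p * wb) = (1 - t) * wa + (k - b)"
        by (simp add: wb wa algebra_simps)
      ultimately show ?thesis by simp
    qed
    moreover have "\<bar>a - b\<bar> = wa + (k - b)" using 2 wa by simp
    ultimately show ?thesis using f unfolding t_def by auto
  next
    case 3
    define t where "t = \<psi>b powr p"
    have t: "0 \<le> t" "t \<le> 1" using \<psi> p2 by (auto simp: t_def powr_le1)
    have wa: "wa = 0" and wb: "wb = b - k" "0 \<le> wb" using 3 by (auto simp: wa_def wb_def)
    have "\<psi>a powr p * wa = 0" using wa by simp
    have "t * wb \<le> wb" using t wb by (simp add: mult_left_le_one_le)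
    moreover have "0 \<le> t * wb" using t wb by simp
    ultimately have "\<bar>(a - \<psi>a powr p * wa) - (b - t * wb)\<bar> \<le> \<bar>a - b\<bar>"
      using 3 wb(1) \<open>\<psi>a powr p * wa = 0\<close> by linarith
    then have "\<bar>(a - \<psi>a powr p * wa) - (b - t * wb)\<bar> powr p \<le> \<bar>a - b\<bar> powr p"
      using p2 by (intro powr_mono2) auto
    moreover have "?g = 0" using 3 by simp
    ultimately show ?thesis using f unfolding t_def by linarith
  next
    case 4
    have wa: "wa = a - k" "0 \<le> wa" and wb: "wb = b - k" "0 \<le> wb" using 4 by (auto simp: wa_def wb_def)
    have g: "?g = 0" using 4 by simp
    have e: "(a - \<psi>a powr p * wa) - (b - \<psi>b powr p * wb) = (1 - \<psi>a powr p) * wa - (1 - \<psi>b powr p) * wb"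
      "a - b = wa - wb" by (simp_all add: wa wb algebra_simps)
    have ta: "0 \<le> \<psi>a powr p" "\<psi>a powr p \<le> 1" and tb: "0 \<le> \<psi>b powr p" "\<psi>b powr p \<le> 1"
      using \<psi> p2 by (auto simp: powr_le1)
    \<comment> \<open>If one point is outside the large ball, its cutoff is 0, and the pair matters
      only if the other point is in the middle ball. If neither is in the middle ball, nothing has
      changed.\<close>
    consider "Rx" "Ry" | "mx" "\<not> Ry" | "my" "\<not> Rx" | "\<not> mx" "\<not> my" using mR by blast
    then show ?thesis
    proof cases
      case 1
      have "\<bar>(1 - \<psi>a powr p) * wa - (1 - \<psi>b powr p) * wb\<bar> powr p
         \<le> \<bar>wa - wb\<bar> powr p + p powr p * \<bar>\<psi>a - \<psi>b\<bar> powr p * (wa powr p + wb powr p)"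
        using \<psi> wa wb p2 by (intro near_truncation_le) auto
      then show ?thesis unfolding g e using 1 f by (simp add: algebra_simps abs_minus_commute)
    next
      case 2
      then have "\<psi>b = 0" using my mR by blast
      have "\<psi>a powr p * wa \<le> wa" using ta wa by (simp add: mult_left_le_one_le)
      have "\<bar>(1 - \<psi>a powr p) * wa - wb\<bar> powr p \<le> \<bar>wa - wb\<bar> powr p + p * \<psi>a powr p * wa * wb powr (p - 1)"
        using ta wa wb p2 by (intro far_truncation_le) auto
      also have "p * \<psi>a powr p * wa * wb powr (p - 1) \<le> p * 1 * wa * wb powr (p - 1)"
        using ta wa wb p2 by (intro mult_right_mono mult_left_mono) auto
      finally show ?thesis unfolding g e using 2 f \<open>\<psi>b = 0\<close> by (simp add: p0)
    next
      case 3
      then have "\<psi>a = 0" using mx mR by blast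
      have "\<bar>(1 - \<psi>b powr p) * wb - wa\<bar> powr p \<le> \<bar>wb - wa\<bar> powr p + p * \<psi>b powr p * wb * wa powr (p - 1)"
        using tb wa wb p2 by (intro far_truncation_le) auto
      also have "p * \<psi>b powr p * wb * wa powr (p - 1) \<le> p * 1 * wb * wa powr (p - 1)"
        using tb wa wb p2 by (intro mult_right_mono mult_left_mono) auto
      finally show ?thesis unfolding g e using 3 f \<open>\<psi>a = 0\<close> by (simp add: p0 abs_minus_commute)
    next
      case 4
      then show ?thesis unfolding g e using mx my f by (simp add: p0)
    qed
  qed
qed

text \<open>The Lipschitz bound turns the kernel into |x - y|^(p - sp - n), which is locally
  integrable because s < 1. The ball around \<open>x0\<close> is enlarged to the ball of radius 2 R
  around \<open>x\<close>.\<close>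

lemma near_cutoff_integral:
  "\<exists>C>0. \<forall>(x0::'a::euclidean_space) R (x::'a) L (\<psi>::'a \<Rightarrow> real). 0 < R \<longrightarrow> x \<in> ball x0 R \<longrightarrow> 0 \<le> L \<longrightarrow>
      (\<forall>y. \<bar>\<psi> x - \<psi> y\<bar> \<le> L * norm (x - y)) \<longrightarrow>
      (\<integral>\<^sup>+y\<in>ball x0 R. ennreal (\<bar>\<psi> x - \<psi> y\<bar> powr p * ker (x - y)) \<partial>lborel)
        \<le> ennreal (C * L powr p * R powr (p - s * p))"
proof -
  let ?a = "p - s * p"
  have "?a > 0" using spp by simp
  from near_kernel_integral[OF this, where 'a = 'a] obtain C where C: "C > 0"
    "\<And>(x::'a) \<rho>. \<rho> > 0 \<Longrightarrow> (\<integral>\<^sup>+y\<in>ball x \<rho>. ennreal (norm (x - y) powr (?a - DIM('a))) \<partial>lborel) \<le> ennreal (C * \<rho> powr ?a)"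
    by blast
  have "(\<integral>\<^sup>+y\<in>ball x0 R. ennreal (\<bar>\<psi> x - \<psi> y\<bar> powr p * ker (x - y)) \<partial>lborel)
        \<le> ennreal (C * 2 powr ?a * L powr p * R powr ?a)"
    if R: "0 < R" and x: "x \<in> ball x0 R" and L: "0 \<le> L" and \<psi>: "\<And>y. \<bar>\<psi> x - \<psi> y\<bar> \<le> L * norm (x - y)"
    for x0 :: 'a and R x L and \<psi> :: "'a \<Rightarrow> real"
  proof -
    have "(\<integral>\<^sup>+y\<in>ball x0 R. ennreal (\<bar>\<psi> x - \<psi> y\<bar> powr p * ker (x - y)) \<partial>lborel)
       \<le> (\<integral>\<^sup>+y. ennreal (L powr p) * (ennreal (norm (x - y) powr (?a - DIM('a))) * indicator (ball x (2 * R)) y) \<partial>lborel)"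
    proof (intro nn_integral_mono)
      fix y
      have "\<bar>\<psi> x - \<psi> y\<bar> powr p * ker (x - y) \<le> (L * norm (x - y)) powr p * ker (x - y)"
        using p2 \<psi>[of y] by (intro mult_right_mono powr_mono2) auto
      also have "\<dots> = L powr p * norm (x - y) powr (?a - DIM('a))"
      proof -
        have "?a - real DIM('a) = p - (DIM('a) + s * p)" by simp
        then show ?thesis using L by (simp only: powr_mult powr_diff ker_def) (simp add: powr_mult)
      qed
      finally have "ennreal (\<bar>\<psi> x - \<psi> y\<bar> powr p * ker (x - y)) \<le> ennreal (L powr p) * ennreal (norm (x - y) powr (?a - DIM('a)))"
        by (subst ennreal_mult[symmetric]) (auto intro: ennreal_leI)
      moreover have "y \<in> ball x (2 * R)" if "y \<in> ball x0 R"
        using dist_triangle_less_add[of x x0 R y R] x that by (auto simp: dist_commute)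
      ultimately show "ennreal (\<bar>\<psi> x - \<psi> y\<bar> powr p * ker (x - y)) * indicator (ball x0 R) y
         \<le> ennreal (L powr p) * (ennreal (norm (x - y) powr (?a - DIM('a))) * indicator (ball x (2 * R)) y)"
        by (auto simp: indicator_def)
    qed
    also have "\<dots> = ennreal (L powr p) * (\<integral>\<^sup>+y\<in>ball x (2*R). ennreal (norm (x - y) powr (?a - DIM('a))) \<partial>lborel)"
      by (rule nn_integral_cmult) measurable
    also have "\<dots> \<le> ennreal (L powr p) * ennreal (C * (2 * R) powr ?a)"
      using R by (intro mult_left_mono C(2)) auto
    also have "\<dots> = ennreal (C * 2 powr ?a * L powr p * R powr ?a)"
      using R C(1) by (subst ennreal_mult[symmetric]) (auto simp: powr_mult mult_ac)
    finally show ?thesis .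
  qed
  moreover have "C * 2 powr ?a > 0" using C(1) by simp
  ultimately show ?thesis by blast
qed

text \<open>Since \<open>x\<close> keeps the distance (R - r)/2 from the complement of the large
  ball, |x - y| is at least |y - x0| divided by 2R/(R - r); the tail may then be centred at
  \<open>x0\<close> for all such \<open>x\<close> at once. The exponent n + sp is raised to n + p so
  that near and far errors can share one power of R/(R - r).\<close>

lemma ker_le_center:
  fixes x y x0 :: "'a::euclidean_space"
  assumes "0 < r" "r < R" "x \<in> ball x0 ((r + R) / 2)" "y \<notin> ball x0 R"
  shows "ker (x - y) \<le> 2 powr (DIM('a) + p) * (R / (R - r)) powr (DIM('a) + p) * ker (y - x0)"
proof -
  let ?e = "real DIM('a) + s * p"
  define q where "q = 2 * (R / (R - r))"
  have q: "1 \<le> q" using assms by (simp add: q_def field_simps)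
  have d: "R \<le> dist x0 y" "dist x0 x < (r + R) / 2" using assms by auto
  have "dist x0 y / q = dist x0 y - dist x0 y * ((r + R) / (2 * R))"
    using assms by (simp add: q_def field_simps)
  also have "\<dots> \<le> dist x0 y - R * ((r + R) / (2 * R))"
    using d assms by (intro diff_left_mono mult_right_mono) auto
  also have "\<dots> = dist x0 y - (r + R) / 2" using assms by simp
  also have "\<dots> \<le> dist x y" using d dist_triangle[of x0 y x] by linarith
  finally have le: "dist x0 y / q \<le> dist x y" .
  have pos: "0 < dist x0 y / q" using d assms q by (intro divide_pos_pos) linarith+
  have "ker (x - y) \<le> 1 / (dist x0 y / q) powr ?e"
    unfolding ker_def dist_norm[symmetric]
    using le pos sp0 by (intro divide_left_mono powr_mono2 mult_pos_pos) auto
  also have "\<dots> = q powr ?e * ker (y - x0)"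
    using q by (simp add: ker_def powr_divide dist_norm norm_minus_commute)
  also have "\<dots> \<le> q powr (DIM('a) + p) * ker (y - x0)"
    using q spp by (intro mult_right_mono powr_mono) auto
  also have "q powr (DIM('a) + p) = 2 powr (DIM('a) + p) * (R / (R - r)) powr (DIM('a) + p)"
    unfolding q_def by (rule powr_mult)
  finally show ?thesis .
qed

section \<open>Double integrals against the kernel, and integration of the truncation
  inequality\<close>

definition ker_integral :: "('a::euclidean_space \<Rightarrow> 'a \<Rightarrow> real) \<Rightarrow> ennreal" where
  "ker_integral h = (\<integral>\<^sup>+x. \<integral>\<^sup>+y. ennreal (h x y * ker (x - y)) \<partial>lborel \<partial>lborel)"

lemma ker_diff_measurable:
  "(\<lambda>(x, y::'a::euclidean_space). ker (x - y)) \<in> borel_measurable (lborel \<Otimes>\<^sub>M lborel)"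
  by measurable

lemma weighted_measurable:
  fixes h :: "'a::euclidean_space \<Rightarrow> 'a \<Rightarrow> real"
  assumes "(\<lambda>(x, y). h x y) \<in> borel_measurable (lborel \<Otimes>\<^sub>M lborel)"
  shows "(\<lambda>(x, y). ennreal (h x y * ker (x - y))) \<in> borel_measurable (lborel \<Otimes>\<^sub>M lborel)"
  using borel_measurable_times[OF assms ker_diff_measurable]
  by (auto simp: case_prod_unfold)

lemma ker_integral_add:
  fixes h h' :: "'a::euclidean_space \<Rightarrow> 'a \<Rightarrow> real"
  assumes m: "(\<lambda>(x, y). h x y) \<in> borel_measurable (lborel \<Otimes>\<^sub>M lborel)"
    "(\<lambda>(x, y). h' x y) \<in> borel_measurable (lborel \<Otimes>\<^sub>M lborel)"
    and nn: "\<And>x y. 0 \<le> h x y" "\<And>x y. 0 \<le> h' x y"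
  shows "ker_integral (\<lambda>x y. h x y + h' x y) = ker_integral h + ker_integral h'"
proof -
  note m' = m[THEN weighted_measurable]
  have "(\<integral>\<^sup>+y. ennreal ((h x y + h' x y) * ker (x - y)) \<partial>lborel)
      = (\<integral>\<^sup>+y. ennreal (h x y * ker (x - y)) \<partial>lborel) + (\<integral>\<^sup>+y. ennreal (h' x y * ker (x - y)) \<partial>lborel)" for x
    using m'[THEN measurable_Pair2, of x] nn
    by (subst nn_integral_add[symmetric]) (auto simp: distrib_right)
  then show ?thesis
    unfolding ker_integral_def using lborel.borel_measurable_nn_integral[OF m'(1)] lborel.borel_measurable_nn_integral[OF m'(2)]
    by (simp add: nn_integral_add)
qed

text \<open>Tonelli's theorem and the symmetry of the kernel. The truncation error therefore has to
  be bounded for one order of the two points only.\<close>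

lemma ker_integral_swap:
  fixes h :: "'a::euclidean_space \<Rightarrow> 'a \<Rightarrow> real"
  assumes m: "(\<lambda>(x, y). h x y) \<in> borel_measurable (lborel \<Otimes>\<^sub>M lborel)"
  shows "ker_integral (\<lambda>x y. h y x) = ker_integral h"
proof -
  have "ker_integral (\<lambda>x y. h y x) = (\<integral>\<^sup>+y. \<integral>\<^sup>+x. ennreal (h x y * ker (x - y)) \<partial>lborel \<partial>lborel)"
    unfolding ker_integral_def by (subst ker_commute) simp
  also have "\<dots> = ker_integral h"
    unfolding ker_integral_def by (rule lborel_pair.Fubini'[OF weighted_measurable[OF m]])
  finally show ?thesis .
qed

text \<open>Integrating the pointwise inequality bounds the energy of the truncation
  \<open>v\<close> plus the gain by the energy of \<open>u\<close> plus the errors. Quasi-minimality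
  replaces the energy of \<open>u\<close> by that of \<open>v\<close> plus \<open>M\<close> times
  the measure of {v \<noteq> u}, and the energy of \<open>v\<close> cancels.\<close>

lemma quasi_minimizer_imp_de_giorgi:
  "\<exists>C>0. \<forall>M (\<Omega>::'a::euclidean_space set) u. 0 \<le> M \<longrightarrow> quasi_minimizer M \<Omega> u \<longrightarrow> de_giorgi C M \<Omega> u"
proof -
  let ?n = "real DIM('a)"
  let ?e = "?n + p"
  obtain C1 where C1_pos: "C1 > 0" and C1_all: "\<forall>(x0::'a) R x L (\<psi>::'a \<Rightarrow> real). 0 < R \<longrightarrow> x \<in> ball x0 R \<longrightarrow> 0 \<le> L \<longrightarrow>
      (\<forall>y. \<bar>\<psi> x - \<psi> y\<bar> \<le> L * norm (x - y)) \<longrightarrow>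
      (\<integral>\<^sup>+y\<in>ball x0 R. ennreal (\<bar>\<psi> x - \<psi> y\<bar> powr p * ker (x - y)) \<partial>lborel)
        \<le> ennreal (C1 * L powr p * R powr (p - s * p))"
    using near_cutoff_integral[where 'a = 'a] by (elim exE conjE)
  note C1 = C1_pos C1_all[rule_format]
  \<comment> \<open>\<open>C2\<close> collects p^p from the near truncation and 2^p from the slope
    2/(R - r) of the cutoff, \<open>C3\<close> the factor p of the far truncation and 2^(n + p) from
    recentring the kernel. The 2 in \<open>C\<close> counts the two orders of a pair.\<close>
  define C2 where "C2 = p powr p * 2 powr p * C1"
  define C3 where "C3 = p * 2 powr ?e"
  define C where "C = 2 * (C2 + C3)"
  have Cpos: "C2 > 0" "C3 > 0" "C > 0" using C1(1) p2 by (auto simp: C_def C2_def C3_def intro: add_pos_pos)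
  have "de_giorgi C M \<Omega> u" if M: "0 \<le> M" and qm: "quasi_minimizer M \<Omega> u" for M \<Omega> and u :: "'a \<Rightarrow> real"
    unfolding de_giorgi_def
  proof (intro conjI allI impI)
    show um: "u \<in> borel_measurable borel" using qm by (simp add: quasi_minimizer_def)
    note um[measurable]
    have ufin: "(\<integral>\<^sup>+x. ennreal (\<bar>u x\<bar> powr p) \<partial>lborel) < \<infinity>" and ugag: "frac_energy u < \<infinity>"
      and umin: "\<And>v. v \<in> borel_measurable borel \<Longrightarrow> (\<integral>\<^sup>+x. ennreal (\<bar>v x\<bar> powr p) \<partial>lborel) < \<infinity> \<Longrightarrow> frac_energy v < \<infinity> \<Longrightarrow>
        (\<And>x. x \<notin> \<Omega> \<Longrightarrow> v x = u x) \<Longrightarrow> frac_energy u \<le> frac_energy v + ennreal M * emeasure lborel {x. v x \<noteq> u x}"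
      using qm by (auto simp: quasi_minimizer_def)
    fix x0 :: 'a and r R k :: real
    assume r: "0 < r" "r < R" and B: "ball x0 R \<subseteq> \<Omega>"
    define m where "m = (r + R) / 2"
    have m: "r < m" "m < R" "m - r = (R - r) / 2" using r by (auto simp: m_def field_simps)
    define \<psi> where "\<psi> x = max 0 (min 1 ((m - dist x0 x) / (m - r)))" for x
    define w where "w x = max (u x - k) 0" for x
    define v where "v x = u x - \<psi> x powr p * w x" for x
    have \<psi>m[measurable]: "\<psi> \<in> borel_measurable borel" unfolding \<psi>_def[abs_def] by measurable
    have wm[measurable]: "w \<in> borel_measurable borel" unfolding w_def[abs_def] by measurable
    have vm[measurable]: "v \<in> borel_measurable borel" unfolding v_def[abs_def] by measurable
    have w0: "0 \<le> w x" for x by (simp add: w_def)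
    have \<psi>01: "0 \<le> \<psi> x" "\<psi> x \<le> 1" for x by (auto simp: \<psi>_def)
    have \<psi>1: "\<psi> x = 1" if "x \<in> ball x0 r" for x
    proof -
      have "1 \<le> (m - dist x0 x) / (m - r)" using that m by (simp add: field_simps)
      then show ?thesis by (simp add: \<psi>_def)
    qed
    have \<psi>0: "\<psi> x = 0" if "x \<notin> ball x0 m" for x
    proof -
      have "(m - dist x0 x) / (m - r) \<le> 0" using that m by (simp add: divide_nonpos_pos)
      then show ?thesis by (simp add: \<psi>_def)
    qed
    define L where "L = 2 / (R - r)"
    have \<psi>L: "\<bar>\<psi> x - \<psi> y\<bar> \<le> L * norm (x - y)" for x y
    proof -
      have "\<bar>\<psi> x - \<psi> y\<bar> \<le> \<bar>(m - dist x0 x) / (m - r) - (m - dist x0 y) / (m - r)\<bar>"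
        unfolding \<psi>_def by linarith
      also have "\<dots> = \<bar>dist x0 y - dist x0 x\<bar> / (m - r)"
        using m by (simp add: diff_divide_distrib[symmetric] abs_divide)
      also have "\<dots> \<le> norm (x - y) / (m - r)"
        using m dist_triangle[of x0 y x] dist_triangle[of x0 x y] unfolding dist_norm[of x y, symmetric]
        by (intro divide_right_mono) (auto simp: dist_commute abs_le_iff)
      also have "\<dots> = L * norm (x - y)" unfolding m(3) L_def by simp
      finally show ?thesis .
    qed
    have mB: "ball x0 m \<subseteq> ball x0 R" using m by auto
    \<comment> \<open>\<open>f1\<close> is the error of a pair inside the large ball,
      \<open>f2\<close> that of a pair reaching outside it, \<open>g\<close> the gain. Each error is
      charged to its first point, so the full error is the sum over both orders.\<close>
    define f1 where "f1 x y = (if x \<in> ball x0 R \<and> y \<in> ball x0 R then p powr p * \<bar>\<psi> x - \<psi> y\<bar> powr p * w x powr p else 0)" for x y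
    define f2 where "f2 x y = (if x \<in> ball x0 m \<and> y \<notin> ball x0 R then p * w x * w y powr (p - 1) else 0)" for x y
    define g where "g x y = (if x \<in> ball x0 r \<and> u y \<le> k then w x powr p + w x * (k - u y) powr (p - 1) else 0)" for x y
    have nn: "0 \<le> f1 x y" "0 \<le> f2 x y" "0 \<le> g x y" for x y
      using w0 p2 by (auto simp: f1_def f2_def g_def)
    have f1m: "(\<lambda>(x, y). f1 x y) \<in> borel_measurable (lborel \<Otimes>\<^sub>M lborel)"
      unfolding f1_def by measurable
    have f2m: "(\<lambda>(x, y). f2 x y) \<in> borel_measurable (lborel \<Otimes>\<^sub>M lborel)"
      unfolding f2_def by measurable
    have gm: "(\<lambda>(x, y). g x y) \<in> borel_measurable (lborel \<Otimes>\<^sub>M lborel)"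
      unfolding g_def by measurable
    note Iadd = ker_integral_add and Iswap = ker_integral_swap and I_def = ker_integral_def
    define D where "D z x y = \<bar>z x - z y\<bar> powr p" for z :: "'a \<Rightarrow> real" and x y
    have Dm: "(\<lambda>(x, y). D z x y) \<in> borel_measurable (lborel \<Otimes>\<^sub>M lborel)"
      if [measurable]: "z \<in> borel_measurable borel" for z unfolding D_def by measurable
    have energy_eq: "frac_energy z = ker_integral (D z)" for z by (simp add: frac_energy_def I_def D_def)
    have pw: "D v x y + g x y \<le> D u x y + ((f1 x y + f2 x y) + (f1 y x + f2 y x))" for x y
    proof -
      have mR: "z \<in> ball x0 m \<Longrightarrow> z \<in> ball x0 R" for z using mB by blast
      show ?thesis
        unfolding D_def v_def f1_def f2_def g_def w_def add.assoc[symmetric, of "\<bar>u x - u y\<bar> powr p" "_ + _"]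
        by (rule truncation_pointwise) (fact \<psi>01 mR \<psi>1 \<psi>0)+
    qed
    define F where "F x y = f1 x y + f2 x y" for x y
    have Fm: "(\<lambda>(x, y). F x y) \<in> borel_measurable (lborel \<Otimes>\<^sub>M lborel)"
      unfolding F_def f1_def f2_def by measurable
    have main: "frac_energy v + ker_integral g \<le> frac_energy u + 2 * ker_integral F"
    proof -
      have Fm': "(\<lambda>(x, y). F y x) \<in> borel_measurable (lborel \<Otimes>\<^sub>M lborel)"
        unfolding F_def f1_def f2_def by measurable
      have FF: "(\<lambda>(x, y). F x y + F y x) \<in> borel_measurable (lborel \<Otimes>\<^sub>M lborel)"
        using borel_measurable_add[OF Fm Fm'] by (simp add: case_prod_unfold)
      have F0: "0 \<le> F x y" for x y using nn by (simp add: F_def)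
      have D0: "0 \<le> D z x y" for z x y by (simp add: D_def)
      have "frac_energy v + ker_integral g = ker_integral (\<lambda>x y. D v x y + g x y)"
        unfolding energy_eq by (rule Iadd[symmetric, OF Dm[OF vm] gm D0 nn(3)])
      also have "\<dots> \<le> ker_integral (\<lambda>x y. D u x y + (F x y + F y x))"
        unfolding I_def F_def by (intro nn_integral_mono ennreal_leI mult_right_mono pw) auto
      also have "\<dots> = ker_integral (D u) + ker_integral (\<lambda>x y. F x y + F y x)"
        by (rule Iadd[OF Dm[OF um] FF D0]) (simp add: F0)
      also have "ker_integral (\<lambda>x y. F x y + F y x) = ker_integral F + ker_integral (\<lambda>x y. F y x)"
        by (rule Iadd[OF Fm Fm' F0 F0])
      also have "ker_integral (\<lambda>x y. F y x) = ker_integral F" by (rule Iswap[OF Fm])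
      finally show ?thesis by (simp add: energy_eq mult_2)
    qed
    define W1 where "W1 = (\<integral>\<^sup>+x\<in>ball x0 R. ennreal (w x) \<partial>lborel)"
    define Wp where "Wp = (\<integral>\<^sup>+x\<in>ball x0 R. ennreal (w x powr p) \<partial>lborel)"
    define T where "T = (\<integral>\<^sup>+y\<in>- ball x0 R. ennreal (w y powr (p - 1) * ker (y - x0)) \<partial>lborel)"
    define Q where "Q = (R / (R - r)) powr ?e"
    have q: "1 \<le> R / (R - r)" using r by simp
    have Q0: "0 \<le> Q" by (simp add: Q_def)
    have F1: "ker_integral f1 \<le> ennreal (C2 * Q) * (ennreal (R powr - (s * p)) * Wp)"
    proof -
      have "ker_integral f1 \<le> (\<integral>\<^sup>+x. ennreal (p powr p * (C1 * L powr p * R powr (p - s * p))) * (ennreal (w x powr p) * indicator (ball x0 R) x) \<partial>lborel)"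
        unfolding I_def
      proof (intro nn_integral_mono)
        fix x
        have "(\<integral>\<^sup>+y. ennreal (f1 x y * ker (x - y)) \<partial>lborel)
           = (\<integral>\<^sup>+y. ennreal (p powr p * w x powr p) * (ennreal (\<bar>\<psi> x - \<psi> y\<bar> powr p * ker (x - y)) * indicator (ball x0 R) y) \<partial>lborel)
             * indicator (ball x0 R) x"
          by (cases "x \<in> ball x0 R")
            (auto simp: f1_def ennreal_mult[symmetric] indicator_def mult_ac intro!: nn_integral_cong)
        also have "\<dots> = ennreal (p powr p * w x powr p) * (\<integral>\<^sup>+y\<in>ball x0 R. ennreal (\<bar>\<psi> x - \<psi> y\<bar> powr p * ker (x - y)) \<partial>lborel)
             * indicator (ball x0 R) x"
          by (subst nn_integral_cmult) auto
        also have "\<dots> \<le> ennreal (p powr p * w x powr p) * ennreal (C1 * L powr p * R powr (p - s * p)) * indicator (ball x0 R) x"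
        proof (cases "x \<in> ball x0 R")
          case True
          show ?thesis using r True by (intro mult_right_mono mult_left_mono C1(2) \<psi>L) (auto simp: L_def)
        qed simp
        also have "\<dots> = ennreal (p powr p * (C1 * L powr p * R powr (p - s * p))) * (ennreal (w x powr p) * indicator (ball x0 R) x)"
          using C1(1) by (simp add: ennreal_mult[symmetric] mult_ac indicator_def)
        finally show "(\<integral>\<^sup>+y. ennreal (f1 x y * ker (x - y)) \<partial>lborel) \<le> \<dots>" .
      qed
      also have "\<dots> = ennreal (p powr p * (C1 * L powr p * R powr (p - s * p))) * Wp"
        unfolding Wp_def by (rule nn_integral_cmult) measurable
      also have "\<dots> \<le> ennreal (C2 * Q * R powr - (s * p)) * Wp"
      proof (intro mult_right_mono ennreal_leI)
        have "L powr p * R powr (p - s * p) = 2 powr p * (R / (R - r)) powr p * R powr - (s * p)"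
          using r by (simp add: L_def powr_divide powr_diff powr_minus_divide)
        also have "\<dots> \<le> 2 powr p * Q * R powr - (s * p)"
          unfolding Q_def using q by (intro mult_right_mono mult_left_mono powr_mono) auto
        finally have "(p powr p * C1) * (L powr p * R powr (p - s * p)) \<le> (p powr p * C1) * (2 powr p * Q * R powr - (s * p))"
          using C1(1) by (intro mult_left_mono) auto
        then show "p powr p * (C1 * L powr p * R powr (p - s * p)) \<le> C2 * Q * R powr - (s * p)"
          by (simp add: C2_def mult_ac)
      qed auto
      also have "\<dots> = ennreal (C2 * Q) * (ennreal (R powr - (s * p)) * Wp)"
        using Cpos Q0 by (simp add: ennreal_mult mult_ac)
      finally show ?thesis .
    qed
    have F2: "ker_integral f2 \<le> ennreal (C3 * Q) * (W1 * T)"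
    proof -
      have "ker_integral f2 \<le> (\<integral>\<^sup>+x. (ennreal (C3 * Q) * T) * (ennreal (w x) * indicator (ball x0 R) x) \<partial>lborel)"
        unfolding I_def
      proof (intro nn_integral_mono)
        fix x
        have "(\<integral>\<^sup>+y. ennreal (f2 x y * ker (x - y)) \<partial>lborel)
          \<le> (\<integral>\<^sup>+y. (ennreal (C3 * Q * w x) * indicator (ball x0 R) x) * (ennreal (w y powr (p - 1) * ker (y - x0)) * indicator (- ball x0 R) y) \<partial>lborel)"
        proof (intro nn_integral_mono)
          fix y
          show "ennreal (f2 x y * ker (x - y))
            \<le> (ennreal (C3 * Q * w x) * indicator (ball x0 R) x) * (ennreal (w y powr (p - 1) * ker (y - x0)) * indicator (- ball x0 R) y)"
          proof (cases "x \<in> ball x0 m \<and> y \<notin> ball x0 R")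
            case True
            then have xR: "x \<in> ball x0 R" using mB by blast
            have "ker (x - y) \<le> 2 powr ?e * Q * ker (y - x0)"
              unfolding Q_def using True r by (intro ker_le_center) (auto simp: m_def)
            then have "p * w x * w y powr (p - 1) * ker (x - y) \<le> p * w x * w y powr (p - 1) * (2 powr ?e * Q * ker (y - x0))"
              using w0 p2 by (intro mult_left_mono) auto
            then have le: "f2 x y * ker (x - y) \<le> (C3 * Q * w x) * (w y powr (p - 1) * ker (y - x0))"
              using True by (simp add: f2_def C3_def mult_ac)
            have "ennreal (f2 x y * ker (x - y)) \<le> ennreal (C3 * Q * w x) * ennreal (w y powr (p - 1) * ker (y - x0))"
              using le Cpos Q0 w0 by (subst ennreal_mult[symmetric]) (auto intro: ennreal_leI)
            then show ?thesis using True xR by simp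
          next
            case False
            then have "f2 x y = 0" by (auto simp: f2_def)
            then show ?thesis by simp
          qed
        qed
        also have "\<dots> = (ennreal (C3 * Q * w x) * indicator (ball x0 R) x) * T"
          unfolding T_def by (rule nn_integral_cmult) measurable
        also have "\<dots> = (ennreal (C3 * Q) * T) * (ennreal (w x) * indicator (ball x0 R) x)"
          using Cpos Q0 w0 by (simp add: ennreal_mult mult_ac)
        finally show "(\<integral>\<^sup>+y. ennreal (f2 x y * ker (x - y)) \<partial>lborel) \<le> \<dots>" .
      qed
      also have "\<dots> = (ennreal (C3 * Q) * T) * W1"
        unfolding W1_def by (rule nn_integral_cmult) measurable
      finally show ?thesis by (simp add: mult_ac)
    qed
    have IF: "2 * ker_integral F \<le> ennreal (C * Q) * (ennreal (R powr - (s * p)) * Wp + W1 * T)"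
    proof -
      have "ker_integral F = ker_integral f1 + ker_integral f2" unfolding F_def by (rule Iadd[OF f1m f2m nn(1) nn(2)])
      also have "\<dots> \<le> ennreal ((C2 + C3) * Q) * (ennreal (R powr - (s * p)) * Wp) + ennreal ((C2 + C3) * Q) * (W1 * T)"
        using Cpos Q0 by (intro add_mono order_trans[OF F1] order_trans[OF F2] mult_right_mono ennreal_leI) auto
      also have "\<dots> = ennreal ((C2 + C3) * Q) * (ennreal (R powr - (s * p)) * Wp + W1 * T)"
        by (simp add: distrib_left)
      finally have "2 * ker_integral F \<le> 2 * (ennreal ((C2 + C3) * Q) * (ennreal (R powr - (s * p)) * Wp + W1 * T))"
        by (intro mult_left_mono) auto
      moreover have "2 * ennreal ((C2 + C3) * Q) = ennreal (C * Q)"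
        using Cpos Q0 unfolding C_def by (subst ennreal_numeral[symmetric], subst ennreal_mult[symmetric]) (auto simp: mult_ac)
      ultimately show ?thesis by (simp only: mult.assoc[symmetric])
    qed
    \<comment> \<open>Cancelling the energy of \<open>v\<close> requires it to be finite. If the
      error integral is infinite there is nothing to show; otherwise \<open>main\<close> bounds the
      energy of \<open>v\<close>, which makes \<open>v\<close> a competitor.\<close>
    have key: "ker_integral g \<le> 2 * ker_integral F + ennreal M * emeasure lborel {x \<in> ball x0 R. k < u x}"
    proof (cases "2 * ker_integral F < \<infinity>")
      case True
      have "frac_energy v \<le> frac_energy v + ker_integral g" by simp
      also note main
      finally have vgag: "frac_energy v < \<infinity>"
        using ugag True by (metis ennreal_add_eq_top infinity_ennreal_def order_le_less_trans top.not_eq_extremum)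
      have "(\<integral>\<^sup>+x. ennreal (\<bar>v x\<bar> powr p) \<partial>lborel)
        \<le> (\<integral>\<^sup>+x. ennreal (\<bar>u x\<bar> powr p) + ennreal (\<bar>k\<bar> powr p) * indicator (ball x0 m) x \<partial>lborel)"
      proof (intro nn_integral_mono)
        fix x
        show "ennreal (\<bar>v x\<bar> powr p) \<le> ennreal (\<bar>u x\<bar> powr p) + ennreal (\<bar>k\<bar> powr p) * indicator (ball x0 m) x"
        proof (cases "x \<in> ball x0 m \<and> k < u x")
          case True
          have "\<psi> x powr p \<le> 1" "0 \<le> \<psi> x powr p" using \<psi>01[of x] p2 by (auto intro: powr_le1)
          then have "0 \<le> \<psi> x powr p * w x" "\<psi> x powr p * w x \<le> w x" using w0[of x] by (auto intro: mult_left_le_one_le)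
          \<comment> \<open>Where it differs from \<open>u\<close>, the truncation lies between
            \<open>k\<close> and \<open>u\<close>. This happens only in a ball, so the constant
            \<open>k\<close> adds a finite amount to the integral of the p-th power.\<close>
          then have "\<bar>v x\<bar> \<le> max \<bar>u x\<bar> \<bar>k\<bar>" using True unfolding v_def w_def by linarith
          then have "\<bar>v x\<bar> powr p \<le> max \<bar>u x\<bar> \<bar>k\<bar> powr p" using p2 by (intro powr_mono2) auto
          also have "\<dots> \<le> \<bar>u x\<bar> powr p + \<bar>k\<bar> powr p" by (simp add: max_def)
          finally show ?thesis using True by (simp add: ennreal_plus[symmetric] ennreal_leI del: ennreal_plus)
        next
          case False
          then have "v x = u x" using \<psi>0[of x] p2 by (auto simp: v_def w_def)
          then show ?thesis by simp
        qed
      qed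
      also have "\<dots> = (\<integral>\<^sup>+x. ennreal (\<bar>u x\<bar> powr p) \<partial>lborel) + ennreal (\<bar>k\<bar> powr p) * emeasure lborel (ball x0 m)"
        by (subst nn_integral_add) (auto simp: nn_integral_cmult_indicator)
      also have "\<dots> < \<infinity>" using ufin emeasure_ball_powr[of m x0] m r
        by (simp add: ennreal_mult[symmetric] less_top[symmetric])
      finally have vfin: "(\<integral>\<^sup>+x. ennreal (\<bar>v x\<bar> powr p) \<partial>lborel) < \<infinity>" .
      have vout: "v x = u x" if "x \<notin> \<Omega>" for x
      proof -
        have "\<psi> x = 0" using that B mB \<psi>0[of x] by blast
        then show ?thesis using p2 by (simp add: v_def)
      qed
      have "{x. v x \<noteq> u x} \<subseteq> {x \<in> ball x0 R. k < u x}"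
      proof safe
        fix x assume "v x \<noteq> u x"
        then have "\<psi> x powr p \<noteq> 0" "w x \<noteq> 0" by (auto simp: v_def)
        then have "x \<in> ball x0 m" using \<psi>0[of x] by auto
        then show "x \<in> ball x0 R" using mB by blast
        show "k < u x" using \<open>w x \<noteq> 0\<close> by (auto simp: w_def max_def split: if_splits)
      qed
      then have sub: "emeasure lborel {x. v x \<noteq> u x} \<le> emeasure lborel {x \<in> ball x0 R. k < u x}"
        by (intro emeasure_mono) auto
      have "frac_energy v + ker_integral g \<le> frac_energy u + 2 * ker_integral F" by (rule main)
      also have "\<dots> \<le> (frac_energy v + ennreal M * emeasure lborel {x. v x \<noteq> u x}) + 2 * ker_integral F"
        by (intro add_right_mono umin vm vfin vgag vout)
      also have "\<dots> \<le> (frac_energy v + ennreal M * emeasure lborel {x \<in> ball x0 R. k < u x}) + 2 * ker_integral F"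
        by (intro add_right_mono add_left_mono mult_left_mono sub) auto
      finally have "frac_energy v + ker_integral g \<le> frac_energy v + (2 * ker_integral F + ennreal M * emeasure lborel {x \<in> ball x0 R. k < u x})"
        by (simp add: add_ac)
      then show ?thesis using vgag by (auto simp: ennreal_add_left_cancel_le)
    qed (simp add: less_top[symmetric])
    have "(\<integral>\<^sup>+x\<in>ball x0 r. (\<integral>\<^sup>+y\<in>{y. u y \<le> k}.
           ennreal ((w x powr p + w x * (k - u y) powr (p - 1)) * ker (x - y)) \<partial>lborel) \<partial>lborel) = ker_integral g"
      unfolding I_def by (intro nn_integral_cong) (auto simp: g_def indicator_def intro!: nn_integral_cong)
    also note key
    also note add_right_mono[OF IF]
    finally show "(\<integral>\<^sup>+x\<in>ball x0 r. (\<integral>\<^sup>+y\<in>{y. u y \<le> k}.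
           ennreal ((max (u x - k) 0 powr p + max (u x - k) 0 * (k - u y) powr (p - 1)) * ker (x - y))
         \<partial>lborel) \<partial>lborel)
       \<le> ennreal (C * (R / (R - r)) powr (DIM('a) + p)) *
           (ennreal (R powr - (s * p)) * (\<integral>\<^sup>+x\<in>ball x0 R. ennreal (max (u x - k) 0 powr p) \<partial>lborel)
            + (\<integral>\<^sup>+x\<in>ball x0 R. ennreal (max (u x - k) 0) \<partial>lborel) *
              (\<integral>\<^sup>+y\<in>- ball x0 R. ennreal (max (u y - k) 0 powr (p - 1) * ker (y - x0)) \<partial>lborel))
         + ennreal M * emeasure lborel {x \<in> ball x0 R. k < u x}"
      by (simp add: w_def Q_def Wp_def W1_def T_def)
  qed
  then show ?thesis using Cpos(3) by blast
qed

end

section \<open>Local boundedness\<close>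

lemma ennreal_le_divide:
  assumes "0 < a" "0 \<le> b" "ennreal a * P \<le> ennreal b"
  shows "P \<le> ennreal (b / a)"
proof -
  have "P = ennreal (1 / a) * (ennreal a * P)"
    using assms(1) by (simp add: mult.assoc[symmetric] ennreal_mult[symmetric])
  also have "\<dots> \<le> ennreal (1 / a) * ennreal b" by (intro mult_left_mono assms) auto
  also have "\<dots> = ennreal (b / a)" using assms by (simp add: ennreal_mult[symmetric])
  finally show ?thesis .
qed

context fractional_energy begin

text \<open>Of the left-hand side in the class only (u - h)_+^p is kept. Its inner kernel integral
  is compared with the one over the complement of A = {u > h} in the large ball, where |A| is at
  most d = Y/(h - k)^p by Chebyshev's inequality. This puts d^(-sp/n) on the left, hence a
  superlinear power of \<open>Y\<close> on the right. \<open>Y\<close> and \<open>T\<close> are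
  bounds and not the integrals themselves, so that \<open>Y\<close> can be taken positive and
  finite.\<close>

lemma de_giorgi_level_step:
  assumes "0 \<le> C"
  shows "\<exists>C'>0. \<forall>M (\<Omega>::'a::euclidean_space set) u x0 r R k h Y T.
    0 \<le> M \<longrightarrow> de_giorgi C M \<Omega> u \<longrightarrow> 0 < r \<longrightarrow> r < R \<longrightarrow> ball x0 R \<subseteq> \<Omega> \<longrightarrow> k < h \<longrightarrow> 0 < Y \<longrightarrow> 0 \<le> T \<longrightarrow>
    (\<integral>\<^sup>+x\<in>ball x0 R. ennreal (max (u x - k) 0 powr p) \<partial>lborel) \<le> ennreal Y \<longrightarrow>
    (\<integral>\<^sup>+y\<in>- ball x0 R. ennreal (max (u y - h) 0 powr (p - 1) * ker (y - x0)) \<partial>lborel) \<le> ennreal T \<longrightarrow>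
    (\<integral>\<^sup>+x\<in>ball x0 r. ennreal (max (u x - h) 0 powr p) \<partial>lborel)
     \<le> ennreal (C' * (Y / (h - k) powr p) powr (s * p / DIM('a)) * Y *
         ((R / (R - r)) powr (DIM('a) + p) * (R powr - (s * p) + (h - k) powr (1 - p) * T) + M * (h - k) powr - p))"
proof -
  let ?n = "real DIM('a)"
  let ?sp = "s * p"
  obtain c1 where c1_pos: "c1 > 0" and c1_all: "\<forall>(A::'a set) d x. A \<in> sets borel \<longrightarrow> d > 0 \<longrightarrow> emeasure lborel A \<le> ennreal d \<longrightarrow>
    ennreal (c1 * d powr (- (?sp / ?n))) \<le> (\<integral>\<^sup>+y\<in>- A. ennreal (1 / norm (x - y) powr (?n + ?sp)) \<partial>lborel)"
    using kernel_integral_complement_ge[OF sp0, where 'a = 'a] by (elim exE conjE)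
  obtain C2 where C2_pos: "C2 > 0" and C2_all: "\<forall>(x::'a) \<rho>. \<rho> > 0 \<longrightarrow>
    (\<integral>\<^sup>+y\<in>- ball x \<rho>. ennreal (1 / norm (x - y) powr (?n + ?sp)) \<partial>lborel) \<le> ennreal (C2 * \<rho> powr (-?sp))"
    using far_kernel_integral[OF sp0, where 'a = 'a] by (elim exE conjE)
  define C' where "C' = (C + C2 + 1) / c1"
  have "C' > 0" using c1_pos C2_pos assms by (simp add: C'_def)
  moreover have "(\<integral>\<^sup>+x\<in>ball x0 r. ennreal (max (u x - h) 0 powr p) \<partial>lborel)
     \<le> ennreal (C' * (Y / (h - k) powr p) powr (?sp / ?n) * Y *
         ((R / (R - r)) powr (?n + p) * (R powr - ?sp + (h - k) powr (1 - p) * T) + M * (h - k) powr - p))"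
    if M: "0 \<le> M" and dg: "de_giorgi C M \<Omega> u" and r: "0 < r" "r < R" and B: "ball x0 R \<subseteq> \<Omega>" and kh: "k < h"
      and Y: "0 < Y" and T: "0 \<le> T"
      and hY: "(\<integral>\<^sup>+x\<in>ball x0 R. ennreal (max (u x - k) 0 powr p) \<partial>lborel) \<le> ennreal Y"
      and hT: "(\<integral>\<^sup>+y\<in>- ball x0 R. ennreal (max (u y - h) 0 powr (p - 1) * ker (y - x0)) \<partial>lborel) \<le> ennreal T"
    for M and \<Omega> :: "'a set" and u x0 r R k h Y T
  proof -
    have um[measurable]: "u \<in> borel_measurable borel" using dg by (simp add: de_giorgi_def)
    define w where "w x = max (u x - h) 0" for x
    define w' where "w' x = max (u x - k) 0" for x
    have [measurable]: "w \<in> borel_measurable borel" unfolding w_def[abs_def] by measurable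
    have [measurable]: "w' \<in> borel_measurable borel" unfolding w'_def[abs_def] by measurable
    have w0: "0 \<le> w x" "0 \<le> w' x" "w x \<le> w' x" for x using kh by (auto simp: w_def w'_def)
    define \<delta> where "\<delta> = h - k"
    have \<delta>: "\<delta> > 0" using kh by (simp add: \<delta>_def)
    define Q where "Q = (R / (R - r)) powr (?n + p)"
    have q: "1 \<le> R / (R - r)" using r by simp
    have Q1: "0 \<le> Q" by (simp add: Q_def)
    have i1: "(\<integral>\<^sup>+x\<in>ball x0 R. ennreal (w x powr p) \<partial>lborel) \<le> ennreal Y"
      by (rule order_trans[OF nn_integral_mono hY[folded w'_def]])
        (use w0 p2 in \<open>auto intro!: mult_right_mono ennreal_leI powr_mono2\<close>)
    have scaled: "(\<integral>\<^sup>+x. ennreal a * (ennreal (w' x powr p) * indicator (ball x0 R) x) \<partial>lborel) \<le> ennreal (a * Y)"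
      if "0 \<le> a" for a
    proof -
      have "(\<integral>\<^sup>+x. ennreal a * (ennreal (w' x powr p) * indicator (ball x0 R) x) \<partial>lborel)
          = ennreal a * (\<integral>\<^sup>+x\<in>ball x0 R. ennreal (w' x powr p) \<partial>lborel)"
        by (rule nn_integral_cmult) measurable
      also have "\<dots> \<le> ennreal a * ennreal Y" using hY by (intro mult_left_mono) (auto simp: w'_def)
      finally show ?thesis using that Y by (simp add: ennreal_mult)
    qed
    \<comment> \<open>Where \<open>w\<close> is positive, \<open>w'\<close> is at least \<delta>;
      the missing powers of \<open>w'\<close> are paid for by negative powers of \<delta>. The bound
      on the measure of \<open>A\<close> uses the same observation with power 0.\<close>
    have i2: "(\<integral>\<^sup>+x\<in>ball x0 R. ennreal (w x) \<partial>lborel) \<le> ennreal (\<delta> powr (1 - p) * Y)"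
    proof (rule order_trans[OF nn_integral_mono scaled])
      fix x
      have "w x \<le> \<delta> powr (1 - p) * w' x powr p"
      proof (cases "w x = 0")
        case False
        then have "\<delta> \<le> w' x" using w0(1)[of x] by (auto simp: w_def w'_def \<delta>_def max_def split: if_splits)
        have "w x \<le> w' x" by (rule w0)
        also have "\<dots> = w' x powr (1 - p) * w' x powr p"
          using \<open>\<delta> \<le> w' x\<close> \<delta> by (simp flip: powr_add)
        also have "\<dots> \<le> \<delta> powr (1 - p) * w' x powr p"
          using \<open>\<delta> \<le> w' x\<close> \<delta> p2 by (intro mult_right_mono powr_mono2') auto
        finally show ?thesis .
      qed simp
      then show "ennreal (w x) * indicator (ball x0 R) x
          \<le> ennreal (\<delta> powr (1 - p)) * (ennreal (w' x powr p) * indicator (ball x0 R) x)"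
        by (auto simp: indicator_def ennreal_mult[symmetric] ennreal_leI)
    qed simp
    define A where "A = {x \<in> ball x0 R. h < u x}"
    have A[measurable]: "A \<in> sets borel" unfolding A_def by measurable
    have i3: "emeasure lborel A \<le> ennreal (\<delta> powr - p * Y)"
    proof -
      have "emeasure lborel A = (\<integral>\<^sup>+x. indicator A x \<partial>lborel)" by simp
      also have "\<dots> \<le> ennreal (\<delta> powr - p * Y)"
      proof (rule order_trans[OF nn_integral_mono scaled])
        fix x
        have "1 \<le> \<delta> powr - p * w' x powr p" if "x \<in> A"
        proof -
          have "\<delta> powr p \<le> w' x powr p" using that \<delta> p2 by (intro powr_mono2) (auto simp: A_def \<delta>_def w'_def)
          then show ?thesis using \<delta> by (simp add: powr_minus_divide)
        qed
        then show "indicator A x \<le> ennreal (\<delta> powr - p) * (ennreal (w' x powr p) * indicator (ball x0 R) x)"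
          by (auto simp: indicator_def ennreal_mult[symmetric] A_def)
      qed simp
      finally show ?thesis .
    qed
    define E where "E = C * Q * (R powr - ?sp * Y + \<delta> powr (1 - p) * Y * T) + M * (\<delta> powr - p * Y)"
    have E0: "0 \<le> E" unfolding E_def using assms Q1 Y T M by (intro add_nonneg_nonneg mult_nonneg_nonneg) auto
    let ?J = "\<lambda>x. \<integral>\<^sup>+y\<in>{y. u y \<le> h}. ennreal (ker (x - y)) \<partial>lborel"
    have [measurable]: "{y. u y \<le> h} \<in> sets borel" by measurable
    have Jm: "?J \<in> borel_measurable lborel"
      by (rule lborel.borel_measurable_nn_integral) measurable
    have "(\<integral>\<^sup>+x. (ennreal (w x powr p) * indicator (ball x0 r) x) * ?J x \<partial>lborel)
      \<le> (\<integral>\<^sup>+x\<in>ball x0 r. (\<integral>\<^sup>+y\<in>{y. u y \<le> h}. ennreal ((w x powr p + w x * (h - u y) powr (p - 1)) * ker (x - y)) \<partial>lborel) \<partial>lborel)"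
    proof (intro nn_integral_mono)
      fix x
      have "ennreal (w x powr p) * ?J x = (\<integral>\<^sup>+y. ennreal (w x powr p) * (ennreal (ker (x - y)) * indicator {y. u y \<le> h} y) \<partial>lborel)"
        by (rule nn_integral_cmult[symmetric]) measurable
      also have "\<dots> \<le> (\<integral>\<^sup>+y\<in>{y. u y \<le> h}. ennreal ((w x powr p + w x * (h - u y) powr (p - 1)) * ker (x - y)) \<partial>lborel)"
        using w0(1)[of x] by (intro nn_integral_mono) (auto simp: indicator_def ennreal_mult[symmetric] intro!: ennreal_leI mult_right_mono)
      finally show "(ennreal (w x powr p) * indicator (ball x0 r) x) * ?J x
        \<le> (\<integral>\<^sup>+y\<in>{y. u y \<le> h}. ennreal ((w x powr p + w x * (h - u y) powr (p - 1)) * ker (x - y)) \<partial>lborel) * indicator (ball x0 r) x"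
        by (simp add: indicator_def)
    qed
    also have "\<dots> \<le> ennreal (C * Q) * (ennreal (R powr - ?sp) * (\<integral>\<^sup>+x\<in>ball x0 R. ennreal (w x powr p) \<partial>lborel)
            + (\<integral>\<^sup>+x\<in>ball x0 R. ennreal (w x) \<partial>lborel) * (\<integral>\<^sup>+y\<in>- ball x0 R. ennreal (w y powr (p - 1) * ker (y - x0)) \<partial>lborel))
         + ennreal M * emeasure lborel A"
      using dg r B unfolding de_giorgi_def w_def Q_def A_def by blast
    also have "\<dots> \<le> ennreal (C * Q) * (ennreal (R powr - ?sp) * ennreal Y + ennreal (\<delta> powr (1 - p) * Y) * ennreal T)
         + ennreal M * ennreal (\<delta> powr - p * Y)"
      by (intro add_mono mult_mono i1 i2 i3 hT[folded w_def]) auto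
    also have "\<dots> = ennreal E"
      unfolding E_def using assms Q1 Y T M by (simp add: ennreal_mult[symmetric] ennreal_plus[symmetric] del: ennreal_plus)
    finally have LE: "(\<integral>\<^sup>+x. (ennreal (w x powr p) * indicator (ball x0 r) x) * ?J x \<partial>lborel) \<le> ennreal E" .
    define d where "d = Y / \<delta> powr p"
    have d: "d > 0" "emeasure lborel A \<le> ennreal d" using Y \<delta> i3 by (auto simp: d_def powr_minus_divide)
    define P where "P = (\<integral>\<^sup>+x\<in>ball x0 r. ennreal (w x powr p) \<partial>lborel)"
    have P: "P \<le> ennreal Y" unfolding P_def
      by (rule order_trans[OF nn_integral_mono i1]) (use r in \<open>auto simp: indicator_def\<close>)
    \<comment> \<open>The set {u \<le> h} misses those points of the complement of \<open>A\<close>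
      that lie above the level and outside the large ball. Seen from the small ball they are at
      distance at least R - r, so they cost only the second summand.\<close>
    have low: "ennreal (c1 * d powr (- (?sp / ?n))) \<le> ?J x + ennreal (C2 * (R - r) powr - ?sp)" if x: "x \<in> ball x0 r" for x
    proof -
      have "ennreal (c1 * d powr (- (?sp / ?n))) \<le> (\<integral>\<^sup>+y\<in>- A. ennreal (ker (x - y)) \<partial>lborel)"
        using c1_all[rule_format, OF A d] unfolding ker_def .
      also have "\<dots> \<le> (\<integral>\<^sup>+y. ennreal (ker (x - y)) * indicator {y. u y \<le> h} y + ennreal (ker (x - y)) * indicator (- ball x (R - r)) y \<partial>lborel)"
      proof (intro nn_integral_mono)
        fix y
        have "u y \<le> h \<or> y \<in> - ball x (R - r)" if "y \<in> - A"
        proof -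
          have "dist x0 y \<le> dist x0 x + dist x y" by (rule dist_triangle)
          then show ?thesis using that x by (auto simp: A_def)
        qed
        then show "ennreal (ker (x - y)) * indicator (- A) y
           \<le> ennreal (ker (x - y)) * indicator {y. u y \<le> h} y + ennreal (ker (x - y)) * indicator (- ball x (R - r)) y"
          by (auto simp: indicator_def)
      qed
      also have "\<dots> = ?J x + (\<integral>\<^sup>+y\<in>- ball x (R - r). ennreal (ker (x - y)) \<partial>lborel)"
        by (rule nn_integral_add) measurable
      also have "\<dots> \<le> ?J x + ennreal (C2 * (R - r) powr - ?sp)"
        using C2_all r unfolding ker_def by (intro add_left_mono) auto
      finally show ?thesis .
    qed
    have "ennreal (c1 * d powr (- (?sp / ?n))) * P
        = (\<integral>\<^sup>+x. ennreal (c1 * d powr (- (?sp / ?n))) * (ennreal (w x powr p) * indicator (ball x0 r) x) \<partial>lborel)"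
      unfolding P_def by (rule nn_integral_cmult[symmetric]) measurable
    also have "\<dots> \<le> (\<integral>\<^sup>+x. (ennreal (w x powr p) * indicator (ball x0 r) x) * ?J x
          + ennreal (C2 * (R - r) powr - ?sp) * (ennreal (w x powr p) * indicator (ball x0 r) x) \<partial>lborel)"
    proof (intro nn_integral_mono)
      fix x
      let ?W = "ennreal (w x powr p) * indicator (ball x0 r) x"
      show "ennreal (c1 * d powr (- (?sp / ?n))) * ?W \<le> ?W * ?J x + ennreal (C2 * (R - r) powr - ?sp) * ?W"
      proof (cases "x \<in> ball x0 r")
        case True
        have "ennreal (c1 * d powr (- (?sp / ?n))) * ?W \<le> (?J x + ennreal (C2 * (R - r) powr - ?sp)) * ?W"
          by (intro mult_right_mono low True) auto
        also have "\<dots> = ?W * ?J x + ennreal (C2 * (R - r) powr - ?sp) * ?W"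
          by (subst distrib_right, subst mult.commute, rule refl)
        finally show ?thesis .
      qed simp
    qed
    also have "\<dots> = (\<integral>\<^sup>+x. (ennreal (w x powr p) * indicator (ball x0 r) x) * ?J x \<partial>lborel)
         + (\<integral>\<^sup>+x. ennreal (C2 * (R - r) powr - ?sp) * (ennreal (w x powr p) * indicator (ball x0 r) x) \<partial>lborel)"
      by (intro nn_integral_add borel_measurable_times_ennreal Jm) measurable
    also have "(\<integral>\<^sup>+x. ennreal (C2 * (R - r) powr - ?sp) * (ennreal (w x powr p) * indicator (ball x0 r) x) \<partial>lborel)
        = ennreal (C2 * (R - r) powr - ?sp) * P"
      unfolding P_def by (rule nn_integral_cmult) measurable
    also have "(\<integral>\<^sup>+x. (ennreal (w x powr p) * indicator (ball x0 r) x) * ?J x \<partial>lborel) + ennreal (C2 * (R - r) powr - ?sp) * P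
        \<le> ennreal E + ennreal (C2 * (R - r) powr - ?sp) * ennreal Y"
      by (intro add_mono LE mult_left_mono P) auto
    also have "\<dots> = ennreal (E + C2 * (R - r) powr - ?sp * Y)"
      using E0 C2_pos Y by (simp add: ennreal_mult[symmetric] ennreal_plus[symmetric] del: ennreal_plus)
    finally have "P \<le> ennreal ((E + C2 * (R - r) powr - ?sp * Y) / (c1 * d powr (- (?sp / ?n))))"
      using c1_pos d E0 C2_pos Y by (intro ennreal_le_divide) auto
    also have "\<dots> \<le> ennreal (C' * d powr (?sp / ?n) * Y * (Q * (R powr - ?sp + \<delta> powr (1 - p) * T) + M * \<delta> powr - p))"
    proof (rule ennreal_leI)
      define G where "G = Q * (R powr - ?sp + \<delta> powr (1 - p) * T)"
      have G0: "0 \<le> G" unfolding G_def using Q1 T by (intro mult_nonneg_nonneg add_nonneg_nonneg) auto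
      have M0: "0 \<le> M * \<delta> powr - p" using M by simp
      have "(R - r) powr - ?sp = (R / (R - r)) powr ?sp * R powr - ?sp"
        using r by (simp add: powr_divide powr_minus_divide)
      also have "\<dots> \<le> Q * R powr - ?sp"
        unfolding Q_def using q spp by (intro mult_right_mono powr_mono) auto
      also have "\<dots> \<le> G" unfolding G_def using Q1 T by (intro mult_left_mono) auto
      finally have "C2 * (R - r) powr - ?sp * Y \<le> C2 * G * Y"
        using C2_pos Y by (intro mult_right_mono mult_left_mono) auto
      moreover have "E = C * G * Y + M * \<delta> powr - p * Y"
        unfolding E_def G_def by (simp add: algebra_simps)
      ultimately have "E + C2 * (R - r) powr - ?sp * Y \<le> (C * G + C2 * G + M * \<delta> powr - p) * Y"
        by (simp add: algebra_simps)
      also have "\<dots> \<le> ((C + C2 + 1) * (G + M * \<delta> powr - p)) * Y"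
      proof (intro mult_right_mono)
        have "0 \<le> (C + C2) * (M * \<delta> powr - p)" using assms C2_pos M0 by simp
        then show "C * G + C2 * G + M * \<delta> powr - p \<le> (C + C2 + 1) * (G + M * \<delta> powr - p)"
          using G0 by (simp add: algebra_simps)
      qed (use Y in auto)
      finally have "(E + C2 * (R - r) powr - ?sp * Y) / (c1 * d powr (- (?sp / ?n)))
          \<le> ((C + C2 + 1) * (G + M * \<delta> powr - p)) * Y / (c1 * d powr (- (?sp / ?n)))"
        using c1_pos d by (intro divide_right_mono) auto
      also have "\<dots> = C' * d powr (?sp / ?n) * Y * (G + M * \<delta> powr - p)"
      proof -
        have "((C + C2 + 1) * X) * Y / (c1 * d powr (- (?sp / ?n))) = C' * d powr (?sp / ?n) * Y * X" for X
          using c1_pos d by (simp add: C'_def powr_minus_divide mult_ac)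
        then show ?thesis .
      qed
      finally show "(E + C2 * (R - r) powr - ?sp * Y) / (c1 * d powr (- (?sp / ?n)))
          \<le> C' * d powr (?sp / ?n) * Y * (Q * (R powr - ?sp + \<delta> powr (1 - p) * T) + M * \<delta> powr - p)"
        by (simp add: G_def)
    qed
    finally show ?thesis by (simp add: P_def w_def d_def \<delta>_def Q_def)
  qed
  ultimately show ?thesis by blast
qed

text \<open>De Giorgi iteration on balls shrinking from radius 2 r to r and levels rising from
  \<open>k0\<close> to k0 + h, with level integrals decaying geometrically. The exterior integral is
  assumed outside the final ball, so that one hypothesis serves all intermediate balls.\<close>

lemma de_giorgi_sup_bound:
  assumes "0 \<le> C" "0 \<le> K"
  shows "\<exists>\<epsilon>>0. \<forall>M (\<Omega>::'a::euclidean_space set) u x0 r k0 h.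
    0 \<le> M \<longrightarrow> de_giorgi C M \<Omega> u \<longrightarrow> 0 < r \<longrightarrow> 0 < h \<longrightarrow> ball x0 (2 * r) \<subseteq> \<Omega> \<longrightarrow> M * r powr (s * p) \<le> K * h powr p \<longrightarrow>
    (\<integral>\<^sup>+y\<in>- ball x0 r. ennreal (max (u y - k0) 0 powr (p - 1) * ker (y - x0)) \<partial>lborel)
      \<le> ennreal (K * h powr (p - 1) * r powr - (s * p)) \<longrightarrow>
    (\<integral>\<^sup>+x\<in>ball x0 (2 * r). ennreal (max (u x - k0) 0 powr p) \<partial>lborel) \<le> ennreal (\<epsilon> * h powr p * r powr DIM('a)) \<longrightarrow>
    (AE x in lborel. x \<in> ball x0 r \<longrightarrow> u x \<le> k0 + h)"
proof -
  let ?n = "real DIM('a)"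
  let ?sp = "s * p"
  define \<beta> where "\<beta> = ?sp / ?n"
  have \<beta>: "\<beta> > 0" "?n * \<beta> = ?sp" using sp0 by (auto simp: \<beta>_def)
  obtain C' where C'_pos: "C' > 0" and step: "\<forall>M (\<Omega>::'a set) u x0 r R k h Y T.
    0 \<le> M \<longrightarrow> de_giorgi C M \<Omega> u \<longrightarrow> 0 < r \<longrightarrow> r < R \<longrightarrow> ball x0 R \<subseteq> \<Omega> \<longrightarrow> k < h \<longrightarrow> 0 < Y \<longrightarrow> 0 \<le> T \<longrightarrow>
    (\<integral>\<^sup>+x\<in>ball x0 R. ennreal (max (u x - k) 0 powr p) \<partial>lborel) \<le> ennreal Y \<longrightarrow>
    (\<integral>\<^sup>+y\<in>- ball x0 R. ennreal (max (u y - h) 0 powr (p - 1) * ker (y - x0)) \<partial>lborel) \<le> ennreal T \<longrightarrow>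
    (\<integral>\<^sup>+x\<in>ball x0 r. ennreal (max (u x - h) 0 powr p) \<partial>lborel)
     \<le> ennreal (C' * (Y / (h - k) powr p) powr (s * p / ?n) * Y *
         ((R / (R - r)) powr (?n + p) * (R powr - (s * p) + (h - k) powr (1 - p) * T) + M * (h - k) powr - p))"
    using de_giorgi_level_step[OF assms(1), where 'a = 'a] by (elim exE conjE)
  \<comment> \<open>A step at z = 2^-(j+1) costs z^(-N): p \<beta> from the superlinear power, n + p
    from the ratio of the radii, and another p from the level gap. \<gamma> is chosen so that
    \<gamma>^(j \<beta>) cancels the growing part 2^(N j), and \<epsilon> so that the remaining
    constants multiply to \<gamma>.\<close>
  define N where "N = p * \<beta> + ?n + 2 * p"
  define \<gamma> where "\<gamma> = 2 powr (- (N / \<beta>))"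
  define D where "D = C' * 2 powr (?n + p) * (1 + 2 * K) * 2 powr N"
  define \<epsilon> where "\<epsilon> = (\<gamma> / D) powr (1 / \<beta>)"
  have N: "0 < N" unfolding N_def using \<beta> p2 by (intro add_nonneg_pos) auto
  have \<gamma>: "0 < \<gamma>" "\<gamma> < 1"
    using N \<beta> powr_less_mono[of "- (N / \<beta>)" 0 2] by (auto simp: \<gamma>_def)
  have D: "0 < D" using C'_pos assms by (simp add: D_def add_pos_nonneg)
  have \<epsilon>: "0 < \<epsilon>" "\<epsilon> powr \<beta> = \<gamma> / D" using \<gamma> D \<beta> by (auto simp: \<epsilon>_def powr_powr)
  have "AE x in lborel. x \<in> ball x0 r \<longrightarrow> u x \<le> k0 + h"
    if M: "0 \<le> M" and dg: "de_giorgi C M \<Omega> u" and r: "0 < r" and h: "0 < h" and B: "ball x0 (2 * r) \<subseteq> \<Omega>"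
      and MK: "M * r powr ?sp \<le> K * h powr p"
      and hT: "(\<integral>\<^sup>+y\<in>- ball x0 r. ennreal (max (u y - k0) 0 powr (p - 1) * ker (y - x0)) \<partial>lborel)
        \<le> ennreal (K * h powr (p - 1) * r powr - ?sp)"
      and h0: "(\<integral>\<^sup>+x\<in>ball x0 (2 * r). ennreal (max (u x - k0) 0 powr p) \<partial>lborel) \<le> ennreal (\<epsilon> * h powr p * r powr ?n)"
    for M and \<Omega> :: "'a set" and u x0 r k0 h
  proof -
    have um[measurable]: "u \<in> borel_measurable borel" using dg by (simp add: de_giorgi_def)
    \<comment> \<open>\<open>b j\<close> is the relative gap of the radii, and also of the levels,
      between the steps j and j + 1; the numbers \<open>2 * b j\<close> are 1, 1/2, 1/4 and so
      on.\<close>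
    define b where "b j = (1 / 2 :: real) ^ Suc j" for j :: nat
    define \<rho> where "\<rho> j = r * (1 + 2 * b j)" for j
    define k where "k j = k0 + h * (1 - 2 * b j)" for j
    define Y where "Y j = \<epsilon> * h powr p * r powr ?n * \<gamma> ^ j" for j
    define T where "T = K * h powr (p - 1) * r powr - ?sp"
    have b: "0 < b j" "2 * b j \<le> 1" "2 * b (Suc j) = b j" for j
      by (auto simp: b_def power_le_one)
    have Y: "0 < Y j" for j using \<epsilon> h r \<gamma> by (simp add: Y_def)
    have T: "0 \<le> T" using assms by (simp add: T_def)
    have main: "(\<integral>\<^sup>+x\<in>ball x0 (\<rho> j). ennreal (max (u x - k j) 0 powr p) \<partial>lborel) \<le> ennreal (Y j)" for j
    proof (induction j)
      case 0
      then show ?case using h0 by (simp add: \<rho>_def k_def Y_def b_def mult.commute)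
    next
      case (Suc j)
      have b1: "0 < b j" "b j \<le> 1" using b[of j] by auto
      have \<rho>j: "r \<le> \<rho> (Suc j)" "\<rho> (Suc j) < \<rho> j" "\<rho> j \<le> 2 * r" "\<rho> j - \<rho> (Suc j) = r * b j" "r \<le> \<rho> j"
        unfolding \<rho>_def b(3) using b[of j] r by (auto simp: algebra_simps)
      have kj: "k (Suc j) - k j = h * b j" "k j < k (Suc j)" "k0 \<le> k (Suc j)"
        unfolding k_def b(3) using b[of j] h by (auto simp: algebra_simps)
      have "ball x0 (\<rho> j) \<subseteq> \<Omega>" using B \<rho>j subset_ball[of "\<rho> j" "2 * r" x0] by auto
      moreover have "(\<integral>\<^sup>+y\<in>- ball x0 (\<rho> j). ennreal (max (u y - k (Suc j)) 0 powr (p - 1) * ker (y - x0)) \<partial>lborel) \<le> ennreal T"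
      proof (rule order_trans[OF nn_integral_mono hT[folded T_def]])
        fix y
        have "max (u y - k (Suc j)) 0 powr (p - 1) * ker (y - x0) \<le> max (u y - k0) 0 powr (p - 1) * ker (y - x0)"
          using kj p2 by (intro mult_right_mono powr_mono2) auto
        then show "ennreal (max (u y - k (Suc j)) 0 powr (p - 1) * ker (y - x0)) * indicator (- ball x0 (\<rho> j)) y
          \<le> ennreal (max (u y - k0) 0 powr (p - 1) * ker (y - x0)) * indicator (- ball x0 r) y"
          using \<rho>j by (auto simp: indicator_def intro: ennreal_leI)
      qed
      moreover have "0 < \<rho> (Suc j)" using \<rho>j r by linarith
      ultimately have "(\<integral>\<^sup>+x\<in>ball x0 (\<rho> (Suc j)). ennreal (max (u x - k (Suc j)) 0 powr p) \<partial>lborel)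
       \<le> ennreal (C' * (Y j / (k (Suc j) - k j) powr p) powr (s * p / ?n) * Y j *
         ((\<rho> j / (\<rho> j - \<rho> (Suc j))) powr (?n + p) * (\<rho> j powr - (s * p) + (k (Suc j) - k j) powr (1 - p) * T) + M * (k (Suc j) - k j) powr - p))"
        using step M dg \<rho>j(2) kj(2) Y T Suc.IH by blast
      also have "\<dots> \<le> ennreal (Y (Suc j))"
      proof (rule ennreal_leI)
        define z where "z = b j"
        have z: "0 < z" "z \<le> 1" using b1 by (auto simp: z_def)
        have e1: "(Y j / (h * z) powr p) powr \<beta> = \<gamma> / D * r powr ?sp * (2 powr - (N * j) * z powr - (p * \<beta>))"
        proof -
          have "Y j / (h * z) powr p = \<epsilon> * r powr ?n * \<gamma> ^ j * z powr - p"
            using h z by (simp add: Y_def powr_mult powr_minus_divide)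
          also have "\<dots> powr \<beta> = \<epsilon> powr \<beta> * r powr (?n * \<beta>) * (\<gamma> ^ j) powr \<beta> * z powr - (p * \<beta>)"
            using z r \<epsilon> \<gamma> by (simp add: powr_mult powr_powr)
          also have "(\<gamma> ^ j) powr \<beta> = 2 powr - (N * j)"
            using \<beta> \<gamma> by (simp add: \<gamma>_def powr_power powr_powr mult.commute)
          finally show ?thesis using \<epsilon> \<beta> by simp
        qed
        have e2: "(\<rho> j / (r * z)) powr (?n + p) \<le> 2 powr (?n + p) * z powr - (?n + p)"
        proof -
          have "\<rho> j / (r * z) \<le> 2 * r / (r * z)" using \<rho>j r z by (intro divide_right_mono) auto
          also have "\<dots> = 2 / z" using r by simp
          finally have "(\<rho> j / (r * z)) powr (?n + p) \<le> (2 / z) powr (?n + p)"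
            using \<rho>j r z p2 by (intro powr_mono2) auto
          also have "\<dots> = 2 powr (?n + p) * z powr - (?n + p)"
            using z by (simp add: powr_divide powr_minus_divide del: minus_add_distrib)
          finally show ?thesis .
        qed
        have e3: "\<rho> j powr - ?sp \<le> r powr - ?sp" using \<rho>j r sp0 by (intro powr_mono2') auto
        have e4: "(h * z) powr (1 - p) * T \<le> K * r powr - ?sp * z powr - p"
        proof -
          have "(h * z) powr (1 - p) * T = K * r powr - ?sp * z powr (1 - p) * (h powr (1 - p) * h powr (p - 1))"
            using h z by (simp add: T_def powr_mult)
          also have "h powr (1 - p) * h powr (p - 1) = 1" using h by (simp flip: powr_add)
          also have "K * r powr - ?sp * z powr (1 - p) * 1 \<le> K * r powr - ?sp * z powr - p"
            using z assms p2 powr_mono'[of "-p" "1-p" z] by (simp add: mult_left_mono)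
          finally show ?thesis .
        qed
        have e5: "M * (h * z) powr - p \<le> K * r powr - ?sp * z powr - p"
        proof -
          have "M * (h * z) powr - p = (M * r powr ?sp) * (h powr - p * z powr - p * r powr - ?sp)"
            using h z r by (simp add: powr_mult powr_minus_divide)
          also have "\<dots> \<le> (K * h powr p) * (h powr - p * z powr - p * r powr - ?sp)"
            by (intro mult_right_mono MK) auto
          also have "\<dots> = K * r powr - ?sp * z powr - p"
            using h by (simp add: powr_minus_divide)
          finally show ?thesis .
        qed
        define W where "W = 2 powr (?n + p) * z powr - (?n + p)"
        have W1: "1 \<le> W"
        proof -
          have "1 \<le> 2 powr (?n + p)" using p2 by (intro ge_one_powr_ge_zero) auto
          moreover have "1 \<le> z powr - (?n + p)" using powr_mono'[of "-(?n+p)" 0 z] z p2 by simp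
          ultimately show ?thesis unfolding W_def using mult_mono[of 1 "2 powr (?n + p)" 1 "z powr - (?n + p)"] by simp
        qed
        have zp: "1 \<le> z powr - p" using powr_mono'[of "-p" 0 z] z p2 by simp
        \<comment> \<open>The near error, the tail and the measure term are brought under one common
          factor; they account for 1, \<open>K\<close> and \<open>K\<close> in
          \<open>1 + 2 * K\<close>.\<close>
        have e6: "(\<rho> j / (r * z)) powr (?n + p) * (\<rho> j powr - ?sp + (h * z) powr (1 - p) * T) + M * (h * z) powr - p
           \<le> W * (r powr - ?sp * z powr - p * (1 + 2 * K))"
        proof -
          have "(\<rho> j / (r * z)) powr (?n + p) * (\<rho> j powr - ?sp + (h * z) powr (1 - p) * T) + M * (h * z) powr - p
             \<le> W * (r powr - ?sp + K * r powr - ?sp * z powr - p) + K * r powr - ?sp * z powr - p"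
            using W1 T by (intro add_mono[OF mult_mono[OF e2[folded W_def] add_mono[OF e3 e4]] e5]) auto
          also have "\<dots> \<le> W * (r powr - ?sp * z powr - p + K * r powr - ?sp * z powr - p) + W * (K * r powr - ?sp * z powr - p)"
          proof (intro add_mono mult_left_mono order_refl)
            show "r powr - ?sp \<le> r powr - ?sp * z powr - p" using zp mult_left_mono[OF zp, of "r powr - ?sp"] by simp
            show "K * r powr - ?sp * z powr - p \<le> W * (K * r powr - ?sp * z powr - p)"
              using W1 assms mult_right_mono[OF W1, of "K * r powr - ?sp * z powr - p"] by simp
          qed (use W1 assms in auto)
          finally show ?thesis by (simp add: algebra_simps)
        qed
        have "C' * (Y j / (h * z) powr p) powr \<beta> * Y j *
         ((\<rho> j / (r * z)) powr (?n + p) * (\<rho> j powr - (s * p) + (h * z) powr (1 - p) * T) + M * (h * z) powr - p)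
          \<le> C' * (\<gamma> / D * r powr ?sp * (2 powr - (N * j) * z powr - (p * \<beta>))) * Y j * (W * (r powr - ?sp * z powr - p * (1 + 2 * K)))"
          unfolding e1 using C'_pos \<gamma> D Y[of j] by (intro mult_left_mono[OF e6]) auto
        also have "\<dots> = \<gamma> / D * Y j * C' * 2 powr (?n + p) * (1 + 2 * K) * 2 powr - (N * j)
            * (z powr - (p * \<beta>) * z powr - (?n + p) * z powr - p) * (r powr ?sp * r powr - ?sp)"
          by (simp add: W_def mult_ac)
        also have "z powr - (p * \<beta>) * z powr - (?n + p) * z powr - p = z powr - N"
        proof -
          have "- (p * \<beta>) + - (?n + p) + - p = - N" by (simp add: N_def)
          then show ?thesis by (simp only: powr_add[symmetric])
        qed
        also have "r powr ?sp * r powr - ?sp = 1" using r by (simp flip: powr_add)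
        also have "z powr - N = 2 powr N * 2 powr (N * j)"
        proof -
          have "z = 2 powr - real (Suc j)"
            unfolding z_def b_def by (simp only: powr_minus_divide powr_realpow power_one_over zero_less_numeral)
          then have "z powr - N = 2 powr (- real (Suc j) * - N)" by (simp only: powr_powr)
          also have "- real (Suc j) * - N = N + N * j" by (simp add: algebra_simps)
          finally show ?thesis by (simp only: powr_add)
        qed
        also have "\<gamma> / D * Y j * C' * 2 powr (?n + p) * (1 + 2 * K) * 2 powr - (N * j) * (2 powr N * 2 powr (N * j)) * 1
            = \<gamma> / D * Y j * D * (2 powr - (N * j) * 2 powr (N * j))"
          by (simp add: D_def mult_ac)
        also have "\<dots> = Y (Suc j)" using D by (simp add: Y_def mult_ac flip: powr_add)
        finally show "C' * (Y j / (k (Suc j) - k j) powr p) powr (s * p / ?n) * Y j *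
         ((\<rho> j / (\<rho> j - \<rho> (Suc j))) powr (?n + p) * (\<rho> j powr - (s * p) + (k (Suc j) - k j) powr (1 - p) * T) + M * (k (Suc j) - k j) powr - p)
          \<le> Y (Suc j)"
          unfolding kj \<rho>j z_def \<beta>_def by simp
      qed
      finally show ?case .
    qed
    let ?I = "\<integral>\<^sup>+x\<in>ball x0 r. ennreal (max (u x - (k0 + h)) 0 powr p) \<partial>lborel"
    have "?I \<le> ennreal (Y j)" for j
    proof (rule order_trans[OF nn_integral_mono main[of j]])
      fix x
      have "0 < h * b j" using b(1)[of j] h by simp
      then have "k j \<le> k0 + h" by (simp add: k_def algebra_simps)
      have "max (u x - (k0 + h)) 0 powr p \<le> max (u x - k j) 0 powr p"
        using \<open>k j \<le> k0 + h\<close> p2 by (intro powr_mono2) auto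
      moreover have "r \<le> \<rho> j" using b(1)[of j] r by (simp add: \<rho>_def)
      ultimately show "ennreal (max (u x - (k0 + h)) 0 powr p) * indicator (ball x0 r) x
          \<le> ennreal (max (u x - k j) 0 powr p) * indicator (ball x0 (\<rho> j)) x"
        by (auto simp: indicator_def intro: ennreal_leI)
    qed
    moreover have "(\<lambda>j. ennreal (Y j)) \<longlonglongrightarrow> ennreal 0"
      unfolding Y_def using \<gamma> by (intro tendsto_ennrealI tendsto_mult_right_zero LIMSEQ_realpow_zero) auto
    ultimately have "?I \<le> ennreal 0" by (intro LIMSEQ_le_const[where X = "\<lambda>j. ennreal (Y j)"]) auto
    then have "?I = 0" by simp
    then have "AE x in lborel. ennreal (max (u x - (k0 + h)) 0 powr p) * indicator (ball x0 r) x = 0"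
      by (subst (asm) nn_integral_0_iff_AE) auto
    then show ?thesis
    proof eventually_elim
      case (elim x)
      then show ?case using p2 by (auto simp: max_def split: if_splits)
    qed
  qed
  then show ?thesis using \<epsilon>(1) by blast
qed

section \<open>Oscillation decay\<close>

lemma far_ker_integral:
  "\<exists>C>0. \<forall>(x::'a::euclidean_space) \<rho>. \<rho> > 0 \<longrightarrow>
    (\<integral>\<^sup>+y\<in>- ball x \<rho>. ennreal (ker (y - x)) \<partial>lborel) \<le> ennreal (C * \<rho> powr - (s * p))"
proof -
  have "ker (y - x) = 1 / norm (x - y) powr (real DIM('a) + s * p)" for x y :: 'a
    by (simp add: ker_def norm_minus_commute)
  then show ?thesis using far_kernel_integral[OF sp0, where 'a = 'a] by (simp only:)
qed

text \<open>The class is used at a level \<open>k\<close> only \<eta> = \<delta> h below the upper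
  bound k0 + h, so its right-hand side is of order \<eta>^p R^(n - sp). On the left, half of the
  ball lies at depth at least h/2 below that level, so the mixed term is at least a constant times
  h^(p-1) R^(-sp) times the integral of w = (u - k)_+. Hence the mean of \<open>w\<close> is at most
  a constant times \<delta>^(p-1) \<eta>, small compared with \<eta>, and the sup bound applies near
  the top.\<close>

lemma de_giorgi_growth:
  assumes "0 \<le> C"
  shows "\<exists>\<delta>>0. \<delta> \<le> 1/2 \<and> (\<forall>M (\<Omega>::'a::euclidean_space set) u x0 R k0 h.
    0 \<le> M \<longrightarrow> de_giorgi C M \<Omega> u \<longrightarrow> 0 < R \<longrightarrow> 0 < h \<longrightarrow> ball x0 (2 * R) \<subseteq> \<Omega> \<longrightarrow> M * R powr (s * p) \<le> (\<delta> * h) powr p \<longrightarrow>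
    (AE x in lborel. x \<in> ball x0 (2 * R) \<longrightarrow> u x \<le> k0 + h) \<longrightarrow>
    emeasure lborel (ball x0 R) \<le> 2 * emeasure lborel {x \<in> ball x0 R. u x \<le> k0} \<longrightarrow>
    (\<integral>\<^sup>+y\<in>- ball x0 (2 * R). ennreal (max (u y - (k0 + h)) 0 powr (p - 1) * ker (y - x0)) \<partial>lborel)
      \<le> ennreal ((\<delta> * h) powr (p - 1) * R powr - (s * p)) \<longrightarrow>
    (AE x in lborel. x \<in> ball x0 (R / 2) \<longrightarrow> u x \<le> k0 + h * (1 - \<delta> / 4)))"
proof -
  let ?n = "real DIM('a)"
  let ?sp = "s * p"
  let ?V = "unit_ball_vol ?n"
  have V: "0 < ?V" by (simp add: unit_ball_vol_pos)
  obtain C2 where C2_pos: "C2 > 0" and C2_all: "\<forall>(x::'a) \<rho>. \<rho> > 0 \<longrightarrow>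
    (\<integral>\<^sup>+y\<in>- ball x \<rho>. ennreal (ker (y - x)) \<partial>lborel) \<le> ennreal (C2 * \<rho> powr - ?sp)"
    using far_ker_integral[where 'a = 'a] by (elim exE conjE)
  note far = C2_all[rule_format]
  \<comment> \<open>The sup bound will be used with height \<eta>/4: 4^p converts \<eta>^p in the
    measure term, and the second summand is the constant of the auxiliary tail bound, converted in
    the same way.\<close>
  define K where "K = 4 powr p + 2 powr (p - 1) * 4 powr (p - 1) * (C2 + 1)"
  have K0: "0 \<le> K" "4 powr p \<le> K" "2 powr (p - 1) * 4 powr (p - 1) * (C2 + 1) \<le> K" using C2_pos by (auto simp: K_def)
  obtain \<epsilon> where \<epsilon>: "\<epsilon> > 0" and sup: "\<forall>M (\<Omega>::'a set) u x0 r k0 h.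
    0 \<le> M \<longrightarrow> de_giorgi C M \<Omega> u \<longrightarrow> 0 < r \<longrightarrow> 0 < h \<longrightarrow> ball x0 (2 * r) \<subseteq> \<Omega> \<longrightarrow> M * r powr (s * p) \<le> K * h powr p \<longrightarrow>
    (\<integral>\<^sup>+y\<in>- ball x0 r. ennreal (max (u y - k0) 0 powr (p - 1) * ker (y - x0)) \<partial>lborel)
      \<le> ennreal (K * h powr (p - 1) * r powr - (s * p)) \<longrightarrow>
    (\<integral>\<^sup>+x\<in>ball x0 (2 * r). ennreal (max (u x - k0) 0 powr p) \<partial>lborel) \<le> ennreal (\<epsilon> * h powr p * r powr ?n) \<longrightarrow>
    (AE x in lborel. x \<in> ball x0 r \<longrightarrow> u x \<le> k0 + h)"
    using de_giorgi_sup_bound[OF assms K0(1), where 'a = 'a] by (elim exE conjE)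
  define c where "c = (1/2) powr (p - 1) * 2 powr - (?n + ?sp) * ?V / 2"
  define C4 where "C4 = 2 powr (p - 1) * (C2 + 1) * 2 powr ?sp"
  define C5 where "C5 = ?V * 2 powr ?n * (C * 2 powr (?n + p) * (1 + C4) + 1)"
  define C6 where "C6 = C5 / c"
  have c: "0 < c" using V by (simp add: c_def)
  have C4: "0 < C4" using C2_pos by (simp add: C4_def)
  have C5: "0 < C5" unfolding C5_def using V C4 assms by (intro mult_pos_pos add_nonneg_pos) auto
  have C6: "0 < C6" using c C5 by (simp add: C6_def)
  \<comment> \<open>The smallness demanded by the sup bound with height \<eta>/4 on a ball of radius
    R/2, whence 4^(-p) and 2^(-n). The first power of \<delta> is enough because p - 1 \<ge> 1 and
    \<delta> \<le> 1 give \<delta>^(p-1) \<le> \<delta>.\<close>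
  define \<delta> where "\<delta> = min (1/2) (\<epsilon> * 4 powr - p * 2 powr - ?n / (2 * C6))"
  have \<delta>: "0 < \<delta>" "\<delta> \<le> 1/2" using \<epsilon> C6 by (auto simp: \<delta>_def)
  have \<delta>le: "2 * C6 * \<delta> \<le> \<epsilon> * 4 powr - p * 2 powr - ?n"
    using C6 by (simp add: \<delta>_def min_def field_simps)
  have "AE x in lborel. x \<in> ball x0 (R / 2) \<longrightarrow> u x \<le> k0 + h * (1 - \<delta> / 4)"
    if M: "0 \<le> M" and dg: "de_giorgi C M \<Omega> u" and R: "0 < R" and h: "0 < h" and B: "ball x0 (2 * R) \<subseteq> \<Omega>"
      and MR: "M * R powr ?sp \<le> (\<delta> * h) powr p"
      and sup1: "AE x in lborel. x \<in> ball x0 (2 * R) \<longrightarrow> u x \<le> k0 + h"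
      and meas: "emeasure lborel (ball x0 R) \<le> 2 * emeasure lborel {x \<in> ball x0 R. u x \<le> k0}"
      and tl: "(\<integral>\<^sup>+y\<in>- ball x0 (2 * R). ennreal (max (u y - (k0 + h)) 0 powr (p - 1) * ker (y - x0)) \<partial>lborel)
        \<le> ennreal ((\<delta> * h) powr (p - 1) * R powr - ?sp)"
    for M and \<Omega> :: "'a set" and u x0 R k0 h
  proof -
    have um[measurable]: "u \<in> borel_measurable borel" using dg by (simp add: de_giorgi_def)
    define \<eta> where "\<eta> = \<delta> * h"
    have \<eta>: "0 < \<eta>" "\<eta> \<le> h / 2" using \<delta> h by (auto simp: \<eta>_def)
    define k where "k = k0 + h - \<eta>"
    define w where "w x = max (u x - k) 0" for x
    have [measurable]: "w \<in> borel_measurable borel" unfolding w_def[abs_def] by measurable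
    have w0: "0 \<le> w x" for x by (simp add: w_def)
    \<comment> \<open>The excess over \<kappa> is at most \<eta> plus the excess over k0 + h. The
      first part costs a kernel integral outside a ball of radius at least R/2; the second vanishes
      almost everywhere in the ball of radius 2 R and is covered by the hypothesis outside.\<close>
    have tail: "(\<integral>\<^sup>+y\<in>- ball x0 \<rho>. ennreal (max (u y - \<kappa>) 0 powr (p - 1) * ker (y - x0)) \<partial>lborel)
      \<le> ennreal (2 powr (p - 1) * (C2 + 1) * \<eta> powr (p - 1) * (R / 2) powr - ?sp)"
      if \<rho>: "R / 2 \<le> \<rho>" and \<kappa>: "k \<le> \<kappa>" for \<rho> \<kappa>
    proof -
      let ?f = "\<lambda>y. ennreal (2 powr (p - 1) * \<eta> powr (p - 1)) * (ennreal (ker (y - x0)) * indicator (- ball x0 \<rho>) y)"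
      let ?g = "\<lambda>y. ennreal (2 powr (p - 1)) * (ennreal (max (u y - (k0 + h)) 0 powr (p - 1) * ker (y - x0)) * indicator (- ball x0 (2 * R)) y)"
      have "(\<integral>\<^sup>+y\<in>- ball x0 \<rho>. ennreal (max (u y - \<kappa>) 0 powr (p - 1) * ker (y - x0)) \<partial>lborel) \<le> (\<integral>\<^sup>+y. ?f y + ?g y \<partial>lborel)"
      proof (rule nn_integral_mono_AE)
        show "AE y in lborel. ennreal (max (u y - \<kappa>) 0 powr (p - 1) * ker (y - x0)) * indicator (- ball x0 \<rho>) y \<le> ?f y + ?g y"
          using sup1
        proof eventually_elim
          case (elim y)
          define z where "z = max (u y - (k0 + h)) 0"
          have z: "0 \<le> z" by (simp add: z_def)
          have "max (u y - \<kappa>) 0 \<le> \<eta> + z" using \<kappa> \<eta> by (auto simp: z_def k_def max_def)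
          then have "max (u y - \<kappa>) 0 powr (p - 1) \<le> (\<eta> + z) powr (p - 1)" using p2 by (intro powr_mono2) auto
          also have "\<dots> \<le> 2 powr (p - 1) * (\<eta> powr (p - 1) + z powr (p - 1))"
            using p2 \<eta> z by (intro powr_add_le) auto
          finally have "max (u y - \<kappa>) 0 powr (p - 1) * ker (y - x0)
              \<le> 2 powr (p - 1) * (\<eta> powr (p - 1) + z powr (p - 1)) * ker (y - x0)"
            by (intro mult_right_mono) auto
          also have "\<dots> = 2 powr (p - 1) * \<eta> powr (p - 1) * ker (y - x0) + 2 powr (p - 1) * (z powr (p - 1) * ker (y - x0))"
            by (simp add: algebra_simps)
          finally have le: "ennreal (max (u y - \<kappa>) 0 powr (p - 1) * ker (y - x0))
             \<le> ennreal (2 powr (p - 1) * \<eta> powr (p - 1)) * ennreal (ker (y - x0)) + ennreal (2 powr (p - 1)) * ennreal (z powr (p - 1) * ker (y - x0))"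
            by (simp add: ennreal_mult[symmetric] ennreal_plus[symmetric] ennreal_leI del: ennreal_plus)
          have z0: "z = 0" if "y \<in> ball x0 (2 * R)" using elim that by (auto simp: z_def)
          show ?case
          proof (cases "y \<in> ball x0 (2 * R)")
            case True
            then show ?thesis using le z0 p2 by (auto simp: indicator_def z_def[symmetric])
          next
            case False
            then show ?thesis using le by (auto simp: indicator_def z_def[symmetric])
          qed
        qed
      qed
      also have "\<dots> = (\<integral>\<^sup>+y. ?f y \<partial>lborel) + (\<integral>\<^sup>+y. ?g y \<partial>lborel)" by (rule nn_integral_add) measurable
      also have "(\<integral>\<^sup>+y. ?f y \<partial>lborel) = ennreal (2 powr (p - 1) * \<eta> powr (p - 1)) * (\<integral>\<^sup>+y\<in>- ball x0 \<rho>. ennreal (ker (y - x0)) \<partial>lborel)"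
        by (rule nn_integral_cmult) measurable
      also have "(\<integral>\<^sup>+y. ?g y \<partial>lborel) = ennreal (2 powr (p - 1)) * (\<integral>\<^sup>+y\<in>- ball x0 (2 * R). ennreal (max (u y - (k0 + h)) 0 powr (p - 1) * ker (y - x0)) \<partial>lborel)"
        by (rule nn_integral_cmult) measurable
      also have "ennreal (2 powr (p - 1) * \<eta> powr (p - 1)) * (\<integral>\<^sup>+y\<in>- ball x0 \<rho>. ennreal (ker (y - x0)) \<partial>lborel) + \<dots>
        \<le> ennreal (2 powr (p - 1) * \<eta> powr (p - 1)) * ennreal (C2 * \<rho> powr - ?sp) + ennreal (2 powr (p - 1)) * ennreal (\<eta> powr (p - 1) * R powr - ?sp)"
        using \<rho> R by (intro add_mono mult_left_mono far tl[folded \<eta>_def]) auto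
      also have "\<dots> = ennreal (2 powr (p - 1) * \<eta> powr (p - 1) * (C2 * \<rho> powr - ?sp + R powr - ?sp))"
        using C2_pos by (simp add: ennreal_mult[symmetric] ennreal_plus[symmetric] algebra_simps del: ennreal_plus)
      also have "\<dots> \<le> ennreal (2 powr (p - 1) * \<eta> powr (p - 1) * (C2 * (R / 2) powr - ?sp + (R / 2) powr - ?sp))"
        using \<rho> R C2_pos sp0 by (intro ennreal_leI mult_left_mono add_mono powr_mono2') auto
      finally show ?thesis by (simp add: algebra_simps)
    qed
    have R2: "(R / 2) powr - ?sp = 2 powr ?sp * R powr - ?sp" using R by (simp add: powr_divide powr_minus_divide)
    have Rn: "(2 * R) powr ?n = 2 powr ?n * R powr ?n" using R by (simp add: powr_mult)
    have bd: "(\<integral>\<^sup>+x\<in>ball x0 (2 * R). ennreal (f x) \<partial>lborel) \<le> ennreal (a * (?V * (2 * R) powr ?n))"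
      if "AE x in lborel. x \<in> ball x0 (2 * R) \<longrightarrow> f x \<le> a" "0 \<le> a" for f :: "'a \<Rightarrow> real" and a
    proof -
      have "(\<integral>\<^sup>+x\<in>ball x0 (2 * R). ennreal (f x) \<partial>lborel) \<le> (\<integral>\<^sup>+x. ennreal a * indicator (ball x0 (2 * R)) x \<partial>lborel)"
        using that(1) by (intro nn_integral_mono_AE) (auto simp: indicator_def ennreal_leI elim!: eventually_mono)
      also have "\<dots> = ennreal a * emeasure lborel (ball x0 (2 * R))" by (simp add: nn_integral_cmult_indicator)
      also have "\<dots> = ennreal (a * (?V * (2 * R) powr ?n))"
        using emeasure_ball_powr[of "2 * R" x0] R that(2) V by (simp add: ennreal_mult)
      finally show ?thesis .
    qed
    have w\<eta>: "AE x in lborel. x \<in> ball x0 (2 * R) \<longrightarrow> w x \<le> \<eta>"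
      using sup1 by eventually_elim (use \<eta> in \<open>auto simp: w_def k_def\<close>)
    have i1: "(\<integral>\<^sup>+x\<in>ball x0 (2 * R). ennreal (w x powr p) \<partial>lborel) \<le> ennreal (\<eta> powr p * (?V * (2 * R) powr ?n))"
      by (rule bd) (use w\<eta> in eventually_elim, use w0 p2 in \<open>auto intro!: powr_mono2\<close>)
    have i2: "(\<integral>\<^sup>+x\<in>ball x0 (2 * R). ennreal (w x) \<partial>lborel) \<le> ennreal (\<eta> * (?V * (2 * R) powr ?n))"
      using w\<eta> \<eta> by (intro bd) auto
    have i3: "(\<integral>\<^sup>+y\<in>- ball x0 (2 * R). ennreal (w y powr (p - 1) * ker (y - x0)) \<partial>lborel) \<le> ennreal (C4 * \<eta> powr (p - 1) * R powr - ?sp)"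
      using tail[of "2 * R" k] R unfolding R2 w_def C4_def by (simp add: mult_ac)
    have i4: "emeasure lborel {x \<in> ball x0 (2 * R). k < u x} \<le> ennreal (?V * (2 * R) powr ?n)"
    proof -
      have "emeasure lborel {x \<in> ball x0 (2 * R). k < u x} \<le> emeasure lborel (ball x0 (2 * R))"
        by (intro emeasure_mono) auto
      then show ?thesis using emeasure_ball_powr[of "2 * R" x0] R by simp
    qed
    have upper: "(\<integral>\<^sup>+x\<in>ball x0 R. (\<integral>\<^sup>+y\<in>{y. u y \<le> k}. ennreal ((w x powr p + w x * (k - u y) powr (p - 1)) * ker (x - y)) \<partial>lborel) \<partial>lborel)
       \<le> ennreal (C5 * \<eta> powr p * R powr - ?sp * R powr ?n)"
    proof -
      have "(\<integral>\<^sup>+x\<in>ball x0 R. (\<integral>\<^sup>+y\<in>{y. u y \<le> k}. ennreal ((w x powr p + w x * (k - u y) powr (p - 1)) * ker (x - y)) \<partial>lborel) \<partial>lborel)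
        \<le> ennreal (C * (2 * R / (2 * R - R)) powr (?n + p)) * (ennreal ((2 * R) powr - ?sp) * (\<integral>\<^sup>+x\<in>ball x0 (2 * R). ennreal (w x powr p) \<partial>lborel)
            + (\<integral>\<^sup>+x\<in>ball x0 (2 * R). ennreal (w x) \<partial>lborel) * (\<integral>\<^sup>+y\<in>- ball x0 (2 * R). ennreal (w y powr (p - 1) * ker (y - x0)) \<partial>lborel))
         + ennreal M * emeasure lborel {x \<in> ball x0 (2 * R). k < u x}"
      proof -
        have "R < 2 * R" using R by simp
        then show ?thesis using dg R B unfolding de_giorgi_def w_def by blast
      qed
      also have "\<dots> \<le> ennreal (C * (2 * R / (2 * R - R)) powr (?n + p)) * (ennreal ((2 * R) powr - ?sp) * ennreal (\<eta> powr p * (?V * (2 * R) powr ?n))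
            + ennreal (\<eta> * (?V * (2 * R) powr ?n)) * ennreal (C4 * \<eta> powr (p - 1) * R powr - ?sp))
         + ennreal M * ennreal (?V * (2 * R) powr ?n)"
        by (intro add_mono mult_mono i1 i2 i3 i4) auto
      also have "\<dots> = ennreal (C * 2 powr (?n + p) * ((2 * R) powr - ?sp * (\<eta> powr p * (?V * (2 * R) powr ?n))
            + \<eta> * (?V * (2 * R) powr ?n) * (C4 * \<eta> powr (p - 1) * R powr - ?sp)) + M * (?V * (2 * R) powr ?n))"
        using assms V \<eta> C4 M R by (simp add: ennreal_mult[symmetric] ennreal_plus[symmetric] del: ennreal_plus)
      also have "\<dots> \<le> ennreal (C5 * \<eta> powr p * R powr - ?sp * R powr ?n)"
      proof (rule ennreal_leI)
        define X where "X = ?V * (2 * R) powr ?n"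
        define Z where "Z = \<eta> powr p * R powr - ?sp"
        have X0: "0 \<le> X" using V by (simp add: X_def)
        have a1: "(2 * R) powr - ?sp * (\<eta> powr p * X) \<le> Z * X"
        proof -
          have "(2 * R) powr - ?sp \<le> R powr - ?sp" using R sp0 by (intro powr_mono2') auto
          then have "(2 * R) powr - ?sp * (\<eta> powr p * X) \<le> R powr - ?sp * (\<eta> powr p * X)"
            using X0 by (intro mult_right_mono) auto
          then show ?thesis by (simp add: Z_def mult_ac)
        qed
        have a2: "\<eta> * X * (C4 * \<eta> powr (p - 1) * R powr - ?sp) = C4 * (Z * X)"
          using powr_mult_self[of \<eta> p] \<eta> by (simp add: Z_def mult_ac)
        have a3: "M * X \<le> Z * X"
        proof (rule mult_right_mono[OF _ X0])
          have "M = M * R powr ?sp * R powr - ?sp" using R by (simp add: powr_minus_divide)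
          also have "\<dots> \<le> \<eta> powr p * R powr - ?sp" using MR by (intro mult_right_mono) (auto simp: \<eta>_def)
          finally show "M \<le> Z" by (simp add: Z_def)
        qed
        have "C * 2 powr (?n + p) * ((2 * R) powr - ?sp * (\<eta> powr p * X) + \<eta> * X * (C4 * \<eta> powr (p - 1) * R powr - ?sp)) + M * X
           \<le> C * 2 powr (?n + p) * (Z * X + C4 * (Z * X)) + Z * X"
          unfolding a2 using assms by (intro add_mono a1 a3 mult_left_mono order_refl) auto
        also have "\<dots> = C5 * \<eta> powr p * R powr - ?sp * R powr ?n"
          unfolding C5_def Z_def X_def Rn by (simp add: algebra_simps)
        finally show "C * 2 powr (?n + p) * ((2 * R) powr - ?sp * (\<eta> powr p * (?V * (2 * R) powr ?n))
            + \<eta> * (?V * (2 * R) powr ?n) * (C4 * \<eta> powr (p - 1) * R powr - ?sp)) + M * (?V * (2 * R) powr ?n)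
            \<le> C5 * \<eta> powr p * R powr - ?sp * R powr ?n"
          unfolding X_def .
      qed
      finally show ?thesis .
    qed
    define S where "S = {x \<in> ball x0 R. u x \<le> k0}"
    have S[measurable]: "S \<in> sets borel" unfolding S_def by measurable
    have Sm: "ennreal (?V / 2 * R powr ?n) \<le> emeasure lborel S"
    proof -
      have "ennreal (?V * R powr ?n) \<le> 2 * emeasure lborel S"
        using meas emeasure_ball_powr[OF R, of x0] by (simp add: S_def)
      then have le: "ennreal (1 / 2) * ennreal (?V * R powr ?n) \<le> ennreal (1 / 2) * (2 * emeasure lborel S)"
        by (intro mult_left_mono) auto
      have "ennreal (?V / 2 * R powr ?n) = ennreal (1 / 2) * ennreal (?V * R powr ?n)"
        using V by (subst ennreal_mult[symmetric]) auto
      also note le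
      also have "ennreal (1 / 2) * (2 * emeasure lborel S) = ennreal (1 / 2 * 2) * emeasure lborel S"
        by (subst ennreal_mult) (auto simp: mult.assoc)
      also have "\<dots> = emeasure lborel S" by simp
      finally show ?thesis .
    qed
    \<comment> \<open>For x in the ball of radius \<open>R\<close> and y \<noteq> x in
      \<open>S\<close>, \<open>G\<close> is a lower bound for (k - u(y))^(p-1) times the kernel, as
      |x - y| \<le> 2 R.\<close>
    define G where "G = (h / 2) powr (p - 1) * (2 * R) powr - (?n + ?sp)"
    have inner: "ennreal (c * h powr (p - 1) * R powr - ?sp) * ennreal (w x)
        \<le> (\<integral>\<^sup>+y\<in>{y. u y \<le> k}. ennreal ((w x powr p + w x * (k - u y) powr (p - 1)) * ker (x - y)) \<partial>lborel)"
      if x: "x \<in> ball x0 R" for x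
    proof -
      have Rn1: "R powr - ?n * R powr ?n = 1" using R by (simp flip: powr_add)
      have "(2 * R) powr - (?n + ?sp) = 2 powr - (?n + ?sp) * (R powr - ?n * R powr - ?sp)"
        using R by (simp add: powr_mult flip: powr_add)
      moreover have "(h / 2) powr (p - 1) = (1/2) powr (p - 1) * h powr (p - 1)"
        using powr_mult[of "1/2" h "p - 1"] by simp
      ultimately have "G * (?V / 2 * R powr ?n) = c * h powr (p - 1) * R powr - ?sp * (R powr - ?n * R powr ?n)"
        unfolding G_def c_def by (simp only: mult_ac times_divide_eq_left times_divide_eq_right)
      also note Rn1
      finally have e: "c * h powr (p - 1) * R powr - ?sp = G * (?V / 2 * R powr ?n)" by simp
      have "ennreal (c * h powr (p - 1) * R powr - ?sp) * ennreal (w x) = ennreal (w x * G * (?V / 2 * R powr ?n))"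
        unfolding e using w0 V by (subst ennreal_mult[symmetric]) (auto simp: G_def mult_ac)
      also have "\<dots> = ennreal (w x * G) * ennreal (?V / 2 * R powr ?n)"
        using w0 V by (intro ennreal_mult) (auto simp: G_def)
      also have "\<dots> \<le> ennreal (w x * G) * emeasure lborel S" by (intro mult_left_mono Sm) auto
      also have "emeasure lborel S \<le> emeasure lborel (S - {x}) + emeasure lborel {x}"
        by (rule order_trans[OF emeasure_mono emeasure_subadditive]) auto
      also have "\<dots> = emeasure lborel (S - {x})" by simp
      also have "ennreal (w x * G) * emeasure lborel (S - {x}) = (\<integral>\<^sup>+y. ennreal (w x * G) * indicator (S - {x}) y \<partial>lborel)"
        by (rule nn_integral_cmult_indicator[symmetric]) auto
      also have "\<dots> \<le> (\<integral>\<^sup>+y\<in>{y. u y \<le> k}. ennreal ((w x powr p + w x * (k - u y) powr (p - 1)) * ker (x - y)) \<partial>lborel)"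
      proof (intro nn_integral_mono)
        fix y
        show "ennreal (w x * G) * indicator (S - {x}) y
          \<le> ennreal ((w x powr p + w x * (k - u y) powr (p - 1)) * ker (x - y)) * indicator {y. u y \<le> k} y"
        proof (cases "y \<in> S - {x}")
          case True
          have uy: "u y \<le> k0" "h / 2 \<le> k - u y" using True \<eta> by (auto simp: S_def k_def)
          have "dist x y \<le> dist x x0 + dist x0 y" by (rule dist_triangle)
          then have d: "dist x y \<le> 2 * R" "0 < dist x y" using x True by (auto simp: S_def dist_commute)
          have kl: "(2 * R) powr - (?n + ?sp) \<le> ker (x - y)"
            unfolding ker_def dist_norm[symmetric] powr_minus_divide using d sp0 R
            by (intro divide_left_mono powr_mono2 mult_pos_pos) auto
          have "w x * G \<le> w x * ((k - u y) powr (p - 1) * ker (x - y))"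
            unfolding G_def using w0 uy h kl p2 by (intro mult_left_mono mult_mono powr_mono2) auto
          also have "\<dots> \<le> (w x powr p + w x * (k - u y) powr (p - 1)) * ker (x - y)"
            by (simp add: algebra_simps)
          finally show ?thesis using True uy h by (auto simp: indicator_def intro!: ennreal_leI)
        qed simp
      qed
      finally show ?thesis by (simp add: mult_left_mono)
    qed
    have wint: "(\<integral>\<^sup>+x\<in>ball x0 R. ennreal (w x) \<partial>lborel) \<le> ennreal (C6 * \<delta> powr p * h * R powr ?n)"
    proof -
      have "ennreal (c * h powr (p - 1) * R powr - ?sp) * (\<integral>\<^sup>+x\<in>ball x0 R. ennreal (w x) \<partial>lborel)
         = (\<integral>\<^sup>+x. ennreal (c * h powr (p - 1) * R powr - ?sp) * (ennreal (w x) * indicator (ball x0 R) x) \<partial>lborel)"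
        by (rule nn_integral_cmult[symmetric]) measurable
      also have "\<dots> \<le> (\<integral>\<^sup>+x\<in>ball x0 R. (\<integral>\<^sup>+y\<in>{y. u y \<le> k}. ennreal ((w x powr p + w x * (k - u y) powr (p - 1)) * ker (x - y)) \<partial>lborel) \<partial>lborel)"
      proof (intro nn_integral_mono)
        fix x
        show "ennreal (c * h powr (p - 1) * R powr - ?sp) * (ennreal (w x) * indicator (ball x0 R) x)
          \<le> (\<integral>\<^sup>+y\<in>{y. u y \<le> k}. ennreal ((w x powr p + w x * (k - u y) powr (p - 1)) * ker (x - y)) \<partial>lborel) * indicator (ball x0 R) x"
          using inner[of x] by (cases "x \<in> ball x0 R") auto
      qed
      also note upper
      finally have "(\<integral>\<^sup>+x\<in>ball x0 R. ennreal (w x) \<partial>lborel) \<le> ennreal (C5 * \<eta> powr p * R powr - ?sp * R powr ?n / (c * h powr (p - 1) * R powr - ?sp))"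
        using c h R C5 by (intro ennreal_le_divide) auto
      also have "C5 * \<eta> powr p * R powr - ?sp * R powr ?n / (c * h powr (p - 1) * R powr - ?sp) = C6 * \<delta> powr p * h * R powr ?n"
        using c h R \<delta> powr_mult_self[of h p] by (simp add: C6_def \<eta>_def powr_mult)
      finally show ?thesis .
    qed
    \<comment> \<open>Base level k0 + h - \<eta>/2 and height \<eta>/4 end at k0 + h - \<eta>/4. As
      the base lies \<eta>/2 above \<open>k\<close>, the function \<open>w\<close> is at least
      \<eta>/2 wherever the base is exceeded, and so the bound on the integral of \<open>w\<close>
      controls a p-th power.\<close>
    have "AE x in lborel. x \<in> ball x0 (R / 2) \<longrightarrow> u x \<le> (k0 + h - \<eta> / 2) + \<eta> / 4"
    proof (rule sup[rule_format, of M \<Omega>])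
      show "0 \<le> M" "de_giorgi C M \<Omega> u" "0 < R / 2" "0 < \<eta> / 4" using M dg R \<eta> by auto
      show "ball x0 (2 * (R / 2)) \<subseteq> \<Omega>" using B R subset_ball[of R "2 * R" x0] by auto
      have e4: "\<eta> powr a = 4 powr a * (\<eta> / 4) powr a" for a using \<eta> by (simp add: powr_divide)
      have "M * (R / 2) powr ?sp \<le> M * R powr ?sp" using M R sp0 by (intro mult_left_mono powr_mono2) auto
      also have "\<dots> \<le> \<eta> powr p" using MR by (simp add: \<eta>_def)
      also have "\<dots> = 4 powr p * (\<eta> / 4) powr p" by (rule e4)
      also have "\<dots> \<le> K * (\<eta> / 4) powr p" using K0 by (intro mult_right_mono) auto
      finally show "M * (R / 2) powr ?sp \<le> K * (\<eta> / 4) powr p" .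
      have "(\<integral>\<^sup>+y\<in>- ball x0 (R / 2). ennreal (max (u y - (k0 + h - \<eta> / 2)) 0 powr (p - 1) * ker (y - x0)) \<partial>lborel)
        \<le> ennreal (2 powr (p - 1) * (C2 + 1) * \<eta> powr (p - 1) * (R / 2) powr - ?sp)"
        using \<eta> by (intro tail) (auto simp: k_def)
      also have "\<dots> \<le> ennreal (K * (\<eta> / 4) powr (p - 1) * (R / 2) powr - ?sp)"
      proof (intro ennreal_leI mult_right_mono)
        have "2 powr (p - 1) * (C2 + 1) * \<eta> powr (p - 1) = (2 powr (p - 1) * 4 powr (p - 1) * (C2 + 1)) * (\<eta> / 4) powr (p - 1)"
          unfolding e4[of "p - 1"] by (simp add: mult_ac)
        also have "\<dots> \<le> K * (\<eta> / 4) powr (p - 1)" by (intro mult_right_mono K0) auto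
        finally show "2 powr (p - 1) * (C2 + 1) * \<eta> powr (p - 1) \<le> K * (\<eta> / 4) powr (p - 1)" .
      qed auto
      finally show "(\<integral>\<^sup>+y\<in>- ball x0 (R / 2). ennreal (max (u y - (k0 + h - \<eta> / 2)) 0 powr (p - 1) * ker (y - x0)) \<partial>lborel)
        \<le> ennreal (K * (\<eta> / 4) powr (p - 1) * (R / 2) powr - ?sp)" .
      have "(\<integral>\<^sup>+x\<in>ball x0 R. ennreal (max (u x - (k0 + h - \<eta> / 2)) 0 powr p) \<partial>lborel)
         \<le> (\<integral>\<^sup>+x. ennreal (2 * \<eta> powr (p - 1)) * (ennreal (w x) * indicator (ball x0 R) x) \<partial>lborel)"
      proof (rule nn_integral_mono_AE)
        show "AE x in lborel. ennreal (max (u x - (k0 + h - \<eta> / 2)) 0 powr p) * indicator (ball x0 R) x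
          \<le> ennreal (2 * \<eta> powr (p - 1)) * (ennreal (w x) * indicator (ball x0 R) x)"
          using sup1
        proof eventually_elim
          case (elim x)
          have "max (u x - (k0 + h - \<eta> / 2)) 0 powr p \<le> 2 * \<eta> powr (p - 1) * w x" if "x \<in> ball x0 R"
          proof (cases "u x \<le> k0 + h - \<eta> / 2")
            case True
            then show ?thesis using w0[of x] p2 by simp
          next
            case False
            have "x \<in> ball x0 (2 * R)" using that R by auto
            then have ux: "u x \<le> k0 + h" using elim by blast
            have "\<eta> / 2 \<le> u x - k" using False unfolding k_def by linarith
            also have "\<dots> \<le> w x" by (simp add: w_def)
            finally have wx: "\<eta> / 2 \<le> w x" .
            have "max (u x - (k0 + h - \<eta> / 2)) 0 powr p \<le> \<eta> powr p" using ux \<eta> p2 by (intro powr_mono2) auto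
            also have "\<dots> = \<eta> powr (p - 1) * \<eta>" using powr_mult_self[of \<eta> p] \<eta> by simp
            also have "\<dots> \<le> \<eta> powr (p - 1) * (2 * w x)" using wx by (intro mult_left_mono) auto
            finally show ?thesis by (simp add: mult_ac)
          qed
          then show ?case using w0[of x] by (auto simp: indicator_def ennreal_mult[symmetric] ennreal_leI)
        qed
      qed
      also have "\<dots> = ennreal (2 * \<eta> powr (p - 1)) * (\<integral>\<^sup>+x\<in>ball x0 R. ennreal (w x) \<partial>lborel)"
        by (rule nn_integral_cmult) measurable
      also have "\<dots> \<le> ennreal (2 * \<eta> powr (p - 1)) * ennreal (C6 * \<delta> powr p * h * R powr ?n)"
        by (intro mult_left_mono wint) auto
      also have "\<dots> = ennreal (2 * \<eta> powr (p - 1) * (C6 * \<delta> powr p * h * R powr ?n))"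
        using C6 h by (intro ennreal_mult[symmetric]) auto
      also have "\<dots> \<le> ennreal (\<epsilon> * (\<eta> / 4) powr p * (R / 2) powr ?n)"
      proof (rule ennreal_leI)
        have "\<delta> powr (p - 1) \<le> \<delta>" using powr_mono'[of 1 "p - 1" \<delta>] \<delta> p2 by simp
        then have "2 * C6 * \<delta> powr (p - 1) \<le> 2 * C6 * \<delta>" using C6 by simp
        also note \<delta>le
        finally have le: "2 * C6 * \<delta> powr (p - 1) \<le> \<epsilon> * 4 powr - p * 2 powr - ?n" .
        have "2 * \<eta> powr (p - 1) * (C6 * \<delta> powr p * h * R powr ?n) = (2 * C6 * \<delta> powr (p - 1)) * (\<eta> * \<eta> powr (p - 1)) * R powr ?n"
          using powr_mult_self[of \<delta> p] \<delta> by (simp add: \<eta>_def mult_ac)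
        also have "\<dots> = (2 * C6 * \<delta> powr (p - 1)) * (\<eta> powr p * R powr ?n)"
          using powr_mult_self[of \<eta> p] \<eta> by simp
        also have "\<dots> \<le> (\<epsilon> * 4 powr - p * 2 powr - ?n) * (\<eta> powr p * R powr ?n)"
          by (intro mult_right_mono le) auto
        also have "\<dots> = \<epsilon> * (\<eta> / 4) powr p * (R / 2) powr ?n"
          using \<eta> R by (simp add: powr_divide powr_minus_divide)
        finally show "2 * \<eta> powr (p - 1) * (C6 * \<delta> powr p * h * R powr ?n) \<le> \<epsilon> * (\<eta> / 4) powr p * (R / 2) powr ?n" .
      qed
      finally show "(\<integral>\<^sup>+x\<in>ball x0 (2 * (R / 2)). ennreal (max (u x - (k0 + h - \<eta> / 2)) 0 powr p) \<partial>lborel) \<le> ennreal (\<epsilon> * (\<eta> / 4) powr p * (R / 2) powr ?n)"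
        by simp
    qed
    then show ?thesis by eventually_elim (auto simp: \<eta>_def algebra_simps)
  qed
  then show ?thesis using \<delta> by blast
qed

text \<open>The hypotheses on \<open>S\<close> are one normalization: \<open>S\<close> dominates
  M^(1/p) r^s, the size of \<open>u\<close> on the ball, and the exterior integral. At smaller
  scales the contributions of \<open>M\<close> and of the exterior decrease at least as fast as the
  claimed oscillation, because \<alpha> \<le> s; the growth lemma therefore stays applicable at
  every scale.\<close>

lemma de_giorgi_oscillation:
  assumes "0 \<le> C"
  shows "\<exists>\<alpha> A. 0 < \<alpha> \<and> \<alpha> < 1 \<and> 0 < A \<and> (\<forall>M (\<Omega>::'a::euclidean_space set) u x0 r S.
    0 \<le> M \<longrightarrow> de_giorgi C M \<Omega> u \<longrightarrow> de_giorgi C M \<Omega> (\<lambda>x. - u x) \<longrightarrow> 0 < r \<longrightarrow> 0 < S \<longrightarrow> ball x0 r \<subseteq> \<Omega> \<longrightarrow>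
    M * r powr (s * p) \<le> S powr p \<longrightarrow>
    (AE y in lborel. y \<in> ball x0 r \<longrightarrow> \<bar>u y\<bar> \<le> S) \<longrightarrow>
    (\<integral>\<^sup>+y\<in>- ball x0 r. ennreal (\<bar>u y\<bar> powr (p - 1) * ker (y - x0)) \<partial>lborel)
      \<le> ennreal (S powr (p - 1) * r powr - (s * p)) \<longrightarrow>
    (\<forall>j::nat. \<exists>b. AE y in lborel. y \<in> ball x0 (r / 4 ^ j) \<longrightarrow> b \<le> u y \<and> u y \<le> b + A * S * ((1/4) ^ j) powr \<alpha>))"
proof -
  let ?n = "real DIM('a)"
  let ?sp = "s * p"
  obtain \<delta> where \<delta>: "0 < \<delta>" "\<delta> \<le> 1/2" and growth: "\<forall>M (\<Omega>::'a set) u x0 R k0 h.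
    0 \<le> M \<longrightarrow> de_giorgi C M \<Omega> u \<longrightarrow> 0 < R \<longrightarrow> 0 < h \<longrightarrow> ball x0 (2 * R) \<subseteq> \<Omega> \<longrightarrow> M * R powr (s * p) \<le> (\<delta> * h) powr p \<longrightarrow>
    (AE x in lborel. x \<in> ball x0 (2 * R) \<longrightarrow> u x \<le> k0 + h) \<longrightarrow>
    emeasure lborel (ball x0 R) \<le> 2 * emeasure lborel {x \<in> ball x0 R. u x \<le> k0} \<longrightarrow>
    (\<integral>\<^sup>+y\<in>- ball x0 (2 * R). ennreal (max (u y - (k0 + h)) 0 powr (p - 1) * ker (y - x0)) \<partial>lborel)
      \<le> ennreal ((\<delta> * h) powr (p - 1) * R powr - (s * p)) \<longrightarrow>
    (AE x in lborel. x \<in> ball x0 (R / 2) \<longrightarrow> u x \<le> k0 + h * (1 - \<delta> / 4))"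
    using de_giorgi_growth[OF assms, where 'a = 'a] by (elim exE conjE)
  obtain C2 where C2_pos: "C2 > 0" and C2_all: "\<forall>(x::'a) \<rho>. \<rho> > 0 \<longrightarrow>
    (\<integral>\<^sup>+y\<in>- ball x \<rho>. ennreal (ker (y - x)) \<partial>lborel) \<le> ennreal (C2 * \<rho> powr - ?sp)"
    using far_ker_integral[where 'a = 'a] by (elim exE conjE)
  have "?sp / 2 > 0" using sp0 by simp
  then obtain C3 where C3_pos: "C3 > 0" and C3_all: "\<forall>(x::'a) \<rho>. \<rho> > 0 \<longrightarrow>
    (\<integral>\<^sup>+y\<in>- ball x \<rho>. ennreal (1 / norm (x - y) powr (?n + ?sp / 2)) \<partial>lborel) \<le> ennreal (C3 * \<rho> powr - (?sp / 2))"
    using far_kernel_integral[of "?sp / 2", where 'a = 'a] by blast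
  \<comment> \<open>A growth like |y - x0|^\<beta>, raised to the power p - 1, uses up half of the
    decay sp of the kernel and leaves sp/2 for integrability.\<close>
  define \<beta> where "\<beta> = ?sp / 2 / (p - 1)"
  have "p - 1 \<noteq> 0" using p2 by simp
  from nonzero_eq_divide_eq[OF this, of \<beta> "?sp / 2"] have "\<beta> * (p - 1) = ?sp / 2" unfolding \<beta>_def by blast
  moreover have "0 < \<beta>" unfolding \<beta>_def using sp0 p2 by (intro divide_pos_pos) auto
  ultimately have \<beta>: "0 < \<beta>" "\<beta> * (p - 1) = ?sp / 2" by auto
  \<comment> \<open>The entry s keeps the measure term and the original exterior integral
    subordinate at small scales; 1/2 gives \<alpha> < 1; \<beta>/2 makes 2 \<alpha>/\<beta> \<le> 1;
    the entry with \<open>C3\<close> lets the growth on larger scales take at most half of the tail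
    admissible in the growth lemma; \<delta>/16 ensures that one scale of decay asks for no more
    than the factor 1 - \<delta>/8.\<close>
  define \<alpha> where "\<alpha> = Min {s, 1/2, \<beta> / 2, \<beta> * \<delta> powr (p - 1) / (4 * C3), \<delta> / 16}"
  have \<alpha>le: "\<alpha> \<le> s" "\<alpha> \<le> 1/2" "\<alpha> \<le> \<beta> / 2" "\<alpha> \<le> \<beta> * \<delta> powr (p - 1) / (4 * C3)" "\<alpha> \<le> \<delta> / 16"
    unfolding \<alpha>_def by auto
  have \<alpha>0: "0 < \<alpha>" unfolding \<alpha>_def using s0 \<beta> \<delta> C3_pos by auto
  \<comment> \<open>Chosen so that \<open>\<delta> * A / 2\<close> equals 2^p (1 + C2): the original
    exterior integral then takes at most the other half of the admissible tail. It also gives A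
    \<ge> 2, needed to start the induction from |u| \<le> S.\<close>
  define A where "A = (2 / \<delta>) * (2 powr p * (1 + C2))"
  have Ad: "\<delta> * A / 2 = 2 powr p * (1 + C2)" using \<delta> by (simp add: A_def)
  have "4 \<le> 2 powr p" using powr_mono[of 2 p 2] p2 by simp
  then have "4 * 1 \<le> 2 powr p * (1 + C2)" using C2_pos by (intro mult_mono) auto
  then have Ad1: "1 \<le> \<delta> * A / 2" unfolding Ad by simp
  have A2: "2 \<le> A"
  proof -
    have "0 \<le> A" using \<delta> C2_pos by (simp add: A_def)
    then have "\<delta> * A \<le> (1/2) * A" using \<delta> by (intro mult_right_mono) auto
    then show ?thesis using Ad1 \<open>0 \<le> A\<close> by linarith
  qed
  define \<mu> where "\<mu> j = ((1/4 :: real) ^ j) powr \<alpha>" for j :: nat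
  have \<mu>0: "0 < \<mu> j" for j by (simp add: \<mu>_def)
  have \<mu>00: "\<mu> 0 = 1" by (simp add: \<mu>_def)
  have \<mu>Suc: "(1 - \<delta> / 8) * \<mu> j \<le> \<mu> (Suc j)" for j
  proof -
    have "1 - \<delta> / 8 \<le> 1 + (- \<alpha> * ln 4)"
    proof -
      have "ln (4::real) = 2 * ln 2" using ln_realpow[of 2 2] by simp
      also have "\<dots> \<le> 2" using ln_le_minus_one[of "2::real"] by simp
      finally have "\<alpha> * ln 4 \<le> (\<delta> / 16) * 2" using \<alpha>le \<alpha>0 by (intro mult_mono) auto
      then show ?thesis by simp
    qed
    also have "\<dots> \<le> exp (- \<alpha> * ln 4)" by (rule exp_ge_add_one_self)
    also have "\<dots> = (1/4) powr \<alpha>" by (simp add: powr_def ln_div)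
    finally have "(1 - \<delta> / 8) * \<mu> j \<le> (1/4) powr \<alpha> * \<mu> j" using \<mu>0[of j] by (intro mult_right_mono) auto
    then show ?thesis by (simp only: \<mu>_def power_Suc powr_mult)
  qed
  have \<mu>dec: "\<mu> (Suc j) \<le> \<mu> j" for j
    unfolding \<mu>_def using \<alpha>0 by (intro powr_mono2) auto
  \<comment> \<open>The one-sided step, with \<open>t\<close> the upper bound at the current scale
    \<open>j\<close>. The bounds at larger scales, which may exceed \<open>t\<close> by
    \<open>A * S * (\<mu> i - \<mu> j)\<close>, are there to control the tail.\<close>
  have half: "AE y in lborel. y \<in> ball x0 (r / 4 ^ Suc j) \<longrightarrow> u y \<le> t - \<delta> / 8 * (A * S * \<mu> j)"
    if M: "0 \<le> M" and dg: "de_giorgi C M \<Omega> u" and r: "0 < r" and S: "0 < S" and B: "ball x0 r \<subseteq> \<Omega>"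
      and MS: "M * r powr ?sp \<le> S powr p"
      and uS: "AE y in lborel. y \<in> ball x0 r \<longrightarrow> \<bar>u y\<bar> \<le> S"
      and tl: "(\<integral>\<^sup>+y\<in>- ball x0 r. ennreal (\<bar>u y\<bar> powr (p - 1) * ker (y - x0)) \<partial>lborel) \<le> ennreal (S powr (p - 1) * r powr - ?sp)"
      and top: "\<And>i. i \<le> j \<Longrightarrow> AE y in lborel. y \<in> ball x0 (r / 4 ^ i) \<longrightarrow> u y \<le> t + A * S * (\<mu> i - \<mu> j)"
      and meas: "emeasure lborel (ball x0 (r / 4 ^ j / 2)) \<le> 2 * emeasure lborel {y \<in> ball x0 (r / 4 ^ j / 2). u y \<le> t - A * S * \<mu> j / 2}"
    for M and \<Omega> :: "'a set" and u x0 r S j t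
  proof -
    have um[measurable]: "u \<in> borel_measurable borel" using dg by (simp add: de_giorgi_def)
    define \<rho> where "\<rho> = r / 4 ^ j"
    have \<rho>: "0 < \<rho>" "\<rho> \<le> r" using r by (auto simp: \<rho>_def field_simps)
    define h where "h = A * S * \<mu> j / 2"
    have h: "0 < h" "A * S * \<mu> j = 2 * h" using A2 S \<mu>0[of j] by (auto simp: h_def)
    have \<delta>h: "\<delta> * h = (\<delta> * A / 2) * S * \<mu> j" by (simp add: h_def)
    have \<mu>sp: "r powr - ?sp \<le> \<mu> j powr a * \<rho> powr - ?sp" if "0 \<le> a" "a \<le> p" for a
    proof -
      define z where "z = (1/4 :: real) ^ j"
      have z: "0 < z" "z \<le> 1" by (auto simp: z_def power_le_one)
      have "\<alpha> * a \<le> s * p" using \<alpha>le \<alpha>0 that p2 s0 by (intro mult_mono) auto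
      then have "z powr ?sp \<le> z powr (\<alpha> * a)" using z by (intro powr_mono') auto
      moreover have "\<mu> j powr a = z powr (\<alpha> * a)" by (simp add: \<mu>_def z_def powr_powr)
      moreover have "\<rho> = r * z" by (simp add: \<rho>_def z_def power_one_over)
      then have "\<rho> powr - ?sp = r powr - ?sp * z powr - ?sp" by (simp add: powr_mult)
      ultimately have "z powr ?sp * z powr - ?sp * r powr - ?sp \<le> \<mu> j powr a * \<rho> powr - ?sp"
        by (simp add: mult_ac mult_right_mono)
      moreover have "z powr ?sp * z powr - ?sp = 1" using z by (simp flip: powr_add)
      ultimately show ?thesis by simp
    qed
    \<comment> \<open>The ball of radius \<rho> has positive measure, and almost everywhere on it
      \<open>u\<close> is at least - S and at most \<open>t\<close>. This makes (u - t)_+ at most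
      |u| + S in the exterior.\<close>
    have tS: "- S \<le> t"
    proof (rule ccontr)
      assume "\<not> - S \<le> t"
      have "AE y in lborel. y \<notin> ball x0 \<rho>"
        using uS top[OF order_refl] by eventually_elim (use \<open>\<not> - S \<le> t\<close> \<rho> in \<open>auto simp: \<rho>_def[symmetric]\<close>)
      then have "emeasure lborel (ball x0 \<rho>) = 0"
        by (subst (asm) AE_iff_measurable[of "ball x0 \<rho>"]) auto
      moreover have "0 < unit_ball_vol ?n * \<rho> powr ?n"
        using \<rho> by (intro mult_pos_pos unit_ball_vol_pos) auto
      ultimately show False using emeasure_ball_powr[OF \<rho>(1), of x0] by (metis ennreal_eq_0_iff not_le)
    qed
    \<comment> \<open>The tail is split in three: \<open>?f\<close> covers the annuli between the
      radii \<rho> and \<open>r\<close>, where the larger scales bound \<open>u\<close>, while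
      \<open>?g\<close> and \<open>?k\<close> carry |u| and \<open>S\<close> outside the ball of
      radius \<open>r\<close>.\<close>
    define G where "G = (2 * h * \<alpha> / \<beta>) powr (p - 1) * (4 / \<rho>) powr (?sp / 2)"
    let ?f = "\<lambda>y. ennreal G * (ennreal (1 / norm (x0 - y) powr (?n + ?sp / 2)) * indicator (- ball x0 \<rho>) y)"
    let ?g = "\<lambda>y. ennreal (2 powr (p - 1)) * (ennreal (\<bar>u y\<bar> powr (p - 1) * ker (y - x0)) * indicator (- ball x0 r) y)"
    let ?k = "\<lambda>y. ennreal (2 powr (p - 1) * S powr (p - 1)) * (ennreal (ker (y - x0)) * indicator (- ball x0 r) y)"
    have top': "AE y in lborel. \<forall>i\<le>j. y \<in> ball x0 (r / 4 ^ i) \<longrightarrow> u y \<le> t + A * S * (\<mu> i - \<mu> j)"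
    proof -
      have "AE y in lborel. \<forall>i\<in>{..j}. y \<in> ball x0 (r / 4 ^ i) \<longrightarrow> u y \<le> t + A * S * (\<mu> i - \<mu> j)"
        using top by (subst AE_ball_countable) auto
      then show ?thesis by (simp add: Ball_def)
    qed
    have tail: "(\<integral>\<^sup>+y\<in>- ball x0 \<rho>. ennreal (max (u y - t) 0 powr (p - 1) * ker (y - x0)) \<partial>lborel)
        \<le> ennreal ((\<delta> * h) powr (p - 1) * (\<rho> / 2) powr - ?sp)"
    proof -
      have "(\<integral>\<^sup>+y\<in>- ball x0 \<rho>. ennreal (max (u y - t) 0 powr (p - 1) * ker (y - x0)) \<partial>lborel)
         \<le> (\<integral>\<^sup>+y. ?f y + (?g y + ?k y) \<partial>lborel)"
      proof (rule nn_integral_mono_AE)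
        show "AE y in lborel. ennreal (max (u y - t) 0 powr (p - 1) * ker (y - x0)) * indicator (- ball x0 \<rho>) y
           \<le> ?f y + (?g y + ?k y)"
          using top'
        proof eventually_elim
          case (elim y)
          define d where "d = norm (x0 - y)"
          define m where "m = max (u y - t) 0"
          have m0: "0 \<le> m" by (simp add: m_def)
          consider "y \<in> ball x0 \<rho>" | "y \<notin> ball x0 \<rho>" "y \<in> ball x0 r" | "y \<notin> ball x0 \<rho>" "y \<notin> ball x0 r" by blast
          then show ?case
          proof cases
            case 2
            then have d: "\<rho> \<le> d" "d < r" by (auto simp: d_def dist_norm)
            have "0 < d" using d \<rho> by linarith
            \<comment> \<open>\<open>N\<close> is the last scale whose ball contains y, and N \<le>
              j since y is outside the ball of radius \<rho>. Bounding (4 d/\<rho>)^\<alpha> - 1 by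
              the power \<beta> then brings in the small factor \<alpha>/\<beta>.\<close>
            obtain N where N: "r / 4 ^ Suc N \<le> d" "d < r / 4 ^ N"
              by (rule geometric_scale[OF _ \<open>0 < d\<close> d(2), of 4]) auto
            have "r / 4 ^ j < r / 4 ^ N" using N d by (simp add: \<rho>_def)
            then have "(4::real) ^ N < 4 ^ j" using r by (simp add: field_simps)
            then have "N \<le> j" by simp
            then have "u y \<le> t + A * S * (\<mu> N - \<mu> j)" using elim N \<open>N \<le> j\<close> by (auto simp: d_def dist_norm)
            moreover have "\<mu> N - \<mu> j \<le> \<mu> j * (\<alpha> / \<beta> * (4 * d / \<rho>) powr \<beta>)"
            proof -
              have z: "\<mu> N \<le> \<mu> j * (4 * d / \<rho>) powr \<alpha>"
              proof -
                have "(1/4) ^ N \<le> (1/4) ^ j * (4 * d / \<rho>)"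
                  using N(1) r by (simp add: \<rho>_def field_simps)
                then have "\<mu> N \<le> ((1/4) ^ j * (4 * d / \<rho>)) powr \<alpha>"
                  unfolding \<mu>_def using \<alpha>0 by (intro powr_mono2) auto
                then show ?thesis by (simp only: \<mu>_def powr_mult)
              qed
              have "1 \<le> 4 * d / \<rho>" using d \<rho> by (simp add: field_simps)
              then have "(4 * d / \<rho>) powr \<alpha> - 1 \<le> \<alpha> / \<beta> * (4 * d / \<rho>) powr \<beta>"
                using \<alpha>0 \<alpha>le \<beta> by (intro powr_minus_one_le) auto
              then have "\<mu> j * ((4 * d / \<rho>) powr \<alpha> - 1) \<le> \<mu> j * (\<alpha> / \<beta> * (4 * d / \<rho>) powr \<beta>)"
                using \<mu>0[of j] by (intro mult_left_mono) auto
              then show ?thesis using z by (simp add: algebra_simps)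
            qed
            then have "A * S * (\<mu> N - \<mu> j) \<le> A * S * (\<mu> j * (\<alpha> / \<beta> * (4 * d / \<rho>) powr \<beta>))"
              using A2 S by (intro mult_left_mono) auto
            moreover have "A * S * (\<mu> j * (\<alpha> / \<beta> * (4 * d / \<rho>) powr \<beta>)) = (2 * h * \<alpha> / \<beta>) * (4 * d / \<rho>) powr \<beta>"
              unfolding h(2)[symmetric] by simp
            moreover have nn: "0 \<le> (2 * h * \<alpha> / \<beta>) * (4 * d / \<rho>) powr \<beta>" using h \<alpha>0 \<beta> by simp
            ultimately have "m \<le> (2 * h * \<alpha> / \<beta>) * (4 * d / \<rho>) powr \<beta>"
              unfolding m_def by (intro max.boundedI) linarith+
            then have "m powr (p - 1) \<le> ((2 * h * \<alpha> / \<beta>) * (4 * d / \<rho>) powr \<beta>) powr (p - 1)"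
              using p2 m0 by (intro powr_mono2) auto
            also have "\<dots> = (2 * h * \<alpha> / \<beta>) powr (p - 1) * (4 * d / \<rho>) powr (?sp / 2)"
              by (simp only: powr_mult powr_powr \<beta>(2))
            also have "(4 * d / \<rho>) powr (?sp / 2) = (4 / \<rho>) powr (?sp / 2) * d powr (?sp / 2)"
              using powr_mult[of "4 / \<rho>" d "?sp / 2"] by simp
            finally have "m powr (p - 1) * ker (y - x0) \<le> G * d powr (?sp / 2) * ker (y - x0)"
              unfolding G_def by (intro mult_right_mono) (auto simp: mult_ac)
            also have "d powr (?sp / 2) * ker (y - x0) = 1 / d powr (?n + ?sp / 2)"
            proof -
              have "d > 0" using d \<rho> by linarith
              moreover have "?n + ?sp = (?n + ?sp / 2) + ?sp / 2" by simp
              ultimately have "d powr (?n + ?sp) = d powr (?n + ?sp / 2) * d powr (?sp / 2)"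
                by (simp only: powr_add)
              then show ?thesis using \<open>d > 0\<close> unfolding ker_def d_def norm_minus_commute[of y x0] by simp
            qed
            then have "G * d powr (?sp / 2) * ker (y - x0) = G * (1 / d powr (?n + ?sp / 2))"
              by (simp only: mult.assoc)
            finally have "ennreal (m powr (p - 1) * ker (y - x0)) \<le> ennreal G * ennreal (1 / d powr (?n + ?sp / 2))"
              by (subst ennreal_mult[symmetric]) (auto simp: G_def intro!: ennreal_leI)
            then show ?thesis using 2 by (simp add: m_def d_def add_increasing2)
          next
            case 3
            have "m \<le> \<bar>u y\<bar> + S" using tS S by (auto simp: m_def)
            then have "m powr (p - 1) \<le> (\<bar>u y\<bar> + S) powr (p - 1)" using p2 m0 by (intro powr_mono2) auto
            also have "\<dots> \<le> 2 powr (p - 1) * (\<bar>u y\<bar> powr (p - 1) + S powr (p - 1))"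
              using p2 S by (intro powr_add_le) auto
            finally have "m powr (p - 1) * ker (y - x0) \<le> 2 powr (p - 1) * (\<bar>u y\<bar> powr (p - 1) + S powr (p - 1)) * ker (y - x0)"
              by (intro mult_right_mono) auto
            also have "\<dots> = 2 powr (p - 1) * (\<bar>u y\<bar> powr (p - 1) * ker (y - x0)) + 2 powr (p - 1) * S powr (p - 1) * ker (y - x0)"
              by (simp add: algebra_simps)
            finally have "ennreal (m powr (p - 1) * ker (y - x0))
              \<le> ennreal (2 powr (p - 1)) * ennreal (\<bar>u y\<bar> powr (p - 1) * ker (y - x0)) + ennreal (2 powr (p - 1) * S powr (p - 1)) * ennreal (ker (y - x0))"
              by (simp add: ennreal_mult[symmetric] ennreal_plus[symmetric] ennreal_leI del: ennreal_plus)
            then show ?thesis using 3 by (simp add: m_def add_increasing)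
          qed simp
        qed
      qed
      also have "\<dots> = (\<integral>\<^sup>+y. ?f y \<partial>lborel) + ((\<integral>\<^sup>+y. ?g y \<partial>lborel) + (\<integral>\<^sup>+y. ?k y \<partial>lborel))"
      proof -
        have "?f \<in> borel_measurable lborel" "?g \<in> borel_measurable lborel" "?k \<in> borel_measurable lborel" by measurable
        then show ?thesis by (simp add: nn_integral_add)
      qed
      also have "(\<integral>\<^sup>+y. ?f y \<partial>lborel) = ennreal G * (\<integral>\<^sup>+y\<in>- ball x0 \<rho>. ennreal (1 / norm (x0 - y) powr (?n + ?sp / 2)) \<partial>lborel)"
        by (rule nn_integral_cmult) measurable
      also have "(\<integral>\<^sup>+y. ?g y \<partial>lborel) = ennreal (2 powr (p - 1)) * (\<integral>\<^sup>+y\<in>- ball x0 r. ennreal (\<bar>u y\<bar> powr (p - 1) * ker (y - x0)) \<partial>lborel)"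
        by (rule nn_integral_cmult) measurable
      also have "(\<integral>\<^sup>+y. ?k y \<partial>lborel) = ennreal (2 powr (p - 1) * S powr (p - 1)) * (\<integral>\<^sup>+y\<in>- ball x0 r. ennreal (ker (y - x0)) \<partial>lborel)"
        by (rule nn_integral_cmult) measurable
      also have "ennreal G * (\<integral>\<^sup>+y\<in>- ball x0 \<rho>. ennreal (1 / norm (x0 - y) powr (?n + ?sp / 2)) \<partial>lborel)
          + (ennreal (2 powr (p - 1)) * (\<integral>\<^sup>+y\<in>- ball x0 r. ennreal (\<bar>u y\<bar> powr (p - 1) * ker (y - x0)) \<partial>lborel)
            + ennreal (2 powr (p - 1) * S powr (p - 1)) * (\<integral>\<^sup>+y\<in>- ball x0 r. ennreal (ker (y - x0)) \<partial>lborel))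
         \<le> ennreal G * ennreal (C3 * \<rho> powr - (?sp / 2)) + (ennreal (2 powr (p - 1)) * ennreal (S powr (p - 1) * r powr - ?sp)
            + ennreal (2 powr (p - 1) * S powr (p - 1)) * ennreal (C2 * r powr - ?sp))"
        using C3_all C2_all r \<rho> by (intro add_mono mult_left_mono tl) auto
      also have "\<dots> = ennreal (G * (C3 * \<rho> powr - (?sp / 2)) + (2 powr (p - 1) * (1 + C2) * S powr (p - 1) * r powr - ?sp))"
        using C2_pos C3_pos by (simp add: G_def ennreal_mult[symmetric] ennreal_plus[symmetric] algebra_simps del: ennreal_plus)
      also have "\<dots> \<le> ennreal ((\<delta> * h) powr (p - 1) * (\<rho> / 2) powr - ?sp)"
      proof (rule ennreal_leI)
        define Z where "Z = (\<delta> * h) powr (p - 1) * \<rho> powr - ?sp"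
        have Zeq: "(\<delta> * h) powr (p - 1) * (\<rho> / 2) powr - ?sp = 2 powr ?sp * Z"
          using \<rho> by (simp add: Z_def powr_divide powr_minus_divide)
        have Z0: "0 \<le> Z" by (simp add: Z_def)
        have t1: "G * (C3 * \<rho> powr - (?sp / 2)) \<le> 2 powr ?sp * (Z / 2)"
        proof -
          have r4: "(4 / \<rho>) powr (?sp / 2) * \<rho> powr - (?sp / 2) = 2 powr ?sp * \<rho> powr - ?sp"
          proof -
            have "(4::real) powr (?sp / 2) = (2 powr 2) powr (?sp / 2)" by simp
            also have "\<dots> = 2 powr ?sp" by (simp only: powr_powr) simp
            finally have "(4 / \<rho>) powr (?sp / 2) * \<rho> powr - (?sp / 2) = 2 powr ?sp * (\<rho> powr - (?sp / 2) * \<rho> powr - (?sp / 2))"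
              using \<rho> by (simp add: powr_divide powr_minus_divide)
            also have "\<rho> powr - (?sp / 2) * \<rho> powr - (?sp / 2) = \<rho> powr - ?sp"
              by (simp add: mult.commute flip: powr_add)
            finally show ?thesis .
          qed
          have "(2 * h * \<alpha> / \<beta>) powr (p - 1) = h powr (p - 1) * (2 * \<alpha> / \<beta>) powr (p - 1)"
            using powr_mult[of h "2 * \<alpha> / \<beta>" "p - 1"] by (simp add: mult_ac)
          then have "G * (C3 * \<rho> powr - (?sp / 2)) = h powr (p - 1) * ((2 * \<alpha> / \<beta>) powr (p - 1) * C3) * ((4 / \<rho>) powr (?sp / 2) * \<rho> powr - (?sp / 2))"
            unfolding G_def by (simp only: mult_ac)
          also have "\<dots> = h powr (p - 1) * ((2 * \<alpha> / \<beta>) powr (p - 1) * C3) * (2 powr ?sp * \<rho> powr - ?sp)"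
            unfolding r4 ..
          also have "\<dots> \<le> h powr (p - 1) * (\<delta> powr (p - 1) / 2) * (2 powr ?sp * \<rho> powr - ?sp)"
          proof (intro mult_right_mono mult_left_mono)
            have "2 * \<alpha> / \<beta> \<le> 1" "0 < 2 * \<alpha> / \<beta>" using \<alpha>le \<alpha>0 \<beta> by (auto simp: field_simps)
            then have "(2 * \<alpha> / \<beta>) powr (p - 1) \<le> 2 * \<alpha> / \<beta>" using powr_mono'[of 1 "p - 1" "2 * \<alpha> / \<beta>"] p2 by simp
            then have "(2 * \<alpha> / \<beta>) powr (p - 1) * C3 \<le> 2 * \<alpha> / \<beta> * C3" using C3_pos by (intro mult_right_mono) auto
            also have "\<dots> \<le> \<delta> powr (p - 1) / 2" using \<alpha>le(4) C3_pos \<beta> by (simp add: field_simps)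
            finally show "(2 * \<alpha> / \<beta>) powr (p - 1) * C3 \<le> \<delta> powr (p - 1) / 2" .
          qed auto
          also have "\<dots> = 2 powr ?sp * (Z / 2)" by (simp add: Z_def powr_mult)
          finally show ?thesis .
        qed
        have t2: "2 powr (p - 1) * (1 + C2) * S powr (p - 1) * r powr - ?sp \<le> Z / 2"
        proof -
          have "2 powr (p - 1) * (1 + C2) = (\<delta> * A / 2) / 2" unfolding Ad by (simp add: powr_diff)
          also have "\<dots> \<le> (\<delta> * A / 2) powr (p - 1) / 2"
            using powr_mono[of 1 "p - 1" "\<delta> * A / 2"] Ad1 p2 by (simp add: mult.commute)
          finally have "2 powr (p - 1) * (1 + C2) * (S powr (p - 1) * r powr - ?sp)
             \<le> (\<delta> * A / 2) powr (p - 1) / 2 * (S powr (p - 1) * (\<mu> j powr (p - 1) * \<rho> powr - ?sp))"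
            using p2 C2_pos by (intro mult_mono mult_left_mono \<mu>sp) auto
          also have "\<dots> = Z / 2" unfolding Z_def \<delta>h powr_mult[of "\<delta> * A / 2 * S"] powr_mult[of "\<delta> * A / 2" S] by simp
          finally show ?thesis by (simp add: mult_ac)
        qed
        have "Z / 2 \<le> 2 powr ?sp * (Z / 2)"
          using Z0 sp0 ge_one_powr_ge_zero[of 2 ?sp] mult_right_mono[of 1 "2 powr ?sp" "Z / 2"] by simp
        then show "G * (C3 * \<rho> powr - (?sp / 2)) + (2 powr (p - 1) * (1 + C2) * S powr (p - 1) * r powr - ?sp)
            \<le> (\<delta> * h) powr (p - 1) * (\<rho> / 2) powr - ?sp"
          unfolding Zeq using t1 t2 by linarith
      qed
      finally show ?thesis .
    qed
    have "AE x in lborel. x \<in> ball x0 (\<rho> / 2 / 2) \<longrightarrow> u x \<le> (t - h) + h * (1 - \<delta> / 4)"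
    proof (rule growth[rule_format, of M \<Omega>])
      show "0 \<le> M" "de_giorgi C M \<Omega> u" "0 < \<rho> / 2" "0 < h" using M dg \<rho> h by auto
      show "ball x0 (2 * (\<rho> / 2)) \<subseteq> \<Omega>" using B \<rho> subset_ball[of \<rho> r x0] by auto
      have "M * (\<rho> / 2) powr ?sp \<le> M * \<rho> powr ?sp" using M \<rho> sp0 by (intro mult_left_mono powr_mono2) auto
      also have "\<dots> = (M * r powr ?sp) * (r powr - ?sp * \<rho> powr ?sp)" using r by (simp add: powr_minus_divide)
      also have "\<dots> \<le> S powr p * ((\<mu> j powr p * \<rho> powr - ?sp) * \<rho> powr ?sp)"
        using p2 M by (intro mult_mono MS mult_right_mono \<mu>sp) auto
      also have "\<dots> = S powr p * \<mu> j powr p" using \<rho> by (simp add: powr_minus_divide)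
      also have "\<dots> \<le> (\<delta> * A / 2) powr p * (S powr p * \<mu> j powr p)"
        using Ad1 p2 mult_right_mono[of 1 "(\<delta> * A / 2) powr p" "S powr p * \<mu> j powr p"] ge_one_powr_ge_zero[of "\<delta> * A / 2" p] by simp
      also have "\<dots> = (\<delta> * h) powr p"
        unfolding \<delta>h powr_mult[of "\<delta> * A / 2 * S"] powr_mult[of "\<delta> * A / 2" S] by simp
      finally show "M * (\<rho> / 2) powr ?sp \<le> (\<delta> * h) powr p" .
      show "AE x in lborel. x \<in> ball x0 (2 * (\<rho> / 2)) \<longrightarrow> u x \<le> (t - h) + h"
        using top[of j] by (simp add: \<rho>_def)
      show "emeasure lborel (ball x0 (\<rho> / 2)) \<le> 2 * emeasure lborel {x \<in> ball x0 (\<rho> / 2). u x \<le> t - h}"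
        using meas by (simp add: \<rho>_def h_def)
      show "(\<integral>\<^sup>+y\<in>- ball x0 (2 * (\<rho> / 2)). ennreal (max (u y - ((t - h) + h)) 0 powr (p - 1) * ker (y - x0)) \<partial>lborel)
        \<le> ennreal ((\<delta> * h) powr (p - 1) * (\<rho> / 2) powr - ?sp)"
        using tail by simp
    qed
    moreover have e: "\<delta> / 8 * (A * S * \<mu> j) = h * \<delta> / 4" unfolding h(2) by simp
    ultimately show ?thesis
      unfolding e by eventually_elim (auto simp: \<rho>_def algebra_simps)
  qed
  \<comment> \<open>Selects which of {u \<le> mid} and {u \<ge> mid} fills at least half of the
    ball, and thus whether the step is made for \<open>u\<close> or for \<open>- u\<close>.\<close>
  have half_of_sum: "c \<le> 2 * a \<or> c \<le> 2 * b" if "c \<le> a + b" for a b c :: ennreal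
  proof (cases "a \<le> b")
    case True
    then have "a + b \<le> b + b" by (rule add_right_mono)
    then show ?thesis using that by (simp add: mult_2 order_trans)
  next
    case False
    then have "a + b \<le> a + a" by (intro add_left_mono) simp
    then show ?thesis using that by (simp add: mult_2 order_trans)
  qed
  \<comment> \<open>The invariant says that at scale i the values lie in the interval from
    \<open>b\<close> to \<open>b + A * S * \<mu> j\<close>, enlarged on both sides by
    \<open>A * S * (\<mu> i - \<mu> j)\<close>. It refers to the current \<open>b\<close> only, and
    survives both moves: keeping \<open>b\<close> while the top drops, and raising \<open>b\<close>
    by \<open>A * S * (\<mu> j - \<mu> (Suc j))\<close> while the top stays.\<close>
  have "\<exists>b. \<forall>i\<le>j. AE y in lborel. y \<in> ball x0 (r / 4 ^ i) \<longrightarrow>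
      b - A * S * (\<mu> i - \<mu> j) \<le> u y \<and> u y \<le> b + A * S * \<mu> i"
    if M: "0 \<le> M" and dg: "de_giorgi C M \<Omega> u" and dg': "de_giorgi C M \<Omega> (\<lambda>x. - u x)" and r: "0 < r" and S: "0 < S"
      and B: "ball x0 r \<subseteq> \<Omega>" and MS: "M * r powr ?sp \<le> S powr p"
      and uS: "AE y in lborel. y \<in> ball x0 r \<longrightarrow> \<bar>u y\<bar> \<le> S"
      and tl: "(\<integral>\<^sup>+y\<in>- ball x0 r. ennreal (\<bar>u y\<bar> powr (p - 1) * ker (y - x0)) \<partial>lborel) \<le> ennreal (S powr (p - 1) * r powr - ?sp)"
    for M and \<Omega> :: "'a set" and u x0 r S j
  proof (induction j)
    case 0
    have "2 * S \<le> A * S" using A2 S by (intro mult_right_mono) auto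
    then show ?case using uS by (intro exI[of _ "- S"]) (auto simp: \<mu>00 elim!: eventually_mono)
  next
    case (Suc j)
    have um[measurable]: "u \<in> borel_measurable borel" using dg by (simp add: de_giorgi_def)
    from Suc obtain b where b: "\<And>i. i \<le> j \<Longrightarrow> AE y in lborel. y \<in> ball x0 (r / 4 ^ i) \<longrightarrow>
      b - A * S * (\<mu> i - \<mu> j) \<le> u y \<and> u y \<le> b + A * S * \<mu> i" by blast
    define L where "L = A * S"
    have L: "0 < L" using A2 S by (simp add: L_def)
    define mid where "mid = b + L * \<mu> j / 2"
    let ?B = "ball x0 (r / 4 ^ j / 2)"
    have dec: "L * \<mu> (Suc j) \<le> L * \<mu> j" using \<mu>dec L by simp
    have gain: "L * \<mu> j - \<delta> / 8 * (L * \<mu> j) \<le> L * \<mu> (Suc j)"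
      using mult_left_mono[OF \<mu>Suc[of j], of L] L by (simp add: algebra_simps)
    have "emeasure lborel ?B \<le> emeasure lborel {y \<in> ?B. u y \<le> mid} + emeasure lborel {y \<in> ?B. - u y \<le> - mid}"
      by (rule order_trans[OF emeasure_mono emeasure_subadditive]) auto
    then have "emeasure lborel ?B \<le> 2 * emeasure lborel {y \<in> ?B. u y \<le> mid} \<or> emeasure lborel ?B \<le> 2 * emeasure lborel {y \<in> ?B. - u y \<le> - mid}"
      by (rule half_of_sum)
    then show ?case
    proof
      assume m: "emeasure lborel ?B \<le> 2 * emeasure lborel {y \<in> ?B. u y \<le> mid}"
      have "AE y in lborel. y \<in> ball x0 (r / 4 ^ Suc j) \<longrightarrow> u y \<le> (b + L * \<mu> j) - \<delta> / 8 * (A * S * \<mu> j)"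
      proof (rule half[OF M dg r S B MS uS tl])
        show "AE y in lborel. y \<in> ball x0 (r / 4 ^ i) \<longrightarrow> u y \<le> b + L * \<mu> j + A * S * (\<mu> i - \<mu> j)" if "i \<le> j" for i
          using b[OF that] by eventually_elim (auto simp: L_def algebra_simps)
        show "emeasure lborel ?B \<le> 2 * emeasure lborel {y \<in> ?B. u y \<le> b + L * \<mu> j - A * S * \<mu> j / 2}"
        proof -
          have "b + L * \<mu> j - A * S * \<mu> j / 2 = mid" unfolding mid_def L_def by linarith
          then show ?thesis using m by (simp only:)
        qed
      qed
      then have new: "AE y in lborel. y \<in> ball x0 (r / 4 ^ Suc j) \<longrightarrow> u y \<le> b + L * \<mu> (Suc j)"
        by eventually_elim (use gain in \<open>auto simp: L_def\<close>)
      have sub: "y \<in> ball x0 (r / 4 ^ j)" if "y \<in> ball x0 (r / 4 ^ Suc j)" for y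
      proof -
        have "r / 4 ^ Suc j \<le> r / 4 ^ j" using r by (simp add: field_simps)
        then show ?thesis using that by (meson subset_ball subsetD)
      qed
      show ?case
      proof (intro exI[of _ b] allI impI)
        fix i assume "i \<le> Suc j"
        then consider "i \<le> j" | "i = Suc j" by linarith
        then show "AE y in lborel. y \<in> ball x0 (r / 4 ^ i) \<longrightarrow> b - A * S * (\<mu> i - \<mu> (Suc j)) \<le> u y \<and> u y \<le> b + A * S * \<mu> i"
        proof cases
          case 1
          then show ?thesis using b[OF 1] by eventually_elim (use dec in \<open>auto simp: L_def algebra_simps\<close>)
        next
          case 2
          show ?thesis unfolding 2 using new b[OF order_refl]
            by eventually_elim (use sub in \<open>auto simp: L_def\<close>)
        qed
      qed
    next
      assume m: "emeasure lborel ?B \<le> 2 * emeasure lborel {y \<in> ?B. - u y \<le> - mid}"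
      have "AE y in lborel. y \<in> ball x0 (r / 4 ^ Suc j) \<longrightarrow> - u y \<le> - b - \<delta> / 8 * (A * S * \<mu> j)"
      proof (rule half[OF M dg' r S B MS])
        show "AE y in lborel. y \<in> ball x0 r \<longrightarrow> \<bar>- u y\<bar> \<le> S" using uS by simp
        show "(\<integral>\<^sup>+y\<in>- ball x0 r. ennreal (\<bar>- u y\<bar> powr (p - 1) * ker (y - x0)) \<partial>lborel) \<le> ennreal (S powr (p - 1) * r powr - ?sp)"
          using tl by simp
        show "AE y in lborel. y \<in> ball x0 (r / 4 ^ i) \<longrightarrow> - u y \<le> - b + A * S * (\<mu> i - \<mu> j)" if "i \<le> j" for i
          using b[OF that] by eventually_elim (auto simp: algebra_simps)
        show "emeasure lborel ?B \<le> 2 * emeasure lborel {y \<in> ?B. - u y \<le> - b - A * S * \<mu> j / 2}"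
        proof -
          have "- b - A * S * \<mu> j / 2 = - mid" unfolding mid_def L_def by linarith
          then show ?thesis using m by (simp only:)
        qed
      qed
      then have new: "AE y in lborel. y \<in> ball x0 (r / 4 ^ Suc j) \<longrightarrow> b + L * \<mu> j - L * \<mu> (Suc j) \<le> u y"
        by eventually_elim (use gain in \<open>auto simp: L_def\<close>)
      have sub: "y \<in> ball x0 (r / 4 ^ j)" if "y \<in> ball x0 (r / 4 ^ Suc j)" for y
      proof -
        have "r / 4 ^ Suc j \<le> r / 4 ^ j" using r by (simp add: field_simps)
        then show ?thesis using that by (meson subset_ball subsetD)
      qed
      show ?case
      proof (intro exI[of _ "b + L * \<mu> j - L * \<mu> (Suc j)"] allI impI)
        fix i assume "i \<le> Suc j"
        then consider "i \<le> j" | "i = Suc j" by linarith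
        then show "AE y in lborel. y \<in> ball x0 (r / 4 ^ i) \<longrightarrow>
          b + L * \<mu> j - L * \<mu> (Suc j) - A * S * (\<mu> i - \<mu> (Suc j)) \<le> u y \<and> u y \<le> b + L * \<mu> j - L * \<mu> (Suc j) + A * S * \<mu> i"
        proof cases
          case 1
          then show ?thesis using b[OF 1] by eventually_elim (use dec in \<open>auto simp: L_def algebra_simps\<close>)
        next
          case 2
          show ?thesis unfolding 2 using new b[OF order_refl]
            by eventually_elim (use sub in \<open>auto simp: L_def\<close>)
        qed
      qed
    qed
  qed
  note P = this
  show ?thesis
  proof (rule exI[of _ \<alpha>], rule exI[of _ A], intro conjI allI impI)
    show "0 < \<alpha>" "\<alpha> < 1" "0 < A" using \<alpha>0 \<alpha>le A2 by auto
    fix M and \<Omega> :: "'a set" and u x0 r S and j :: nat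
    assume "0 \<le> M" "de_giorgi C M \<Omega> u" "de_giorgi C M \<Omega> (\<lambda>x. - u x)" "0 < r" "0 < S" "ball x0 r \<subseteq> \<Omega>"
      "M * r powr ?sp \<le> S powr p" "AE y in lborel. y \<in> ball x0 r \<longrightarrow> \<bar>u y\<bar> \<le> S"
      "(\<integral>\<^sup>+y\<in>- ball x0 r. ennreal (\<bar>u y\<bar> powr (p - 1) * ker (y - x0)) \<partial>lborel) \<le> ennreal (S powr (p - 1) * r powr - ?sp)"
    from P[OF this, of j] obtain b where "AE y in lborel. y \<in> ball x0 (r / 4 ^ j) \<longrightarrow>
      b - A * S * (\<mu> j - \<mu> j) \<le> u y \<and> u y \<le> b + A * S * \<mu> j" by blast
    then show "\<exists>b. AE y in lborel. y \<in> ball x0 (r / 4 ^ j) \<longrightarrow> b \<le> u y \<and> u y \<le> b + A * S * ((1/4) ^ j) powr \<alpha>"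
      by (intro exI[of _ b]) (simp add: \<mu>_def)
  qed
qed

end

section \<open>Hoelder continuity of minimizers\<close>

text \<open>It depends only on the almost-everywhere class of \<open>u\<close> and has a value at
  every point. As \<open>Sup\<close> of an empty or unbounded set of reals is arbitrary, it is used
  only where \<open>u\<close> is essentially bounded near x.\<close>

definition ess_lower_limit :: "('a::euclidean_space \<Rightarrow> real) \<Rightarrow> 'a \<Rightarrow> real" where
  "ess_lower_limit u x = Sup {a. \<exists>d>0. AE y in lborel. y \<in> ball x d \<longrightarrow> a \<le> u y}"

text \<open>Contradictory bounds on two concentric balls would make the smaller ball a null set.
  This is the device that turns bounds almost everywhere into bounds at every point.\<close>

lemma ess_lower_limit_bounds:
  fixes u :: "'a::euclidean_space \<Rightarrow> real"
  assumes d: "0 < d" and ae: "AE y in lborel. y \<in> ball x d \<longrightarrow> b \<le> u y \<and> u y \<le> b'"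
  shows "b \<le> ess_lower_limit u x" and "ess_lower_limit u x \<le> b'"
proof -
  let ?X = "{a. \<exists>d>0. AE y in lborel. y \<in> ball x d \<longrightarrow> a \<le> u y}"
  have bX: "b \<in> ?X" using d ae by (auto elim!: eventually_mono)
  have le: "a \<le> b'" if aX: "a \<in> ?X" for a
  proof (rule ccontr)
    assume "\<not> a \<le> b'"
    obtain d' where d': "0 < d'" "AE y in lborel. y \<in> ball x d' \<longrightarrow> a \<le> u y" using aX by blast
    have "AE y in lborel. y \<notin> ball x (min d d')"
      using ae d'(2) by eventually_elim (use \<open>\<not> a \<le> b'\<close> in auto)
    then have "emeasure lborel (ball x (min d d')) = 0"
      by (subst (asm) AE_iff_measurable[of "ball x (min d d')"]) auto
    moreover have "0 < unit_ball_vol (real DIM('a)) * min d d' powr real DIM('a)"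
      using d d' by (intro mult_pos_pos unit_ball_vol_pos) auto
    ultimately show False using emeasure_ball_powr[of "min d d'" x] d d'
      by (metis ennreal_eq_0_iff not_le min_less_iff_conj)
  qed
  show "b \<le> ess_lower_limit u x" unfolding ess_lower_limit_def
    using bX le by (intro cSup_upper) (auto intro!: bdd_aboveI[of _ b'])
  show "ess_lower_limit u x \<le> b'" unfolding ess_lower_limit_def
    using bX le by (intro cSup_least) auto
qed

text \<open>Near each point \<open>u\<close> and its essential lower limit lie in the same interval
  of length e, up to a null set. By the Lindelof property countably many such neighbourhoods
  suffice, so the union of the null sets is null; then e runs through a sequence tending to
  0.\<close>

lemma ess_lower_limit_AE_eq:
  fixes u :: "'a::euclidean_space \<Rightarrow> real"
  assumes osc: "\<And>x e. x \<in> \<Omega> \<Longrightarrow> 0 < e \<Longrightarrow> \<exists>d>0. \<exists>b. AE y in lborel. y \<in> ball x d \<longrightarrow> b \<le> u y \<and> u y \<le> b + e"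
  shows "AE x in lborel. x \<in> \<Omega> \<longrightarrow> ess_lower_limit u x = u x"
proof -
  have close: "AE y in lborel. y \<in> \<Omega> \<longrightarrow> \<bar>u y - ess_lower_limit u y\<bar> \<le> e" if e: "0 < e" for e
  proof -
    define F where "F = {U. open U \<and> (AE y in lborel. y \<in> U \<longrightarrow> \<bar>u y - ess_lower_limit u y\<bar> \<le> e)}"
    have cov: "\<Omega> \<subseteq> \<Union>F"
    proof
      fix x assume "x \<in> \<Omega>"
      then obtain d b where d: "d > 0" and ae: "AE y in lborel. y \<in> ball x d \<longrightarrow> b \<le> u y \<and> u y \<le> b + e"
        using osc e by blast
      have w: "b \<le> ess_lower_limit u y \<and> ess_lower_limit u y \<le> b + e" if yd: "y \<in> ball x d" for y
      proof -
        obtain d' where d': "0 < d'" "ball y d' \<subseteq> ball x d"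
          using yd open_contains_ball[of "ball x d"] by blast
        have "AE z in lborel. z \<in> ball y d' \<longrightarrow> b \<le> u z \<and> u z \<le> b + e"
          using ae by eventually_elim (use d' in blast)
        from ess_lower_limit_bounds[OF d'(1) this] show ?thesis by blast
      qed
      have "AE y in lborel. y \<in> ball x d \<longrightarrow> \<bar>u y - ess_lower_limit u y\<bar> \<le> e"
        using ae
      proof eventually_elim
        case (elim y)
        then show ?case using w[of y] by (auto simp: abs_le_iff)
      qed
      then have "ball x d \<in> F" by (simp add: F_def)
      then show "x \<in> \<Union>F" using d by (auto intro!: bexI[of _ "ball x d"])
    qed
    obtain F' where F': "F' \<subseteq> F" "countable F'" "\<Union>F' = \<Union>F"
      using Lindelof[of F] by (auto simp: F_def)
    have "AE y in lborel. \<forall>U\<in>F'. y \<in> U \<longrightarrow> \<bar>u y - ess_lower_limit u y\<bar> \<le> e"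
      using F' by (subst AE_ball_countable) (auto simp: F_def)
    then show ?thesis by eventually_elim (use cov F' in blast)
  qed
  have "AE y in lborel. \<forall>k. y \<in> \<Omega> \<longrightarrow> \<bar>u y - ess_lower_limit u y\<bar> \<le> inverse (real (Suc k))"
    by (subst AE_all_countable) (auto intro!: close)
  then show ?thesis
  proof eventually_elim
    case (elim y)
    show ?case
    proof
      assume "y \<in> \<Omega>"
      have "\<bar>u y - ess_lower_limit u y\<bar> \<le> 0 + e" if e: "0 < e" for e
      proof -
        obtain k where "inverse (real (Suc k)) < e" using reals_Archimedean[OF e] by blast
        moreover have "\<bar>u y - ess_lower_limit u y\<bar> \<le> inverse (real (Suc k))" using elim \<open>y \<in> \<Omega>\<close> by blast
        ultimately show ?thesis by linarith
      qed
      then have "\<bar>u y - ess_lower_limit u y\<bar> \<le> 0" by (rule field_le_epsilon)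
      then show "ess_lower_limit u y = u y" by simp
    qed
  qed
qed

section \<open>Passage from Lebesgue measurable data to Borel representatives\<close>

lemma emeasure_lebesgue_borel: "A \<in> sets borel \<Longrightarrow> emeasure lebesgue A = emeasure lborel A"
  by simp

context fractional_energy begin

lemma gagliardo_eq_frac_energy: "gagliardo s p u = frac_energy (u :: real ^ 'n \<Rightarrow> real)"
  by (simp add: gagliardo_def frac_energy_def ker_def nn_integral_completion)

lemma frac_energy_cong_AE:
  assumes "AE x in lborel. u x = v x"
  shows "frac_energy u = frac_energy v"
  unfolding frac_energy_def
proof (rule nn_integral_cong_AE, use assms in eventually_elim)
  case (elim x)
  show ?case by (rule nn_integral_cong_AE, use assms in eventually_elim) (simp add: elim)
qed

text \<open>The energy, and the set where two functions differ, are unchanged when both functions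
  change sign; estimates from above thereby become estimates from below.\<close>

lemma quasi_minimizer_uminus:
  assumes "quasi_minimizer M \<Omega> u"
  shows "quasi_minimizer M \<Omega> (\<lambda>x. - u x)"
proof -
  have neg: "frac_energy (\<lambda>x. - v x) = frac_energy v" for v :: "'a \<Rightarrow> real"
    by (simp add: frac_energy_def abs_minus_commute)
  have um: "u \<in> borel_measurable borel" and ufin: "(\<integral>\<^sup>+x. ennreal (\<bar>u x\<bar> powr p) \<partial>lborel) < \<infinity>" and ugag: "frac_energy u < \<infinity>"
    and umin: "\<And>v. v \<in> borel_measurable borel \<Longrightarrow> (\<integral>\<^sup>+x. ennreal (\<bar>v x\<bar> powr p) \<partial>lborel) < \<infinity> \<Longrightarrow> frac_energy v < \<infinity> \<Longrightarrow>
      (\<And>x. x \<notin> \<Omega> \<Longrightarrow> v x = u x) \<Longrightarrow> frac_energy u \<le> frac_energy v + ennreal M * emeasure lborel {x. v x \<noteq> u x}"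
    using assms by (auto simp: quasi_minimizer_def)
  have "frac_energy (\<lambda>x. - u x) \<le> frac_energy v + ennreal M * emeasure lborel {x. v x \<noteq> - u x}"
    if "v \<in> borel_measurable borel" "(\<integral>\<^sup>+x. ennreal (\<bar>v x\<bar> powr p) \<partial>lborel) < \<infinity>" "frac_energy v < \<infinity>"
      "\<forall>x. x \<notin> \<Omega> \<longrightarrow> v x = - u x" for v
  proof -
    have "frac_energy u \<le> frac_energy (\<lambda>x. - v x) + ennreal M * emeasure lborel {x. - v x \<noteq> u x}"
      using that by (intro umin) (auto simp: neg)
    moreover have "{x. - v x \<noteq> u x} = {x. v x \<noteq> - u x}" by auto
    ultimately show ?thesis by (simp add: neg)
  qed
  then show ?thesis using um ufin ugag by (simp add: quasi_minimizer_def neg)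
qed

text \<open>The positivity set of a competitor v is contained in that of \<open>u'\<close> together
  with {v \<noteq> u'}. As \<Omega> is bounded, M |{u' > 0} \<inter> \<Omega>| is finite and can be
  subtracted from both sides.\<close>

lemma minimizer_imp_quasi_minimizer:
  fixes u u' :: "real ^ 'n \<Rightarrow> real"
  assumes min: "is_minimizer s p M \<Omega> u" and \<Omega>: "open \<Omega>" "bounded \<Omega>"
    and u'[measurable]: "u' \<in> borel_measurable borel" and ae: "AE x in lborel. u x = u' x"
  shows "quasi_minimizer M \<Omega> u'"
proof -
  obtain g where u: "u \<in> admissible s p g \<Omega>"
    and le: "\<And>v. v \<in> admissible s p g \<Omega> \<Longrightarrow> energy s p M \<Omega> u \<le> energy s p M \<Omega> v"
    using min by (auto simp: is_minimizer_def)
  have uS: "u \<in> frac_sobolev s p" and ug: "AE x in lborel. x \<notin> \<Omega> \<longrightarrow> u x = g x"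
    using u by (auto simp: admissible_def AE_completion_iff)
  have um: "u \<in> borel_measurable lebesgue" using uS by (simp add: frac_sobolev_def)
  have gu: "frac_energy u = frac_energy u'" by (rule frac_energy_cong_AE[OF ae])
  have fin: "(\<integral>\<^sup>+x. ennreal (\<bar>u' x\<bar> powr p) \<partial>lborel) < \<infinity>"
  proof -
    have "(\<integral>\<^sup>+x. ennreal (\<bar>u' x\<bar> powr p) \<partial>lborel) = (\<integral>\<^sup>+x. ennreal (\<bar>u x\<bar> powr p) \<partial>lborel)"
      using ae by (intro nn_integral_cong_AE) (auto elim!: eventually_mono)
    also have "\<dots> = (\<integral>\<^sup>+x. ennreal (norm (\<bar>u x\<bar> powr p)) \<partial>lebesgue)"
      by (simp add: nn_integral_completion)
    also have "\<dots> < \<infinity>" using uS unfolding frac_sobolev_def integrable_iff_bounded by blast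
    finally show ?thesis .
  qed
  have set_eq: "emeasure lebesgue ({x. u x > 0} \<inter> \<Omega>) = emeasure lborel ({x. u' x > 0} \<inter> \<Omega>)"
  proof -
    have [measurable]: "\<Omega> \<in> sets borel" using \<Omega> by simp
    have "emeasure lebesgue ({x. u x > 0} \<inter> \<Omega>) = emeasure lebesgue ({x. u' x > 0} \<inter> \<Omega>)"
    proof (rule emeasure_eq_AE)
      show "AE x in lebesgue. (x \<in> {x. u x > 0} \<inter> \<Omega>) = (x \<in> {x. u' x > 0} \<inter> \<Omega>)"
        using AE_completion[OF ae] by eventually_elim auto
      have "{x \<in> space lebesgue. u x > 0} \<in> sets lebesgue" using um by measurable
      then show "{x. u x > 0} \<inter> \<Omega> \<in> sets lebesgue" using \<Omega> by auto
      have "{x. u' x > 0} \<in> sets borel" by measurable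
      then show "{x. u' x > 0} \<inter> \<Omega> \<in> sets lebesgue" using \<Omega> by auto
    qed
    also have "\<dots> = emeasure lborel ({x. u' x > 0} \<inter> \<Omega>)"
    proof (rule emeasure_lebesgue_borel)
      have "{x. u' x > 0} \<in> sets borel" by measurable
      then show "{x. u' x > 0} \<inter> \<Omega> \<in> sets borel" using \<Omega> by auto
    qed
    finally show ?thesis .
  qed
  have "frac_energy u' \<le> frac_energy v + ennreal M * emeasure lborel {x. v x \<noteq> u' x}"
    if v[measurable]: "v \<in> borel_measurable borel" and vfin: "(\<integral>\<^sup>+x. ennreal (\<bar>v x\<bar> powr p) \<partial>lborel) < \<infinity>"
      and vgag: "frac_energy v < \<infinity>" and vout: "\<forall>x. x \<notin> \<Omega> \<longrightarrow> v x = u' x" for v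
  proof -
    let ?m = "emeasure lborel ({x. u' x > 0} \<inter> \<Omega>)"
    have "v \<in> frac_sobolev s p"
      unfolding frac_sobolev_def
    proof (intro CollectI conjI)
      show vl: "v \<in> borel_measurable lebesgue" using v by (intro measurable_completion) simp
      have "(\<lambda>x. \<bar>v x\<bar> powr p) \<in> borel_measurable borel" by measurable
      then show "integrable lebesgue (\<lambda>x. \<bar>v x\<bar> powr p)"
        unfolding integrable_iff_bounded using vfin
        by (auto simp: nn_integral_completion intro!: measurable_completion)
      show "gagliardo s p v < \<infinity>" using vgag by (simp add: gagliardo_eq_frac_energy)
    qed
    moreover have "AE x in lborel. x \<notin> \<Omega> \<longrightarrow> v x = g x"
      using ug ae by eventually_elim (use vout in auto)
    ultimately have "v \<in> admissible s p g \<Omega>" by (simp add: admissible_def AE_completion_iff)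
    from le[OF this] have "frac_energy u' + ennreal M * ?m \<le> frac_energy v + ennreal M * emeasure lebesgue ({x. v x > 0} \<inter> \<Omega>)"
      unfolding energy_def gagliardo_eq_frac_energy gu set_eq .
    also have "emeasure lebesgue ({x. v x > 0} \<inter> \<Omega>) = emeasure lborel ({x. v x > 0} \<inter> \<Omega>)"
    proof (rule emeasure_lebesgue_borel)
      have "{x. v x > 0} \<in> sets borel" by measurable
      then show "{x. v x > 0} \<inter> \<Omega> \<in> sets borel" using \<Omega> by auto
    qed
    also have "\<dots> \<le> emeasure lborel (({x. u' x > 0} \<inter> \<Omega>) \<union> {x. v x \<noteq> u' x})"
    proof (rule emeasure_mono)
      have "{x. u' x > 0} \<in> sets borel" "{x. v x \<noteq> u' x} \<in> sets borel" by measurable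
      then show "({x. u' x > 0} \<inter> \<Omega>) \<union> {x. v x \<noteq> u' x} \<in> sets lborel" using \<Omega> by auto
    qed auto
    also have "\<dots> \<le> ?m + emeasure lborel {x. v x \<noteq> u' x}"
    proof (rule emeasure_subadditive)
      have "{x. u' x > 0} \<in> sets borel" "{x. v x \<noteq> u' x} \<in> sets borel" by measurable
      then show "({x. u' x > 0} \<inter> \<Omega>) \<in> sets lborel" "{x. v x \<noteq> u' x} \<in> sets lborel" using \<Omega> by auto
    qed
    finally have "ennreal M * ?m + frac_energy u' \<le> ennreal M * ?m + (frac_energy v + ennreal M * emeasure lborel {x. v x \<noteq> u' x})"
      by (auto simp: distrib_left add_ac mult_left_mono)
    moreover have "ennreal M * ?m < \<infinity>"
    proof -
      have "?m \<le> emeasure lborel \<Omega>" using \<Omega> by (intro emeasure_mono) auto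
      also have "\<dots> < \<infinity>" using emeasure_bounded_finite[OF \<Omega>(2)] by simp
      finally show ?thesis by (auto intro!: ennreal_mult_less_top[THEN iffD2])
    qed
    ultimately show ?thesis by (auto simp: ennreal_add_left_cancel_le)
  qed
  then show ?thesis
    unfolding quasi_minimizer_def using u' fin uS by (auto simp: frac_sobolev_def gagliardo_eq_frac_energy gu)
qed

text \<open>Finiteness must be known before the real-valued integral in \<open>tail\<close> can be
  identified with an extended one. Where |u| \<le> 1 the kernel alone is integrable outside the
  ball; elsewhere |u|^(p-1) \<le> |u|^p and the kernel is at most r^-(n + sp).\<close>

lemma nn_integral_tail:
  fixes u u' :: "real ^ 'n \<Rightarrow> real"
  assumes u: "u \<in> frac_sobolev s p" and u'[measurable]: "u' \<in> borel_measurable borel"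
    and ae: "AE x in lborel. u x = u' x" and r: "0 < r"
  shows "(\<integral>\<^sup>+y\<in>- ball x0 r. ennreal (\<bar>u' y\<bar> powr (p - 1) * ker (y - x0)) \<partial>lborel)
     = ennreal (tail s p u x0 r powr (p - 1) * r powr - (s * p))"
proof -
  let ?e = "real CARD('n) + s * p"
  define k where "k y = indicator (- ball x0 r) y * (1 / norm (y - x0) powr ?e)" for y
  have km: "k \<in> borel_measurable borel" unfolding k_def[abs_def] by measurable
  have k0: "0 \<le> k y" for y by (simp add: k_def)
  define f where "f y = \<bar>u y\<bar> powr (p - 1) * k y" for y
  have um[measurable]: "u \<in> borel_measurable lebesgue" using u by (simp add: frac_sobolev_def)
  have [measurable]: "k \<in> borel_measurable lebesgue" using km by (intro measurable_completion) simp
  have fm: "f \<in> borel_measurable lebesgue" unfolding f_def[abs_def] by measurable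
  have f0: "0 \<le> f y" for y by (simp add: f_def k0)
  let ?T = "\<integral>\<^sup>+y\<in>- ball x0 r. ennreal (\<bar>u' y\<bar> powr (p - 1) * ker (y - x0)) \<partial>lborel"
  have fT: "(\<integral>\<^sup>+y. ennreal (f y) \<partial>lebesgue) = ?T"
    unfolding nn_integral_completion
  proof (rule nn_integral_cong_AE, use ae in eventually_elim)
    case (elim y)
    then show ?case by (simp add: f_def k_def ker_def indicator_def)
  qed
  obtain C2 where C2: "\<forall>(x::real^'n) \<rho>. \<rho> > 0 \<longrightarrow>
    (\<integral>\<^sup>+y\<in>- ball x \<rho>. ennreal (ker (y - x)) \<partial>lborel) \<le> ennreal (C2 * \<rho> powr - (s * p))"
    using far_ker_integral[where 'a = "real^'n"] by blast
  have "?T \<le> (\<integral>\<^sup>+y. ennreal (ker (y - x0)) * indicator (- ball x0 r) y + ennreal (1 / r powr ?e) * ennreal (\<bar>u' y\<bar> powr p) \<partial>lborel)"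
  proof (rule nn_integral_mono)
    fix y
    have "ennreal (\<bar>u' y\<bar> powr (p - 1) * ker (y - x0)) \<le> ennreal (ker (y - x0)) + ennreal (1 / r powr ?e) * ennreal (\<bar>u' y\<bar> powr p)"
      if y: "y \<notin> ball x0 r"
    proof (cases "\<bar>u' y\<bar> \<le> 1")
      case True
      then have "\<bar>u' y\<bar> powr (p - 1) * ker (y - x0) \<le> ker (y - x0)"
        using p2 by (intro mult_left_le_one_le powr_le1) auto
      then show ?thesis by (intro add_increasing2 ennreal_leI) auto
    next
      case False
      then have "\<bar>u' y\<bar> powr (p - 1) \<le> \<bar>u' y\<bar> powr p" by (intro powr_mono) auto
      moreover have "ker (y - x0) \<le> 1 / r powr ?e"
        unfolding ker_def using y r sp0
        by (auto simp: dist_norm norm_minus_commute intro!: divide_left_mono powr_mono2 mult_pos_pos)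
      ultimately have "\<bar>u' y\<bar> powr (p - 1) * ker (y - x0) \<le> 1 / r powr ?e * \<bar>u' y\<bar> powr p"
        by (subst mult.commute) (intro mult_mono, auto)
      then have "ennreal (\<bar>u' y\<bar> powr (p - 1) * ker (y - x0)) \<le> ennreal (1 / r powr ?e) * ennreal (\<bar>u' y\<bar> powr p)"
        by (subst ennreal_mult[symmetric]) (auto intro: ennreal_leI)
      then show ?thesis by (intro add_increasing) auto
    qed
    then show "ennreal (\<bar>u' y\<bar> powr (p - 1) * ker (y - x0)) * indicator (- ball x0 r) y
      \<le> ennreal (ker (y - x0)) * indicator (- ball x0 r) y + ennreal (1 / r powr ?e) * ennreal (\<bar>u' y\<bar> powr p)"
      by (cases "y \<in> ball x0 r") auto
  qed
  also have "\<dots> = (\<integral>\<^sup>+y\<in>- ball x0 r. ennreal (ker (y - x0)) \<partial>lborel) + ennreal (1 / r powr ?e) * (\<integral>\<^sup>+y. ennreal (\<bar>u' y\<bar> powr p) \<partial>lborel)"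
    by (subst nn_integral_add) (auto simp: nn_integral_cmult)
  also have "\<dots> < \<infinity>"
  proof -
    have "(\<integral>\<^sup>+x. ennreal (\<bar>u' x\<bar> powr p) \<partial>lborel) = (\<integral>\<^sup>+x. ennreal (norm (\<bar>u x\<bar> powr p)) \<partial>lebesgue)"
      unfolding nn_integral_completion using ae by (intro nn_integral_cong_AE) (auto elim!: eventually_mono)
    also have "\<dots> < \<infinity>" using u unfolding frac_sobolev_def integrable_iff_bounded by blast
    finally have "ennreal (1 / r powr ?e) * (\<integral>\<^sup>+y. ennreal (\<bar>u' y\<bar> powr p) \<partial>lborel) < \<infinity>"
      by (simp add: ennreal_mult_less_top)
    moreover have "(\<integral>\<^sup>+y\<in>- ball x0 r. ennreal (ker (y - x0)) \<partial>lborel) < \<infinity>"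
      by (rule order_le_less_trans[OF C2[rule_format, OF r]]) simp
    ultimately show ?thesis by simp
  qed
  finally have Tfin: "?T < \<infinity>" .
  have int: "integrable lebesgue f"
    using fm f0 Tfin fT by (intro integrableI_nonneg) auto
  have "?T = ennreal (\<integral>y. f y \<partial>lebesgue)"
    unfolding fT[symmetric] using int f0 by (intro nn_integral_eq_integral) auto
  moreover have "(\<integral>y. f y \<partial>lebesgue) = tail s p u x0 r powr (p - 1) * r powr - (s * p)"
  proof -
    have "(LINT y:(- ball x0 r)|lebesgue. \<bar>u y\<bar> powr (p - 1) / norm (y - x0) powr ?e) = (\<integral>y. f y \<partial>lebesgue)"
      unfolding set_lebesgue_integral_def by (intro Bochner_Integration.integral_cong) (auto simp: f_def k_def)
    then have "tail s p u x0 r powr (p - 1) = (r powr (s * p) * (\<integral>y. f y \<partial>lebesgue)) powr (1 / (p - 1) * (p - 1))"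
      by (simp only: tail_def powr_powr)
    also have "1 / (p - 1) * (p - 1) = 1" using p2 by simp
    also have "(r powr (s * p) * (\<integral>y. f y \<partial>lebesgue)) powr 1 = r powr (s * p) * (\<integral>y. f y \<partial>lebesgue)"
      using f0 by (intro powr_one mult_nonneg_nonneg integral_nonneg_AE) auto
    finally show ?thesis using r by (simp add: powr_minus_divide)
  qed
  ultimately show ?thesis by simp
qed

lemma nn_integral_ball_powr:
  fixes u u' :: "real ^ 'n \<Rightarrow> real"
  assumes u: "u \<in> frac_sobolev s p" and ae: "AE x in lborel. u x = u' x" and r: "0 < r"
  shows "(\<integral>\<^sup>+x\<in>ball x0 r. ennreal (\<bar>u' x\<bar> powr p) \<partial>lborel)
     = ennreal (unit_ball_vol CARD('n) * r powr CARD('n) *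
         ((1 / measure lebesgue (ball x0 r) * (LINT x:ball x0 r|lebesgue. \<bar>u x\<bar> powr p)) powr (1 / p)) powr p)"
proof -
  let ?V = "unit_ball_vol CARD('n) * r powr CARD('n)"
  define I where "I = (LINT x:ball x0 r|lebesgue. \<bar>u x\<bar> powr p)"
  have I0: "0 \<le> I" unfolding I_def set_lebesgue_integral_def by (intro integral_nonneg_AE) auto
  have V: "0 < ?V" using r by (intro mult_pos_pos unit_ball_vol_pos) auto
  have m: "measure lebesgue (ball x0 r) = ?V"
    using emeasure_ball_powr[OF r, of x0] V by (simp add: measure_def)
  have int: "integrable lebesgue (\<lambda>x. indicator (ball x0 r) x *\<^sub>R (\<bar>u x\<bar> powr p))"
    using u by (intro integrable_mult_indicator) (auto simp: frac_sobolev_def)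
  have "(\<integral>\<^sup>+x\<in>ball x0 r. ennreal (\<bar>u' x\<bar> powr p) \<partial>lborel) = (\<integral>\<^sup>+x. ennreal (indicator (ball x0 r) x *\<^sub>R (\<bar>u x\<bar> powr p)) \<partial>lebesgue)"
    unfolding nn_integral_completion
  proof (rule nn_integral_cong_AE, use ae in eventually_elim)
    case (elim y)
    then show ?case by (simp add: indicator_def)
  qed
  also have "\<dots> = ennreal I"
    unfolding I_def set_lebesgue_integral_def using int by (intro nn_integral_eq_integral) auto
  also have "I = ?V * ((1 / measure lebesgue (ball x0 r) * I) powr (1 / p)) powr p"
  proof -
    define v where "v = ?V"
    have v: "0 < v" using V by (simp only: v_def)
    have "1 / p * p = 1" using p2 by simp
    moreover have "0 \<le> 1 / v * I" using v I0 by simp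
    ultimately have "v * ((1 / v * I) powr (1 / p)) powr p = v * (1 / v * I)"
      unfolding powr_powr by (simp only: powr_one)
    also have "\<dots> = I" using v by simp
    finally show ?thesis unfolding m v_def by (rule sym)
  qed
  finally show ?thesis unfolding I_def .
qed

text \<open>The bracket \<open>Q\<close> of the estimate dominates the mean, the tail and M^(1/p)
  R^s, hence everything that the preceding lemmas ask for. The sup bound gives |u| \<le> c1 Q on the
  ball of radius 2 R; the oscillation lemma is then applied around every point of the ball of radius
  \<open>R\<close>, and the distance of two points selects the scale.\<close>

lemma minimizer_holder:
  "\<exists>\<alpha> c :: real. 0 < \<alpha> \<and> \<alpha> < 1 \<and> 0 < c \<and>
    (\<forall>(\<Omega> :: (real ^ 'n) set) (M :: real) (u :: real ^ 'n \<Rightarrow> real).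
       open \<Omega> \<longrightarrow> connected \<Omega> \<longrightarrow> \<Omega> \<noteq> {} \<longrightarrow> bounded \<Omega> \<longrightarrow> M > 0 \<longrightarrow> is_minimizer s p M \<Omega> u \<longrightarrow>
       (\<exists>w :: real ^ 'n \<Rightarrow> real. (AE x in lebesgue. w x = u x) \<and>
          (\<forall>x\<^sub>0 R. R > 0 \<longrightarrow> ball x\<^sub>0 (4 * R) \<subseteq> \<Omega> \<longrightarrow>
             holder_seminorm \<alpha> (ball x\<^sub>0 R) w \<le>
               ennreal (c / R powr \<alpha> *
                 (tail s p u x\<^sub>0 (2 * R)
                  + (1 / measure lebesgue (ball x\<^sub>0 (4 * R))
                      * (LINT x:ball x\<^sub>0 (4 * R)|lebesgue. \<bar>u x\<bar> powr p)) powr (1 / p)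
                  + M powr (1 / p) * R powr s)))))"
proof -
  let ?n = "real CARD('n)"
  let ?sp = "s * p"
  let ?V = "unit_ball_vol ?n"
  obtain C where C_pos: "C > 0" and dgC: "\<forall>M (\<Omega>::(real^'n) set) u. 0 \<le> M \<longrightarrow> quasi_minimizer M \<Omega> u \<longrightarrow> de_giorgi C M \<Omega> u"
    using quasi_minimizer_imp_de_giorgi[where 'a = "real^'n"] by blast
  have C0: "0 \<le> C" using C_pos by simp
  \<comment> \<open>The sup bound is used with radius 2 R, and M (2R)^(sp) is 2^(sp) times M
    R^(sp).\<close>
  define K where "K = (2::real) powr ?sp"
  have K1: "1 \<le> K" unfolding K_def using sp0 by (intro ge_one_powr_ge_zero) auto
  then have K0: "0 \<le> K" by simp
  obtain \<epsilon> where \<epsilon>: "\<epsilon> > 0" and sup: "\<forall>M (\<Omega>::(real^'n) set) u x0 r k0 h.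
    0 \<le> M \<longrightarrow> de_giorgi C M \<Omega> u \<longrightarrow> 0 < r \<longrightarrow> 0 < h \<longrightarrow> ball x0 (2 * r) \<subseteq> \<Omega> \<longrightarrow> M * r powr (s * p) \<le> K * h powr p \<longrightarrow>
    (\<integral>\<^sup>+y\<in>- ball x0 r. ennreal (max (u y - k0) 0 powr (p - 1) * ker (y - x0)) \<partial>lborel)
      \<le> ennreal (K * h powr (p - 1) * r powr - (s * p)) \<longrightarrow>
    (\<integral>\<^sup>+x\<in>ball x0 (2 * r). ennreal (max (u x - k0) 0 powr p) \<partial>lborel) \<le> ennreal (\<epsilon> * h powr p * r powr DIM(real^'n)) \<longrightarrow>
    (AE x in lborel. x \<in> ball x0 r \<longrightarrow> u x \<le> k0 + h)"
    using de_giorgi_sup_bound[OF C0 K0, where 'a = "real^'n"] by (elim exE conjE)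
  obtain \<alpha> A where \<alpha>: "0 < \<alpha>" "\<alpha> < 1" and A: "0 < A" and osc: "\<forall>M (\<Omega>::(real^'n) set) u x0 r S.
    0 \<le> M \<longrightarrow> de_giorgi C M \<Omega> u \<longrightarrow> de_giorgi C M \<Omega> (\<lambda>x. - u x) \<longrightarrow> 0 < r \<longrightarrow> 0 < S \<longrightarrow> ball x0 r \<subseteq> \<Omega> \<longrightarrow>
    M * r powr (s * p) \<le> S powr p \<longrightarrow>
    (AE y in lborel. y \<in> ball x0 r \<longrightarrow> \<bar>u y\<bar> \<le> S) \<longrightarrow>
    (\<integral>\<^sup>+y\<in>- ball x0 r. ennreal (\<bar>u y\<bar> powr (p - 1) * ker (y - x0)) \<partial>lborel)
      \<le> ennreal (S powr (p - 1) * r powr - (s * p)) \<longrightarrow>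
    (\<forall>j::nat. \<exists>b. AE y in lborel. y \<in> ball x0 (r / 4 ^ j) \<longrightarrow> b \<le> u y \<and> u y \<le> b + A * S * ((1/4) ^ j) powr \<alpha>)"
    using de_giorgi_oscillation[OF C0, where 'a = "real^'n"] by (elim exE conjE)
  obtain C2 where C2_pos: "C2 > 0" and C2: "\<forall>(x::real^'n) \<rho>. \<rho> > 0 \<longrightarrow>
    (\<integral>\<^sup>+y\<in>- ball x \<rho>. ennreal (ker (y - x)) \<partial>lborel) \<le> ennreal (C2 * \<rho> powr - ?sp)"
    using far_ker_integral[where 'a = "real^'n"] by blast
  \<comment> \<open>The ball of radius 4 R has measure \<open>?V * 2 powr ?n\<close> times (2R)^n,
    so \<open>c1\<close> is what makes the mean over it satisfy the \<epsilon>-smallness for height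
    c1 Q.\<close>
  define c1 where "c1 = max 1 ((?V * 2 powr ?n / \<epsilon>) powr (1 / p))"
  have V: "0 < ?V" by (simp add: unit_ball_vol_pos)
  have c1: "1 \<le> c1" "?V * 2 powr ?n \<le> \<epsilon> * c1 powr p"
  proof -
    show "1 \<le> c1" by (simp add: c1_def)
    have nn: "0 \<le> ?V * 2 powr ?n / \<epsilon>" using V \<epsilon> by (intro divide_nonneg_pos mult_nonneg_nonneg) auto
    have "1 / p * p = 1" using p2 by simp
    then have "?V * 2 powr ?n / \<epsilon> = ((?V * 2 powr ?n / \<epsilon>) powr (1 / p)) powr p"
      unfolding powr_powr using powr_one[OF nn] by (simp only:)
    also have "\<dots> \<le> c1 powr p" unfolding c1_def using p2 by (intro powr_mono2) auto
    finally show "?V * 2 powr ?n \<le> \<epsilon> * c1 powr p" using \<epsilon> by (simp add: divide_le_eq mult.commute)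
  qed
  \<comment> \<open>The normalization after moving the centre from \<open>x0\<close> to another
    point: inside the ball of radius 2 R the new tail is bounded by c1 Q and a kernel integral, and
    outside it the change of centre costs 2^(n + sp).\<close>
  define c2 where "c2 = max c1 (c1 powr (p - 1) * C2 + 2 powr (?n + ?sp))"
  have c2: "1 \<le> c2" "c1 \<le> c2" "c1 powr (p - 1) * C2 + 2 powr (?n + ?sp) \<le> c2 powr (p - 1)"
  proof -
    show "1 \<le> c2" "c1 \<le> c2" using c1 by (auto simp: c2_def)
    have "c1 powr (p - 1) * C2 + 2 powr (?n + ?sp) \<le> c2" by (simp add: c2_def)
    also have "\<dots> \<le> c2 powr (p - 1)" using powr_mono[of 1 "p - 1" c2] \<open>1 \<le> c2\<close> p2 by simp
    finally show "c1 powr (p - 1) * C2 + 2 powr (?n + ?sp) \<le> c2 powr (p - 1)" .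
  qed
  \<comment> \<open>The first summand serves pairs closer than \<open>R\<close>, where replacing a
    power of 1/4 by the distance costs at most a factor 4; the second serves all other pairs,
    through the sup bound at both points.\<close>
  define c where "c = 4 * A * c2 + 2 * c2"
  have c: "0 < c" using A c2 by (simp add: c_def add_pos_pos)
  have "\<exists>w. (AE x in lebesgue. w x = u x) \<and>
          (\<forall>x\<^sub>0 R. R > 0 \<longrightarrow> ball x\<^sub>0 (4 * R) \<subseteq> \<Omega> \<longrightarrow>
             holder_seminorm \<alpha> (ball x\<^sub>0 R) w \<le>
               ennreal (c / R powr \<alpha> *
                 (tail s p u x\<^sub>0 (2 * R)
                  + (1 / measure lebesgue (ball x\<^sub>0 (4 * R))
                      * (LINT x:ball x\<^sub>0 (4 * R)|lebesgue. \<bar>u x\<bar> powr p)) powr (1 / p)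
                  + M powr (1 / p) * R powr s)))"
    if \<Omega>: "open \<Omega>" "bounded \<Omega>" and M: "M > 0" and min: "is_minimizer s p M \<Omega> u"
    for \<Omega> M and u :: "real ^ 'n \<Rightarrow> real"
  proof -
    have uS: "u \<in> frac_sobolev s p" using min by (auto simp: is_minimizer_def admissible_def)
    then have "u \<in> borel_measurable (completion lborel)" by (simp add: frac_sobolev_def)
    from completion_ex_borel_measurable_real[OF this] obtain u' where
      u': "u' \<in> borel_measurable lborel" and ae: "AE x in lborel. u x = u' x" by blast
    have u'm[measurable]: "u' \<in> borel_measurable borel" using u' by simp
    have qm: "quasi_minimizer M \<Omega> u'" by (rule minimizer_imp_quasi_minimizer[OF min \<Omega> u'm ae])
    have dg: "de_giorgi C M \<Omega> u'" "de_giorgi C M \<Omega> (\<lambda>x. - u' x)"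
      using dgC M qm quasi_minimizer_uminus[OF qm] by auto
    define Q where "Q x0 R = tail s p u x0 (2 * R) + (1 / measure lebesgue (ball x0 (4 * R))
                      * (LINT x:ball x0 (4 * R)|lebesgue. \<bar>u x\<bar> powr p)) powr (1 / p) + M powr (1 / p) * R powr s" for x0 R
    have Qpos: "0 < Q x0 R" if "0 < R" for x0 R
      unfolding Q_def using M that by (intro add_nonneg_pos add_nonneg_nonneg) (auto simp: tail_def)
    have bnd: "AE y in lborel. y \<in> ball x0 (2 * R) \<longrightarrow> \<bar>u' y\<bar> \<le> c1 * Q x0 R"
      and tl: "(\<integral>\<^sup>+y\<in>- ball x0 (2 * R). ennreal (\<bar>u' y\<bar> powr (p - 1) * ker (y - x0)) \<partial>lborel) \<le> ennreal (Q x0 R powr (p - 1) * (2 * R) powr - ?sp)"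
      and MQ: "M * R powr ?sp \<le> Q x0 R powr p"
      if R: "0 < R" and B: "ball x0 (4 * R) \<subseteq> \<Omega>" for x0 R
    proof -
      define T where "T = tail s p u x0 (2 * R)"
      define a where "a = (1 / measure lebesgue (ball x0 (4 * R)) * (LINT x:ball x0 (4 * R)|lebesgue. \<bar>u x\<bar> powr p)) powr (1 / p)"
      define m where "m = M powr (1 / p) * R powr s"
      have nn: "0 \<le> T" "0 \<le> a" "0 \<le> m" by (auto simp: T_def tail_def a_def m_def)
      have Qe: "Q x0 R = T + a + m" by (simp add: Q_def T_def a_def m_def)
      have le: "T \<le> Q x0 R" "a \<le> Q x0 R" "m \<le> Q x0 R" using nn by (auto simp: Qe)
      have "M * R powr ?sp = m powr p" unfolding m_def powr_mult powr_powr using p2 M by simp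
      also have "\<dots> \<le> Q x0 R powr p" using le nn p2 by (intro powr_mono2) auto
      finally show MQ: "M * R powr ?sp \<le> Q x0 R powr p" .
      have "(\<integral>\<^sup>+y\<in>- ball x0 (2 * R). ennreal (\<bar>u' y\<bar> powr (p - 1) * ker (y - x0)) \<partial>lborel) = ennreal (T powr (p - 1) * (2 * R) powr - ?sp)"
        unfolding T_def using R by (intro nn_integral_tail[OF uS u'm ae]) auto
      also have "\<dots> \<le> ennreal (Q x0 R powr (p - 1) * (2 * R) powr - ?sp)"
        using le nn p2 by (intro ennreal_leI mult_right_mono powr_mono2) auto
      finally show tl: "(\<integral>\<^sup>+y\<in>- ball x0 (2 * R). ennreal (\<bar>u' y\<bar> powr (p - 1) * ker (y - x0)) \<partial>lborel) \<le> \<dots>" .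
      let ?h = "c1 * Q x0 R"
      have h: "Q x0 R \<le> ?h" "0 < ?h" using c1 Qpos[OF R, of x0] by auto
      have one: "AE y in lborel. y \<in> ball x0 (2 * R) \<longrightarrow> v y \<le> 0 + ?h"
        if v: "de_giorgi C M \<Omega> v" "\<And>y. \<bar>v y\<bar> = \<bar>u' y\<bar>" for v
      proof (rule sup[rule_format, of M \<Omega>])
        show "0 \<le> M" "de_giorgi C M \<Omega> v" "0 < 2 * R" "0 < ?h" using M v R h by auto
        show "ball x0 (2 * (2 * R)) \<subseteq> \<Omega>" using B by simp
        have "M * (2 * R) powr ?sp = K * (M * R powr ?sp)" by (simp add: K_def powr_mult)
        also have "\<dots> \<le> K * Q x0 R powr p" using K0 by (intro mult_left_mono MQ) auto
        also have "\<dots> \<le> K * ?h powr p" using K0 h p2 Qpos[OF R, of x0] by (intro mult_left_mono powr_mono2) auto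
        finally show "M * (2 * R) powr ?sp \<le> K * ?h powr p" .
        have mx: "max (v y - 0) 0 \<le> \<bar>u' y\<bar>" for y using v(2)[of y] by auto
        have "(\<integral>\<^sup>+y\<in>- ball x0 (2 * R). ennreal (max (v y - 0) 0 powr (p - 1) * ker (y - x0)) \<partial>lborel)
           \<le> (\<integral>\<^sup>+y\<in>- ball x0 (2 * R). ennreal (\<bar>u' y\<bar> powr (p - 1) * ker (y - x0)) \<partial>lborel)"
          using p2 by (intro nn_integral_mono mult_right_mono ennreal_leI powr_mono2 mx) auto
        also note tl
        also have "ennreal (Q x0 R powr (p - 1) * (2 * R) powr - ?sp) \<le> ennreal (K * ?h powr (p - 1) * (2 * R) powr - ?sp)"
        proof (intro ennreal_leI mult_right_mono)
          have "1 * Q x0 R powr (p - 1) \<le> K * ?h powr (p - 1)"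
            using K1 h p2 Qpos[OF R, of x0] by (intro mult_mono powr_mono2) auto
          then show "Q x0 R powr (p - 1) \<le> K * ?h powr (p - 1)" by simp
        qed auto
        finally show "(\<integral>\<^sup>+y\<in>- ball x0 (2 * R). ennreal (max (v y - 0) 0 powr (p - 1) * ker (y - x0)) \<partial>lborel)
           \<le> ennreal (K * ?h powr (p - 1) * (2 * R) powr - ?sp)" .
        have "(\<integral>\<^sup>+x\<in>ball x0 (2 * (2 * R)). ennreal (max (v x - 0) 0 powr p) \<partial>lborel)
           \<le> (\<integral>\<^sup>+x\<in>ball x0 (4 * R). ennreal (\<bar>u' x\<bar> powr p) \<partial>lborel)"
          using p2 mx by (intro nn_integral_mono) (auto simp: indicator_def intro!: ennreal_leI powr_mono2)
        also have "\<dots> = ennreal (?V * (4 * R) powr ?n * a powr p)"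
          unfolding a_def using R by (intro nn_integral_ball_powr[OF uS ae]) auto
        also have "\<dots> \<le> ennreal (\<epsilon> * ?h powr p * (2 * R) powr real DIM(real^'n))"
        proof (rule ennreal_leI)
          have "?V * (4 * R) powr ?n * a powr p = (?V * 2 powr ?n) * a powr p * (2 * R) powr ?n"
            using powr_mult[of 2 "2 * R" ?n] by (simp add: mult_ac)
          also have "\<dots> \<le> (\<epsilon> * c1 powr p) * Q x0 R powr p * (2 * R) powr ?n"
            using le nn p2 \<epsilon> by (intro mult_right_mono mult_mono[OF c1(2)] powr_mono2) auto
          also have "\<dots> = \<epsilon> * ?h powr p * (2 * R) powr real DIM(real^'n)" by (simp add: powr_mult)
          finally show "?V * (4 * R) powr ?n * a powr p \<le> \<epsilon> * ?h powr p * (2 * R) powr real DIM(real^'n)" .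
        qed
        finally show "(\<integral>\<^sup>+x\<in>ball x0 (2 * (2 * R)). ennreal (max (v x - 0) 0 powr p) \<partial>lborel) \<le> ennreal (\<epsilon> * ?h powr p * (2 * R) powr real DIM(real^'n))" .
      qed
      have "AE y in lborel. y \<in> ball x0 (2 * R) \<longrightarrow> u' y \<le> 0 + ?h" by (rule one[OF dg(1)]) simp
      moreover have "AE y in lborel. y \<in> ball x0 (2 * R) \<longrightarrow> - u' y \<le> 0 + ?h" by (rule one[OF dg(2)]) simp
      ultimately show "AE y in lborel. y \<in> ball x0 (2 * R) \<longrightarrow> \<bar>u' y\<bar> \<le> c1 * Q x0 R"
        by eventually_elim auto
    qed
    have local_osc: "\<exists>b. AE y in lborel. y \<in> ball x (R / 4 ^ j) \<longrightarrow> b \<le> u' y \<and> u' y \<le> b + A * (c2 * Q x0 R) * ((1/4) ^ j) powr \<alpha>"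
      if R: "0 < R" and B: "ball x0 (4 * R) \<subseteq> \<Omega>" and x: "x \<in> ball x0 R" for x0 x R and j :: nat
    proof -
      let ?Q = "Q x0 R"
      have Q: "0 < ?Q" by (rule Qpos[OF R])
      have sub: "ball x R \<subseteq> ball x0 (2 * R)"
      proof
        fix y assume "y \<in> ball x R"
        then show "y \<in> ball x0 (2 * R)" using x dist_triangle[of x0 y x] by simp
      qed
      have "\<forall>j::nat. \<exists>b. AE y in lborel. y \<in> ball x (R / 4 ^ j) \<longrightarrow> b \<le> u' y \<and> u' y \<le> b + A * (c2 * ?Q) * ((1/4) ^ j) powr \<alpha>"
      proof (rule allI, rule osc[rule_format, of M \<Omega>])
        show "0 \<le> M" "de_giorgi C M \<Omega> u'" "de_giorgi C M \<Omega> (\<lambda>x. - u' x)" "0 < R" "0 < c2 * ?Q"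
          using M dg R Q c2 by auto
        show "ball x R \<subseteq> \<Omega>" using sub B R subset_ball[of "2 * R" "4 * R" x0] by auto
        have Qc: "?Q \<le> c2 * ?Q" "c1 * ?Q \<le> c2 * ?Q" using c2 Q by (auto intro: mult_right_mono)
        have "?Q powr p \<le> (c2 * ?Q) powr p" using Qc Q p2 by (intro powr_mono2) auto
        then show "M * R powr ?sp \<le> (c2 * ?Q) powr p" using MQ[OF R B] by linarith
        show "AE y in lborel. y \<in> ball x R \<longrightarrow> \<bar>u' y\<bar> \<le> c2 * ?Q"
          using bnd[OF R B] by eventually_elim (use sub Qc in force)
        let ?f = "\<lambda>y. ennreal ((c1 * ?Q) powr (p - 1)) * (ennreal (ker (y - x)) * indicator (- ball x R) y)"
        let ?g = "\<lambda>y. ennreal (2 powr (?n + ?sp)) * (ennreal (\<bar>u' y\<bar> powr (p - 1) * ker (y - x0)) * indicator (- ball x0 (2 * R)) y)"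
        have "(\<integral>\<^sup>+y\<in>- ball x R. ennreal (\<bar>u' y\<bar> powr (p - 1) * ker (y - x)) \<partial>lborel) \<le> (\<integral>\<^sup>+y. ?f y + ?g y \<partial>lborel)"
        proof (rule nn_integral_mono_AE, use bnd[OF R B] in eventually_elim)
          case (elim y)
          show ?case
          proof (cases "y \<in> ball x0 (2 * R)")
            case True
            then have "\<bar>u' y\<bar> powr (p - 1) \<le> (c1 * ?Q) powr (p - 1)" using elim p2 by (intro powr_mono2) auto
            then have "\<bar>u' y\<bar> powr (p - 1) * ker (y - x) \<le> (c1 * ?Q) powr (p - 1) * ker (y - x)" by (intro mult_right_mono) auto
            then have "ennreal (\<bar>u' y\<bar> powr (p - 1) * ker (y - x)) \<le> ennreal ((c1 * ?Q) powr (p - 1)) * ennreal (ker (y - x))"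
              by (subst ennreal_mult[symmetric]) (auto intro: ennreal_leI)
            then show ?thesis using True by (simp add: indicator_def)
          next
            case False
            have "dist y x0 \<le> dist y x + dist x x0" by (rule dist_triangle)
            \<comment> \<open>As \<open>x\<close> is within \<open>R\<close> of \<open>x0\<close>
              while \<open>y\<close> is at least 2 R away from it, the distance from
              \<open>y\<close> to \<open>x\<close> is at least half of that to
              \<open>x0\<close>.\<close>
            then have d: "dist y x0 / 2 \<le> dist y x" "0 < dist y x0" using False x R by (auto simp: dist_commute)
            have "ker (y - x) \<le> 1 / (dist y x0 / 2) powr (?n + ?sp)"
              unfolding ker_def dist_norm[symmetric] DIM_cart using d sp0
              by (auto intro!: divide_left_mono powr_mono2 mult_pos_pos)
            also have "\<dots> = 2 powr (?n + ?sp) * ker (y - x0)"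
              by (simp add: ker_def powr_divide dist_norm)
            finally have "\<bar>u' y\<bar> powr (p - 1) * ker (y - x) \<le> \<bar>u' y\<bar> powr (p - 1) * (2 powr (?n + ?sp) * ker (y - x0))"
              by (intro mult_left_mono) auto
            then have "ennreal (\<bar>u' y\<bar> powr (p - 1) * ker (y - x)) \<le> ennreal (2 powr (?n + ?sp)) * ennreal (\<bar>u' y\<bar> powr (p - 1) * ker (y - x0))"
              by (subst ennreal_mult[symmetric]) (auto intro!: ennreal_leI simp: mult_ac)
            then show ?thesis using False by (auto simp: indicator_def intro: add_increasing)
          qed
        qed
        also have "\<dots> = (\<integral>\<^sup>+y. ?f y \<partial>lborel) + (\<integral>\<^sup>+y. ?g y \<partial>lborel)" by (rule nn_integral_add) measurable
        also have "(\<integral>\<^sup>+y. ?f y \<partial>lborel) = ennreal ((c1 * ?Q) powr (p - 1)) * (\<integral>\<^sup>+y\<in>- ball x R. ennreal (ker (y - x)) \<partial>lborel)"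
          by (rule nn_integral_cmult) measurable
        also have "(\<integral>\<^sup>+y. ?g y \<partial>lborel) = ennreal (2 powr (?n + ?sp)) * (\<integral>\<^sup>+y\<in>- ball x0 (2 * R). ennreal (\<bar>u' y\<bar> powr (p - 1) * ker (y - x0)) \<partial>lborel)"
          by (rule nn_integral_cmult) measurable
        also have "ennreal ((c1 * ?Q) powr (p - 1)) * (\<integral>\<^sup>+y\<in>- ball x R. ennreal (ker (y - x)) \<partial>lborel) + \<dots>
           \<le> ennreal ((c1 * ?Q) powr (p - 1)) * ennreal (C2 * R powr - ?sp) + ennreal (2 powr (?n + ?sp)) * ennreal (?Q powr (p - 1) * (2 * R) powr - ?sp)"
          using C2 R by (intro add_mono mult_left_mono tl[OF R B]) auto
        also have "\<dots> = ennreal ((c1 * ?Q) powr (p - 1) * (C2 * R powr - ?sp) + 2 powr (?n + ?sp) * (?Q powr (p - 1) * (2 * R) powr - ?sp))"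
          using C2_pos by (simp add: ennreal_mult[symmetric] ennreal_plus[symmetric] del: ennreal_plus)
        also have "\<dots> \<le> ennreal ((c2 * ?Q) powr (p - 1) * R powr - ?sp)"
        proof (rule ennreal_leI)
          have "(2 * R) powr - ?sp \<le> R powr - ?sp" using R sp0 by (intro powr_mono2') auto
          then have "(c1 * ?Q) powr (p - 1) * (C2 * R powr - ?sp) + 2 powr (?n + ?sp) * (?Q powr (p - 1) * (2 * R) powr - ?sp)
             \<le> (c1 * ?Q) powr (p - 1) * (C2 * R powr - ?sp) + 2 powr (?n + ?sp) * (?Q powr (p - 1) * R powr - ?sp)"
            by (intro add_left_mono mult_left_mono) auto
          also have "\<dots> = (c1 powr (p - 1) * C2 + 2 powr (?n + ?sp)) * (?Q powr (p - 1) * R powr - ?sp)"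
            unfolding powr_mult by (simp add: algebra_simps)
          also have "\<dots> \<le> c2 powr (p - 1) * (?Q powr (p - 1) * R powr - ?sp)"
            by (intro mult_right_mono c2) auto
          finally show "(c1 * ?Q) powr (p - 1) * (C2 * R powr - ?sp) + 2 powr (?n + ?sp) * (?Q powr (p - 1) * (2 * R) powr - ?sp)
             \<le> (c2 * ?Q) powr (p - 1) * R powr - ?sp" by (simp add: powr_mult)
        qed
        finally show "(\<integral>\<^sup>+y\<in>- ball x R. ennreal (\<bar>u' y\<bar> powr (p - 1) * ker (y - x)) \<partial>lborel) \<le> ennreal ((c2 * ?Q) powr (p - 1) * R powr - ?sp)" .
      qed
      then show ?thesis ..
    qed
    \<comment> \<open>One representative for all balls at once, since it does not refer to any of
      them. Outside \<Omega>, where nothing is known about the essential lower limit,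
      \<open>u\<close> itself is kept.\<close>
    define w where "w x = (if x \<in> \<Omega> then ess_lower_limit u' x else u x)" for x
    have small_osc: "\<exists>d>0. \<exists>b. AE y in lborel. y \<in> ball x d \<longrightarrow> b \<le> u' y \<and> u' y \<le> b + e" if x: "x \<in> \<Omega>" and e: "0 < e" for x e
    proof -
      obtain d where d: "0 < d" "ball x d \<subseteq> \<Omega>" using \<Omega>(1) x open_contains_ball by blast
      define R where "R = d / 4"
      have R: "0 < R" "ball x (4 * R) \<subseteq> \<Omega>" using d by (auto simp: R_def)
      define L where "L = A * (c2 * Q x R)"
      have L: "0 < L" using A c2 Qpos[OF R(1), of x] by (simp add: L_def)
      define \<theta> where "\<theta> = (1/4 :: real) powr \<alpha>"
      have "\<theta> < 1" "0 \<le> \<theta>" using \<alpha> powr_less_mono2[of \<alpha> "1/4" 1] by (auto simp: \<theta>_def)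
      then obtain j where j: "\<theta> ^ j < e / L" using real_arch_pow_inv[of "e / L" \<theta>] e L by auto
      have "((1/4 :: real) ^ j) powr \<alpha> = \<theta> ^ j" by (simp add: \<theta>_def powr_power powr_realpow[symmetric] powr_powr mult.commute)
      then have le: "L * ((1/4) ^ j) powr \<alpha> \<le> e" using j L by (simp add: field_simps)
      obtain b where "AE y in lborel. y \<in> ball x (R / 4 ^ j) \<longrightarrow> b \<le> u' y \<and> u' y \<le> b + L * ((1/4) ^ j) powr \<alpha>"
        using local_osc[OF R, of x j] R unfolding L_def by auto
      then have "AE y in lborel. y \<in> ball x (R / 4 ^ j) \<longrightarrow> b \<le> u' y \<and> u' y \<le> b + e"
        by eventually_elim (use le in auto)
      then show ?thesis using R by (intro exI[of _ "R / 4 ^ j"]) auto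
    qed
    have "AE x in lborel. x \<in> \<Omega> \<longrightarrow> ess_lower_limit u' x = u' x"
      by (rule ess_lower_limit_AE_eq) (rule small_osc)
    then have "AE x in lborel. w x = u x"
      using ae by eventually_elim (auto simp: w_def)
    then have "AE x in lebesgue. w x = u x" by (rule AE_completion)
    moreover have "holder_seminorm \<alpha> (ball x0 R) w \<le> ennreal (c / R powr \<alpha> * Q x0 R)"
      if R: "0 < R" and B: "ball x0 (4 * R) \<subseteq> \<Omega>" for x0 R
    proof -
      let ?Q = "Q x0 R"
      have Q: "0 < ?Q" by (rule Qpos[OF R])
      have w_bounds: "b \<le> w x \<and> w x \<le> b'"
        if U: "open U" "U \<subseteq> \<Omega>" "x \<in> U" "AE y in lborel. y \<in> U \<longrightarrow> b \<le> u' y \<and> u' y \<le> b'" for U x b b'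
      proof -
        obtain d where d: "0 < d" "ball x d \<subseteq> U" using U open_contains_ball by blast
        have "AE y in lborel. y \<in> ball x d \<longrightarrow> b \<le> u' y \<and> u' y \<le> b'"
          using U(4) by eventually_elim (use d in blast)
        from ess_lower_limit_bounds[OF d(1) this] show ?thesis using U by (auto simp: w_def)
      qed
      have "\<bar>w x - w y\<bar> / norm (x - y) powr \<alpha> \<le> c / R powr \<alpha> * ?Q"
        if x: "x \<in> ball x0 R" and y: "y \<in> ball x0 R" and ne: "x \<noteq> y" for x y
      proof -
        define d where "d = norm (x - y)"
        have d: "0 < d" using ne by (simp add: d_def)
        have "\<bar>w x - w y\<bar> \<le> c * ?Q * (d / R) powr \<alpha>"
        proof (cases "d < R")
          case True
          \<comment> \<open>Both points lie in the ball of radius R/4^j around \<open>x\<close>, and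
            (1/4)^j \<le> 4 d/R turns the oscillation at scale \<open>j\<close> into a power of the
            distance.\<close>
          obtain j where j: "R / 4 ^ Suc j \<le> d" "d < R / 4 ^ j" by (rule geometric_scale[OF _ d True]) auto
          obtain b where b: "AE z in lborel. z \<in> ball x (R / 4 ^ j) \<longrightarrow> b \<le> u' z \<and> u' z \<le> b + A * (c2 * ?Q) * ((1/4) ^ j) powr \<alpha>"
            using local_osc[OF R B x, of j] by blast
          have sub: "ball x (R / 4 ^ j) \<subseteq> \<Omega>"
          proof
            fix z assume "z \<in> ball x (R / 4 ^ j)"
            moreover have "R / 4 ^ j \<le> R" using R by (simp add: field_simps)
            ultimately have "z \<in> ball x0 (4 * R)" using x R dist_triangle[of x0 z x] by simp
            then show "z \<in> \<Omega>" using B by blast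
          qed
          have mem: "x \<in> ball x (R / 4 ^ j)" "y \<in> ball x (R / 4 ^ j)" using j R by (auto simp: d_def dist_norm)
          have "\<bar>w x - w y\<bar> \<le> A * (c2 * ?Q) * ((1/4) ^ j) powr \<alpha>"
            using w_bounds[OF open_ball sub mem(1) b] w_bounds[OF open_ball sub mem(2) b] by linarith
          also have "((1/4 :: real) ^ j) powr \<alpha> \<le> (4 * (d / R)) powr \<alpha>"
            using j R \<alpha> by (intro powr_mono2) (auto simp: field_simps)
          also have "(4 * (d / R)) powr \<alpha> \<le> 4 * (d / R) powr \<alpha>"
            unfolding powr_mult[of 4] using \<alpha> powr_mono[of \<alpha> 1 4] by (intro mult_right_mono) auto
          finally have "\<bar>w x - w y\<bar> \<le> A * (c2 * ?Q) * (4 * (d / R) powr \<alpha>)"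
            using A c2 Q by (simp add: mult_left_mono)
          also have "\<dots> \<le> c * ?Q * (d / R) powr \<alpha>"
            unfolding c_def using c2 Q by (simp add: algebra_simps)
          finally show ?thesis .
        next
          case False
          have sub: "ball x0 (2 * R) \<subseteq> \<Omega>" using B R subset_ball[of "2 * R" "4 * R" x0] by auto
          have b: "AE z in lborel. z \<in> ball x0 (2 * R) \<longrightarrow> - (c1 * ?Q) \<le> u' z \<and> u' z \<le> c1 * ?Q"
            using bnd[OF R B] by eventually_elim auto
          have mem: "x \<in> ball x0 (2 * R)" "y \<in> ball x0 (2 * R)" using x y R by auto
          have "\<bar>w x - w y\<bar> \<le> 2 * (c1 * ?Q)"
            using w_bounds[OF open_ball sub mem(1) b] w_bounds[OF open_ball sub mem(2) b] by linarith
          also have "\<dots> \<le> c * ?Q"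
          proof -
            have "2 * c1 \<le> c" using A c2 by (simp add: c_def add_increasing)
            then show ?thesis using Q by (simp add: mult_right_mono mult.assoc[symmetric])
          qed
          also have "\<dots> \<le> c * ?Q * (d / R) powr \<alpha>"
          proof -
            have "1 \<le> (d / R) powr \<alpha>" using False R \<alpha> by (intro ge_one_powr_ge_zero) auto
            then show ?thesis using c Q mult_left_mono[of 1 "(d / R) powr \<alpha>" "c * ?Q"] by simp
          qed
          finally show ?thesis .
        qed
        then have "\<bar>w x - w y\<bar> / d powr \<alpha> \<le> c * ?Q * (d / R) powr \<alpha> / d powr \<alpha>"
          by (intro divide_right_mono) auto
        also have "\<dots> = c / R powr \<alpha> * ?Q" using d by (simp add: powr_divide)
        finally show ?thesis by (simp add: d_def)
      qed
      then show ?thesis unfolding holder_seminorm_def by (intro SUP_least) (auto intro!: ennreal_leI)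
    qed
    ultimately show ?thesis unfolding Q_def by blast
  qed
  then show ?thesis using \<alpha> c by blast
qed

end

theorem theorem1p2:
  fixes p s :: real
  assumes "p \<ge> 2" and "0 < s" and "s < 1"
  shows "\<exists>\<alpha>\<^sub>0 c :: real. 0 < \<alpha>\<^sub>0 \<and> \<alpha>\<^sub>0 < 1 \<and> 0 < c \<and>
    (\<forall>(\<Omega> :: (real ^ 'n) set) (M :: real) (u :: real ^ 'n \<Rightarrow> real).
       open \<Omega> \<longrightarrow> connected \<Omega> \<longrightarrow> \<Omega> \<noteq> {} \<longrightarrow> bounded \<Omega> \<longrightarrow> M > 0 \<longrightarrow> is_minimizer s p M \<Omega> u \<longrightarrow>
       (\<exists>w :: real ^ 'n \<Rightarrow> real. (AE x in lebesgue. w x = u x) \<and>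
          (\<forall>x\<^sub>0 R. R > 0 \<longrightarrow> ball x\<^sub>0 (4 * R) \<subseteq> \<Omega> \<longrightarrow>
             holder_seminorm \<alpha>\<^sub>0 (ball x\<^sub>0 R) w \<le>
               ennreal (c / R powr \<alpha>\<^sub>0 *
                 (tail s p u x\<^sub>0 (2 * R)
                  + (1 / measure lebesgue (ball x\<^sub>0 (4 * R))
                      * (LINT x:ball x\<^sub>0 (4 * R)|lebesgue. \<bar>u x\<bar> powr p)) powr (1 / p)
                  + M powr (1 / p) * R powr s)))))"
proof -
  interpret fractional_energy s p
    by unfold_locales (use assms in auto)
  show ?thesis by (rule minimizer_holder)
qed

end
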